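(* Let $s>2$ be an integer and let $\mathcal{C}$ be a family of plane algebraic curves in $\mathbb{R}^2$ of bounded degree, with constant multiplicity type and $s$ degrees of freedom. Then in any set $P$ of $n$ points in $\mathbb{R}^2$ there exists a subset of $\Omega(n^{1-1/s})$ points of $P$ all incident to a single curve of $\mathcal{C}$, or a subset of $\Omega(n^{1/s})$ points of $P$ such that at most $s$ of them lie on any curve of $\mathcal{C}$.
   Context: The number of degrees of freedom of a family $\mathcal{C}$ of algebraic curves is the minimum value $s$ such that for any $s$ points in $\mathbb{R}^2$ there are at most $c$ curves of $\mathcal{C}$ passing through all of them, for some constant $c$. The family has multiplicity type $r$ if any two distinct curves of $\mathcal{C}$ intersect in at most $r$ points; constant multiplicity type means $r$ is a constant. The constants implicit in $\Omega(\cdot)$ depend only on the family $\mathcal{C}$ (its degree bound, $s$, $r$, $c$), not on $n$ or $P$. *)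

theory Defs
  imports Complex_Main "HOL-Computational_Algebra.Polynomial"
begin

text \<open>
  A real polynomial in two variables is represented as \<^typ>\<open>real poly poly\<close>: the outer variable
  is the second coordinate \<open>y\<close>, and the coefficients are polynomials in the first coordinate \<open>x\<close>.
\<close>

definition eval2 :: "real poly poly \<Rightarrow> real \<times> real \<Rightarrow> real" where
  "eval2 p z = poly (poly p [:snd z:]) (fst z)"

text \<open>
  The maximum may range over indices with zero coefficient: such an index contributes \<open>i\<close>, which is
  at most the contribution of the leading coefficient. In particular the zero polynomial gets 0.
\<close>

definition total_degree :: "real poly poly \<Rightarrow> nat" where
  "total_degree p = (MAX i\<in>{..degree p}. degree (coeff p i) + i)"

text \<open>
  Curves are identified with their real point sets; neither irreducibility nor the presence of
  infinitely many real points is required.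
\<close>

definition algebraic_curve_of_degree_le :: "nat \<Rightarrow> (real \<times> real) set \<Rightarrow> bool" where
  "algebraic_curve_of_degree_le d \<gamma> \<longleftrightarrow>
     (\<exists>p. 0 < total_degree p \<and> total_degree p \<le> d \<and> \<gamma> = {z. eval2 p z = 0})"

definition multiplicity_type :: "(real \<times> real) set set \<Rightarrow> nat \<Rightarrow> bool" where
  "multiplicity_type C r \<longleftrightarrow>
     (\<forall>\<gamma>\<in>C. \<forall>\<delta>\<in>C. \<gamma> \<noteq> \<delta> \<longrightarrow> finite (\<gamma> \<inter> \<delta>) \<and> card (\<gamma> \<inter> \<delta>) \<le> r)"

definition at_most_curves_through :: "(real \<times> real) set set \<Rightarrow> nat \<Rightarrow> nat \<Rightarrow> bool" where
  "at_most_curves_through C s c \<longleftrightarrow>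
     (\<forall>S. finite S \<and> card S = s \<longrightarrow>
        finite {\<gamma> \<in> C. S \<subseteq> \<gamma>} \<and> card {\<gamma> \<in> C. S \<subseteq> \<gamma>} \<le> c)"

text \<open>Meaningful only for families admitting some pair \<open>s\<close>, \<open>c\<close>.\<close>

definition degrees_of_freedom :: "(real \<times> real) set set \<Rightarrow> nat" where
  "degrees_of_freedom C = (LEAST s. \<exists>c. at_most_curves_through C s c)"

end

theory Submission
  imports Defs "HOL-Analysis.Analysis" "Subresultants.Subresultant_Gcd"
    "HOL-Computational_Algebra.Squarefree" "HOL-Computational_Algebra.Field_as_Ring"
begin

text \<open>
  Suppose every curve contains fewer than \<open>n\<^bsup>1-1/s\<^esup>\<close> points of \<open>P\<close>. It suffices that only \<open>O(n\<^sup>s)\<close> of the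
  \<open>(s+1)\<close>-subsets of \<open>P\<close> lie on a curve: some \<open>t\<close>-subset with \<open>t\<close> about \<open>n\<^bsup>1/s\<^esup>\<close> then contains at most \<open>t/2\<close>
  of them, and deleting a point of each leaves a set with at most \<open>s\<close> points on any curve.

  The number of \<open>(s+1)\<close>-subsets is controlled by the number \<open>m\<close> of curves with at least \<open>k\<close> points, for
  which the incidence bound \<open>m = O(n\<^sup>s/k\<^bsup>2s-1\<^esup> + k)\<close> is proved by cuttings: the vertical decomposition of a
  random sample of \<open>u\<close> of these curves has \<open>O(u\<^sup>2)\<close> cells, each determined by at most four curves of the
  sample, so by backward analysis an average point lies in a cell met by \<open>O(m/u)\<close> curves, and an average curve
  meets \<open>O(u)\<close> cells. With \<open>u\<close> a small multiple of \<open>k\<close>, counting in every cell the \<open>s\<close>-subsets that lie on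
  curves gives the bound. It is summable against \<open>k\<^sup>s\<close> because \<open>s > 2\<close>.

  The vertical decomposition only needs that the real roots of a bivariate polynomial in \<open>y\<close> are continuous
  functions of \<open>x\<close> away from boundedly many values of \<open>x\<close>. These are the zeros of the content, of the leading
  coefficient and of the discriminant of the squarefree part.
\<close>

section \<open>Cuttings and counting\<close>

text \<open>The summand \<open>k\<close> of the incidence bound is the delicate one: against k^s it
  gives k^(s+1), whose sum up to n^(1-1/s) exceeds n^s. It is used only while k^2 < 4rn; for larger
  \<open>k\<close> a second-moment argument gives mk <= 2n. The resulting terms 2n k^(s-1) sum to at
  most 2n L^s, where \<open>L\<close> bounds the number of points on a curve, and L^s <= n^(s-1) is
  exactly the threshold n^(1-1/s). The sample size is tied to \<open>k\<close> because a curve meets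
  O(u) cells on average while the \<open>s\<close>-subsets do not see the first few points in a
  cell: \<open>k\<close> must exceed the O(su) incidences lost in this way. Curves may be reducible,
  contain vertical lines, touch, or cross above points of \<open>P\<close>; no general position is
  available. The decomposition is therefore not a subdivision of the plane but an equivalence
  relation on points of \<open>P\<close>: only the vertical lines through \<open>P\<close> are
  inspected, coinciding roots are ordered by an arbitrary numbering of the curves, and a crossing
  matters only through the change of adjacency between two consecutive inspected lines.\<close>

lemma real_card_Diff:
  assumes "finite A" "finite B"
  shows "real (card (A - B)) = real (card A) - real (card B) + real (card (B - A))"
proof -
  have "card A = card (A - B) + card (A \<inter> B)" "card B = card (B - A) + card (A \<inter> B)"
    using assms by (metis Int_commute add.commute card_Int_Diff)+
  thus ?thesis by simp
qed

lemma sum_card_Collect_swap: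
  assumes "finite A" "finite B"
  shows "(\<Sum>a\<in>A. card {b \<in> B. R a b}) = (\<Sum>b\<in>B. card {a \<in> A. R a b})"
proof -
  have "(\<Sum>a\<in>A. card {b \<in> B. R a b}) = (\<Sum>a\<in>A. \<Sum>b\<in>B. if R a b then 1 else 0)"
    using assms by (intro sum.cong refl) (simp add: sum.If_cases Int_def)
  also have "\<dots> = (\<Sum>b\<in>B. \<Sum>a\<in>A. if R a b then 1 else 0)" by (rule sum.swap)
  also have "\<dots> = (\<Sum>b\<in>B. card {a \<in> A. R a b})"
    using assms by (intro sum.cong refl) (simp add: sum.If_cases Int_def)
  finally show ?thesis .
qed

text \<open>\<open>cls R p\<close> is the cell of the point \<open>p\<close> in the decomposition induced by the curves \<open>R\<close>; it is empty
  for points on the curves.\<close>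

locale cell_system =
  fixes \<Gamma> :: "'p set set" and P :: "'p set" and cls :: "'p set set \<Rightarrow> 'p \<Rightarrow> 'p set" and M :: nat
  assumes finite_curves: "finite \<Gamma>" and finite_points: "finite P"
    and cls_subset: "cls R p \<subseteq> P"
    and cls_eq: "R \<subseteq> \<Gamma> \<Longrightarrow> p \<in> P \<Longrightarrow> q \<in> cls R p \<Longrightarrow> cls R q = cls R p"
    and cls_self: "R \<subseteq> \<Gamma> \<Longrightarrow> p \<in> P \<Longrightarrow> p \<notin> \<Union>R \<Longrightarrow> p \<in> cls R p"
    and cls_disjoint: "q \<in> cls R p \<Longrightarrow> q \<notin> \<Union>R"
    and definers: "R \<subseteq> \<Gamma> \<Longrightarrow> p \<in> P \<Longrightarrow>
      \<exists>D\<subseteq>R. card D \<le> 4 \<and> (\<forall>R'. D \<subseteq> R' \<longrightarrow> R' \<subseteq> R \<longrightarrow> cls R' p = cls R p)"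
    and card_cells: "R \<subseteq> \<Gamma> \<Longrightarrow> card (cls R ` P - {{}}) \<le> M * (card R + 1)\<^sup>2"
begin

section \<open>Random samples in an abstract cell system\<close>

definition cells :: "'p set set \<Rightarrow> 'p set set" where
  "cells R = cls R ` P - {{}}"

definition hits :: "'p set set \<Rightarrow> 'p set \<Rightarrow> nat" where
  "hits R Q = card {\<gamma> \<in> \<Gamma> - R. \<gamma> \<inter> Q \<noteq> {}}"

definition subs :: "nat \<Rightarrow> 'p set set set" where
  "subs k = {R. R \<subseteq> \<Gamma> \<and> card R = k}"

lemma finite_cells: "finite (cells R)"
  using finite_points by (simp add: cells_def)

lemma finite_sub: "R \<subseteq> \<Gamma> \<Longrightarrow> finite R"
  using finite_curves finite_subset by blast

lemma finite_subs: "finite (subs k)"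
  using finite_curves by (simp add: subs_def)

lemma cellsE: assumes "Q \<in> cells R" obtains p where "p \<in> P" "Q = cls R p" "Q \<noteq> {}"
  using assms by (auto simp: cells_def)

lemma cells_disjoint:
  assumes "R \<subseteq> \<Gamma>" "Q \<in> cells R" "Q' \<in> cells R" "q \<in> Q" "q \<in> Q'"
  shows "Q = Q'"
  using assms by (auto simp: cells_def dest: cls_eq)

lemma cell_subset: "Q \<in> cells R \<Longrightarrow> Q \<subseteq> P"
  using cls_subset by (auto simp: cells_def)

lemma finite_cell: "Q \<in> cells R \<Longrightarrow> finite Q"
  using cell_subset finite_points finite_subset by blast

lemma cell_avoids: "Q \<in> cells R \<Longrightarrow> \<gamma> \<in> R \<Longrightarrow> \<gamma> \<inter> Q = {}"
  using cls_disjoint by (auto simp: cells_def)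

text \<open>Both sides run over the pairs of a sample and one further curve, indexed by the sample
  before or after the insertion. This change of viewpoint is what backward analysis rests
  on.\<close>

lemma sum_extend:
  "(\<Sum>R\<in>subs k. \<Sum>\<gamma>\<in>\<Gamma> - R. f R \<gamma>) = (\<Sum>R\<in>subs (Suc k). \<Sum>\<gamma>\<in>R. f (R - {\<gamma>}) \<gamma>)"
proof -
  have "(\<Sum>R\<in>subs k. \<Sum>\<gamma>\<in>\<Gamma> - R. f R \<gamma>) = (\<Sum>(R, \<gamma>)\<in>(SIGMA R:subs k. \<Gamma> - R). f R \<gamma>)"
    using finite_subs finite_curves by (subst sum.Sigma) auto
  also have "\<dots> = (\<Sum>(R, \<gamma>)\<in>(SIGMA R:subs (Suc k). R). f (R - {\<gamma>}) \<gamma>)"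
    by (rule sum.reindex_bij_witness[where i = "\<lambda>(R, \<gamma>). (R - {\<gamma>}, \<gamma>)" and j = "\<lambda>(R, \<gamma>). (insert \<gamma> R, \<gamma>)"])
      (auto simp: subs_def finite_sub insert_absorb card_insert_if intro: finite_sub)
  also have "\<dots> = (\<Sum>R\<in>subs (Suc k). \<Sum>\<gamma>\<in>R. f (R - {\<gamma>}) \<gamma>)"
    using finite_subs finite_sub by (subst sum.Sigma) (auto simp: subs_def)
  finally show ?thesis .
qed

text \<open>Removing a curve that is not a definer leaves a set between the definers and
  \<open>R\<close>, which has the same cell.\<close>

lemma card_changing:
  assumes "R \<subseteq> \<Gamma>" "p \<in> P"
  shows "card {\<gamma> \<in> R. cls (R - {\<gamma>}) p \<noteq> cls R p} \<le> 4"
proof -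
  obtain D where D: "D \<subseteq> R" "card D \<le> 4" "\<And>R'. D \<subseteq> R' \<Longrightarrow> R' \<subseteq> R \<Longrightarrow> cls R' p = cls R p"
    using definers[OF assms] by metis
  have "{\<gamma> \<in> R. cls (R - {\<gamma>}) p \<noteq> cls R p} \<subseteq> D"
  proof
    fix \<gamma> assume \<gamma>: "\<gamma> \<in> {\<gamma> \<in> R. cls (R - {\<gamma>}) p \<noteq> cls R p}"
    show "\<gamma> \<in> D"
    proof (rule ccontr)
      assume "\<gamma> \<notin> D"
      hence "D \<subseteq> R - {\<gamma>}" using D(1) by blast
      from D(3)[OF this] \<gamma> show False by auto
    qed
  qed
  hence "card {\<gamma> \<in> R. cls (R - {\<gamma>}) p \<noteq> cls R p} \<le> card D"
    using D(1) finite_sub[OF assms(1)] by (intro card_mono) (auto intro: finite_subset)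
  with D(2) show ?thesis by linarith
qed

definition weight :: "'p set set \<Rightarrow> nat" where
  "weight R = (\<Sum>Q\<in>cells R. card Q * hits R Q)"

definition total_hits :: "'p set set \<Rightarrow> nat" where
  "total_hits R = (\<Sum>Q\<in>cells R. hits R Q)"

text \<open>A curve hitting a cell removes a point from it, so all points of that cell have a
  different cell after the insertion.\<close>

lemma weight_le:
  assumes R: "R \<subseteq> \<Gamma>"
  shows "weight R \<le> (\<Sum>\<gamma>\<in>\<Gamma> - R. card {p \<in> P. cls (insert \<gamma> R) p \<noteq> cls R p})"
proof -
  have "weight R = (\<Sum>Q\<in>cells R. \<Sum>\<gamma>\<in>\<Gamma> - R. if \<gamma> \<inter> Q \<noteq> {} then card Q else 0)"
    unfolding weight_def hits_def using finite_curves
    by (intro sum.cong refl) (simp add: sum.If_cases Int_def)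
  also have "\<dots> = (\<Sum>\<gamma>\<in>\<Gamma> - R. \<Sum>Q\<in>cells R. if \<gamma> \<inter> Q \<noteq> {} then card Q else 0)" by (rule sum.swap)
  also have "\<dots> \<le> (\<Sum>\<gamma>\<in>\<Gamma> - R. card {p \<in> P. cls (insert \<gamma> R) p \<noteq> cls R p})"
  proof (rule sum_mono)
    fix \<gamma> assume \<gamma>: "\<gamma> \<in> \<Gamma> - R"
    let ?C = "{Q \<in> cells R. \<gamma> \<inter> Q \<noteq> {}}"
    have "(\<Sum>Q\<in>cells R. if \<gamma> \<inter> Q \<noteq> {} then card Q else 0) = (\<Sum>Q\<in>?C. card Q)"
      using finite_cells by (simp add: sum.If_cases Int_def)
    also have "\<dots> = card (\<Union>?C)"
    proof (rule card_Union_disjoint[symmetric])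
      show "pairwise disjnt ?C" using cells_disjoint[OF R] by (auto simp: pairwise_def disjnt_def)
    qed (use finite_cell in auto)
    also have "\<dots> \<le> card {p \<in> P. cls (insert \<gamma> R) p \<noteq> cls R p}"
    proof (rule card_mono)
      show "\<Union>?C \<subseteq> {p \<in> P. cls (insert \<gamma> R) p \<noteq> cls R p}"
      proof
        fix p assume "p \<in> \<Union>?C"
        then obtain Q q where Q: "Q \<in> cells R" "p \<in> Q" "q \<in> \<gamma>" "q \<in> Q" by blast
        from Q(1) obtain p' where p': "p' \<in> P" "Q = cls R p'" by (rule cellsE)
        hence "cls R p = Q" using cls_eq[OF R p'(1)] Q(2) by simp
        hence "q \<in> cls R p" using Q(4) by simp
        moreover have "q \<notin> cls (insert \<gamma> R) p" using Q(3) cls_disjoint by blast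
        ultimately show "p \<in> {p \<in> P. cls (insert \<gamma> R) p \<noteq> cls R p}" using Q cell_subset by auto
      qed
    qed (use finite_points in simp)
    finally show "(\<Sum>Q\<in>cells R. if \<gamma> \<inter> Q \<noteq> {} then card Q else 0) \<le> card {p \<in> P. cls (insert \<gamma> R) p \<noteq> cls R p}" .
  qed
  finally show ?thesis .
qed

text \<open>Backward analysis: a curve added last changes the cell of a given point only if it is one of the
  at most four definers of the new cell.\<close>

lemma sum_weight_le: "(\<Sum>R\<in>subs k. weight R) \<le> 4 * card P * card (subs (Suc k))"
proof -
  have "(\<Sum>R\<in>subs k. weight R) \<le> (\<Sum>R\<in>subs k. \<Sum>\<gamma>\<in>\<Gamma> - R. card {p \<in> P. cls (insert \<gamma> R) p \<noteq> cls R p})"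
    by (intro sum_mono weight_le) (simp add: subs_def)
  also have "\<dots> = (\<Sum>R\<in>subs (Suc k). \<Sum>\<gamma>\<in>R. card {p \<in> P. cls (insert \<gamma> (R - {\<gamma>})) p \<noteq> cls (R - {\<gamma>}) p})"
    by (rule sum_extend)
  also have "\<dots> = (\<Sum>R\<in>subs (Suc k). \<Sum>\<gamma>\<in>R. card {p \<in> P. cls (R - {\<gamma>}) p \<noteq> cls R p})"
    by (intro sum.cong refl arg_cong[of _ _ card] Collect_cong) (simp only: insert_Diff, blast)
  also have "\<dots> = (\<Sum>R\<in>subs (Suc k). \<Sum>p\<in>P. card {\<gamma> \<in> R. cls (R - {\<gamma>}) p \<noteq> cls R p})"
    using finite_points finite_sub by (intro sum.cong refl sum_card_Collect_swap) (auto simp: subs_def)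
  also have "\<dots> \<le> (\<Sum>R\<in>subs (Suc k). \<Sum>p\<in>P. 4)"
    by (intro sum_mono card_changing) (auto simp: subs_def)
  finally show ?thesis by (simp add: mult_ac)
qed

text \<open>Cells avoid the curves of their sample, so a cell hit by \<open>\<gamma>\<close> is
  destroyed when \<open>\<gamma>\<close> is inserted.\<close>

lemma total_hits_le:
  assumes R: "R \<subseteq> \<Gamma>"
  shows "total_hits R \<le> (\<Sum>\<gamma>\<in>\<Gamma> - R. card (cells R - cells (insert \<gamma> R)))"
proof -
  have "total_hits R = (\<Sum>\<gamma>\<in>\<Gamma> - R. card {Q \<in> cells R. \<gamma> \<inter> Q \<noteq> {}})"
    unfolding total_hits_def hits_def using finite_curves finite_cells by (intro sum_card_Collect_swap) auto
  also have "\<dots> \<le> (\<Sum>\<gamma>\<in>\<Gamma> - R. card (cells R - cells (insert \<gamma> R)))"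
  proof (intro sum_mono card_mono)
    fix \<gamma>
    show "{Q \<in> cells R. \<gamma> \<inter> Q \<noteq> {}} \<subseteq> cells R - cells (insert \<gamma> R)"
      using cell_avoids[of _ "insert \<gamma> R" \<gamma>] by blast
  qed (use finite_cells in simp)
  finally show ?thesis .
qed

definition num_cells :: "nat \<Rightarrow> nat" where
  "num_cells k = (\<Sum>R\<in>subs k. card (cells R))"

text \<open>The destroyed cells number the old cells minus the new ones plus the created ones.
  Summed over all insertions, the first two counts become multiples of \<open>num_cells\<close> at
  sizes \<open>k\<close> and \<open>k + 1\<close>. A cell of the larger sample is created by the
  last curve for at most four choices of that curve.\<close>

lemma sum_total_hits_le:
  assumes "k \<le> card \<Gamma>"
  shows "real (\<Sum>R\<in>subs k. total_hits R) \<le> real (card \<Gamma> - k) * real (num_cells k) -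
    real (Suc k) * real (num_cells (Suc k)) + 4 * real (num_cells (Suc k))"
proof -
  have created: "(\<Sum>\<gamma>\<in>R. card (cells R - cells (R - {\<gamma>}))) \<le> 4 * card (cells R)" if R: "R \<subseteq> \<Gamma>" for R
  proof -
    have "(\<Sum>\<gamma>\<in>R. card (cells R - cells (R - {\<gamma>}))) = (\<Sum>\<gamma>\<in>R. card {Q \<in> cells R. Q \<notin> cells (R - {\<gamma>})})"
      by (intro sum.cong refl arg_cong[of _ _ card]) auto
    also have "\<dots> = (\<Sum>Q\<in>cells R. card {\<gamma> \<in> R. Q \<notin> cells (R - {\<gamma>})})"
      using finite_cells finite_sub[OF R] by (intro sum_card_Collect_swap) auto
    also have "\<dots> \<le> (\<Sum>Q\<in>cells R. 4)"
    proof (rule sum_mono)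
      fix Q assume "Q \<in> cells R"
      then obtain p where p: "p \<in> P" "Q = cls R p" "Q \<noteq> {}" by (rule cellsE)
      have "card {\<gamma> \<in> R. Q \<notin> cells (R - {\<gamma>})} \<le> card {\<gamma> \<in> R. cls (R - {\<gamma>}) p \<noteq> cls R p}"
        using finite_sub[OF R] p by (intro card_mono) (auto simp: cells_def)
      also have "\<dots> \<le> 4" by (rule card_changing[OF R p(1)])
      finally show "card {\<gamma> \<in> R. Q \<notin> cells (R - {\<gamma>})} \<le> 4" .
    qed
    finally show ?thesis by simp
  qed
  have cG: "card (\<Gamma> - R) = card \<Gamma> - k" if "R \<in> subs k" for R
    using that finite_sub by (auto simp: subs_def card_Diff_subset)
  have "real (\<Sum>R\<in>subs k. total_hits R) \<le> real (\<Sum>R\<in>subs k. \<Sum>\<gamma>\<in>\<Gamma> - R. card (cells R - cells (insert \<gamma> R)))"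
    unfolding of_nat_le_iff by (intro sum_mono total_hits_le) (simp add: subs_def)
  also have "\<dots> = (\<Sum>R\<in>subs k. \<Sum>\<gamma>\<in>\<Gamma> - R. real (card (cells R))) -
      (\<Sum>R\<in>subs k. \<Sum>\<gamma>\<in>\<Gamma> - R. real (card (cells (insert \<gamma> R)))) +
      (\<Sum>R\<in>subs k. \<Sum>\<gamma>\<in>\<Gamma> - R. real (card (cells (insert \<gamma> R) - cells R)))"
    unfolding of_nat_sum sum_subtractf[symmetric] sum.distrib[symmetric]
    by (intro sum.cong refl real_card_Diff finite_cells)
  also have "(\<Sum>R\<in>subs k. \<Sum>\<gamma>\<in>\<Gamma> - R. real (card (cells R))) = real (card \<Gamma> - k) * real (num_cells k)"
    unfolding num_cells_def of_nat_sum sum_distrib_left by (intro sum.cong refl) (simp add: cG)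
  also have "(\<Sum>R\<in>subs k. \<Sum>\<gamma>\<in>\<Gamma> - R. real (card (cells (insert \<gamma> R)))) =
      (\<Sum>R\<in>subs (Suc k). \<Sum>\<gamma>\<in>R. real (card (cells (insert \<gamma> (R - {\<gamma>})))))" by (rule sum_extend)
  also have "\<dots> = real (Suc k) * real (num_cells (Suc k))"
    unfolding num_cells_def of_nat_sum sum_distrib_left
  proof (intro sum.cong refl)
    fix R assume R: "R \<in> subs (Suc k)"
    have "(\<Sum>\<gamma>\<in>R. real (card (cells (insert \<gamma> (R - {\<gamma>}))))) = (\<Sum>\<gamma>\<in>R. real (card (cells R)))"
      by (intro sum.cong refl) (simp only: insert_Diff)
    thus "(\<Sum>\<gamma>\<in>R. real (card (cells (insert \<gamma> (R - {\<gamma>}))))) = real (Suc k) * real (card (cells R))"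
      using R by (simp add: subs_def)
  qed
  also have "(\<Sum>R\<in>subs k. \<Sum>\<gamma>\<in>\<Gamma> - R. real (card (cells (insert \<gamma> R) - cells R))) =
      (\<Sum>R\<in>subs (Suc k). \<Sum>\<gamma>\<in>R. real (card (cells (insert \<gamma> (R - {\<gamma>})) - cells (R - {\<gamma>}))))"
    by (rule sum_extend)
  also have "\<dots> = (\<Sum>R\<in>subs (Suc k). real (\<Sum>\<gamma>\<in>R. card (cells R - cells (R - {\<gamma>}))))"
    unfolding of_nat_sum by (intro sum.cong refl) (simp only: insert_Diff)
  also have "\<dots> \<le> (\<Sum>R\<in>subs (Suc k). real (4 * card (cells R)))"
    unfolding of_nat_le_iff by (intro sum_mono, unfold of_nat_le_iff, intro created) (simp add: subs_def)
  also have "\<dots> = 4 * real (num_cells (Suc k))"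
    by (simp add: num_cells_def sum_distrib_left)
  finally show ?thesis by linarith
qed

lemma card_subs_Suc: "Suc k * card (subs (Suc k)) = (card \<Gamma> - k) * card (subs k)"
proof -
  have cG: "card (\<Gamma> - R) = card \<Gamma> - k" if "R \<in> subs k" for R
    using that finite_sub by (auto simp: subs_def card_Diff_subset)
  have "(\<Sum>R\<in>subs k. \<Sum>\<gamma>\<in>\<Gamma> - R. 1 :: nat) = (\<Sum>R\<in>subs (Suc k). \<Sum>\<gamma>\<in>R. 1)"
    by (rule sum_extend)
  moreover have "(\<Sum>R\<in>subs k. \<Sum>\<gamma>\<in>\<Gamma> - R. 1 :: nat) = (\<Sum>R\<in>subs k. card \<Gamma> - k)"
    using cG by (intro sum.cong refl) simp
  moreover have "(\<Sum>R\<in>subs (Suc k). \<Sum>\<gamma>\<in>R. 1 :: nat) = (\<Sum>R\<in>subs (Suc k). Suc k)"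
    by (intro sum.cong refl) (simp add: subs_def)
  ultimately show ?thesis by (simp add: mult.commute)
qed

lemma card_subs_pos: "k \<le> card \<Gamma> \<Longrightarrow> 0 < card (subs k)"
  using finite_curves by (simp add: subs_def n_subsets)

text \<open>Curves conflicting with a cell are counted twice: per point (\<^const>\<open>weight\<close>), and per cell
  (\<^const>\<open>total_hits\<close>). The latter telescopes over the sample sizes between \<open>u\<close> and \<open>2u\<close>.\<close>

theorem good_sample:
  assumes u: "1 \<le> u" "2 * u \<le> card \<Gamma>" and M: "1 \<le> M" and P: "P \<noteq> {}"
  shows "\<exists>R\<subseteq>\<Gamma>. u \<le> card R \<and> card R < 2 * u \<and>
    real (weight R) \<le> 8 * real (card \<Gamma>) * real (card P) / real u \<and>
    real (total_hits R) \<le> 80 * real M * real u * real (card \<Gamma>)"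
proof (rule ccontr)
  assume contr: "\<not> ?thesis"
  define m n where "m = real (card \<Gamma>)" and "n = real (card P)"
  define N where "N = (\<lambda>k. real (card (subs k)))"
  \<comment> \<open>\<open>e k\<close> is the mean number of cells of a sample of size
    \<open>k\<close>. The definition of \<open>y\<close> makes the total hits over all samples of
    size \<open>v\<close> at most \<open>(m - v) * (N v * y v)\<close>.\<close>
  define e where "e = (\<lambda>k. real (num_cells k) / N k)"
  define y where "y = (\<lambda>k. e k - e (Suc k) + 4 * e (Suc k) / real (Suc k))"
  have pos: "m > 0" "n > 0" "real u > 0" "real M > 0"
    using u M P finite_points finite_curves by (auto simp: m_def n_def card_gt_0_iff)
  have NS: "real (Suc k) * N (Suc k) = (m - real k) * N k" if "k \<le> card \<Gamma>" for k
  proof -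
    have "real (Suc k * card (subs (Suc k))) = real ((card \<Gamma> - k) * card (subs k))"
      by (simp only: card_subs_Suc)
    thus ?thesis using that by (simp only: of_nat_mult of_nat_diff N_def m_def)
  qed
  have Npos: "N k > 0" if "k \<le> card \<Gamma>" for k using card_subs_pos[OF that] by (simp add: N_def)
  have e_le: "e k \<le> real M * (real k + 1)\<^sup>2" "e k \<ge> 0" if "k \<le> card \<Gamma>" for k
  proof -
    have "num_cells k \<le> (\<Sum>R\<in>subs k. M * (k + 1)\<^sup>2)"
      unfolding num_cells_def cells_def using card_cells by (intro sum_mono) (auto simp: subs_def)
    hence "real (num_cells k) \<le> real (card (subs k) * (M * (k + 1)\<^sup>2))"
      unfolding of_nat_le_iff by simp
    also have "\<dots> = N k * (real M * (real k + 1)\<^sup>2)" by (simp add: N_def)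
    finally show "e k \<le> real M * (real k + 1)\<^sup>2"
      using Npos[OF that] by (simp add: e_def field_simps)
    show "e k \<ge> 0" by (simp add: e_def N_def)
  qed
  have aux: "A * (K * E) - S * (A * K / S * F) + 4 * (A * K / S * F) = A * (K * (E - F + 4 * F / S))"
    if "S > 0" for A K E F S :: real
  proof -
    define q where "q = F / S"
    have F: "F = S * q" using that by (simp add: q_def)
    have q: "A * K / S * F = A * K * q" "4 * F / S = 4 * q" by (simp_all add: q_def)
    show ?thesis unfolding q by (simp add: F algebra_simps)
  qed
  \<comment> \<open>The mean weight is at most half of its threshold. Since every sample violates
    one of the two thresholds, the mean of \<open>total_hits\<close> must exceed half of its own
    threshold.\<close>
  have large: "40 * real M * real u < y v" if v: "u \<le> v" "v < 2 * u" for v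
  proof -
    have vm: "Suc v \<le> card \<Gamma>" "v \<le> card \<Gamma>" using v u by auto
    have "1 < real u / (8 * m * n) * real (weight R) + real (total_hits R) / (80 * real M * real u * m)"
      if R: "R \<in> subs v" for R
    proof -
      have "8 * m * n / real u < real (weight R) \<or> 80 * real M * real u * m < real (total_hits R)"
        using contr R v by (auto simp: subs_def m_def n_def not_le)
      hence "1 < real u / (8 * m * n) * real (weight R) \<or> 1 < real (total_hits R) / (80 * real M * real u * m)"
        using pos by (auto simp: field_simps)
      moreover have "0 \<le> real u / (8 * m * n) * real (weight R)" "0 \<le> real (total_hits R) / (80 * real M * real u * m)"
        using pos by auto
      ultimately show ?thesis by linarith
    qed
    hence "(\<Sum>R\<in>subs v. 1) < (\<Sum>R\<in>subs v. real u / (8 * m * n) * real (weight R) +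
        real (total_hits R) / (80 * real M * real u * m))"
      using finite_subs card_subs_pos[OF vm(2)] by (intro sum_strict_mono) auto
    also have "\<dots> = real u / (8 * m * n) * real (\<Sum>R\<in>subs v. weight R) +
        real (\<Sum>R\<in>subs v. total_hits R) / (80 * real M * real u * m)"
      by (simp add: sum.distrib sum_distrib_left sum_divide_distrib)
    finally have 1: "N v < real u / (8 * m * n) * real (\<Sum>R\<in>subs v. weight R) +
        real (\<Sum>R\<in>subs v. total_hits R) / (80 * real M * real u * m)" by (simp add: N_def)
    have "real (\<Sum>R\<in>subs v. weight R) \<le> real (4 * card P * card (subs (Suc v)))"
      unfolding of_nat_le_iff by (rule sum_weight_le)
    hence w: "real (\<Sum>R\<in>subs v. weight R) \<le> 4 * n * N (Suc v)" by (simp add: N_def n_def)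
    have "real u * N (Suc v) \<le> real (Suc v) * N (Suc v)"
      using v Npos[OF vm(1)] by (intro mult_right_mono) auto
    also have "\<dots> \<le> m * N v" using NS[OF vm(2)] Npos[OF vm(2)] by (simp add: mult_right_mono)
    finally have "real u * N (Suc v) \<le> m * N v" .
    hence "real u / (8 * m * n) * (4 * n * N (Suc v)) \<le> N v / 2" using pos by (simp add: field_simps)
    moreover have "real u / (8 * m * n) * real (\<Sum>R\<in>subs v. weight R) \<le> real u / (8 * m * n) * (4 * n * N (Suc v))"
      using w pos by (intro mult_left_mono) auto
    ultimately have 2: "N v / 2 < real (\<Sum>R\<in>subs v. total_hits R) / (80 * real M * real u * m)"
      using 1 by linarith
    have "real (\<Sum>R\<in>subs v. total_hits R) \<le> (m - real v) * real (num_cells v) -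
        real (Suc v) * real (num_cells (Suc v)) + 4 * real (num_cells (Suc v))"
      using sum_total_hits_le[OF vm(2)] vm by (simp add: m_def of_nat_diff)
    also have "\<dots> = (m - real v) * (N v * e v) - real (Suc v) * (N (Suc v) * e (Suc v)) + 4 * (N (Suc v) * e (Suc v))"
      using Npos[OF vm(1)] Npos[OF vm(2)] by (simp add: e_def)
    also have "N (Suc v) = (m - real v) * N v / real (Suc v)"
      using NS[OF vm(2)] by (simp add: field_simps)
    also have "(m - real v) * (N v * e v) - real (Suc v) * ((m - real v) * N v / real (Suc v) * e (Suc v)) +
        4 * ((m - real v) * N v / real (Suc v) * e (Suc v)) = (m - real v) * (N v * y v)"
      unfolding y_def by (rule aux) simp
    finally have 3: "real (\<Sum>R\<in>subs v. total_hits R) \<le> (m - real v) * (N v * y v)" .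
    have "0 < N v / 2 * (80 * real M * real u * m)" using pos Npos[OF vm(2)] by simp
    also have *: "N v / 2 * (80 * real M * real u * m) < (m - real v) * (N v * y v)"
      using 2 3 pos by (simp add: field_simps)
    finally have "0 < (m - real v) * (N v * y v)" .
    moreover have mv: "m - real v > 0" using vm by (simp add: m_def)
    ultimately have yv: "y v > 0" using Npos[OF vm(2)] by (simp add: zero_less_mult_iff)
    note *
    also have "(m - real v) * (N v * y v) \<le> m * (N v * y v)"
      using yv Npos[OF vm(2)] by (intro mult_right_mono) auto
    finally show ?thesis using pos Npos[OF vm(2)] by (simp add: field_simps)
  qed
  \<comment> \<open>Everything is compared in units of \<open>M * u * u\<close>: the left-hand sum
    is 40, while the telescoping part contributes at most 4 and the created cells at most
    32.\<close>
  have "(\<Sum>v=u..<2*u. 40 * real M * real u) < (\<Sum>v=u..<2*u. y v)"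
    using u large by (intro sum_strict_mono) auto
  moreover have "(\<Sum>v=u..<2*u. y v) = (\<Sum>v=u..<2*u. e v - e (Suc v)) + (\<Sum>v=u..<2*u. 4 * e (Suc v) / real (Suc v))"
    by (simp add: y_def sum.distrib)
  moreover have "(\<Sum>v=u..<2*u. e v - e (Suc v)) = e u - e (2 * u)"
    using sum_Suc_diff'[of u "2 * u" e] by (simp add: sum_subtractf)
  moreover have "(\<Sum>v=u..<2*u. 4 * e (Suc v) / real (Suc v)) \<le> (\<Sum>v=u..<2*u. 32 * real M * real u)"
  proof (rule sum_mono)
    fix v assume v: "v \<in> {u..<2*u}"
    have "e (Suc v) \<le> real M * (real (Suc v) + 1)\<^sup>2" using v u by (intro e_le) auto
    also have "\<dots> \<le> real M * (2 * real (Suc v))\<^sup>2" by (intro mult_left_mono power_mono) auto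
    also have "\<dots> = 4 * real M * real (Suc v) * real (Suc v)" by (simp add: power2_eq_square algebra_simps)
    also have "\<dots> \<le> 4 * real M * real (Suc v) * (2 * real u)"
      using v by (intro mult_left_mono) auto
    finally show "4 * e (Suc v) / real (Suc v) \<le> 32 * real M * real u"
      by (simp add: field_simps)
  qed
  moreover have "e u \<le> 4 * (real M * real u * real u)"
  proof -
    have "e u \<le> real M * (real u + 1)\<^sup>2" using u by (intro e_le) auto
    also have "\<dots> \<le> real M * (2 * real u)\<^sup>2" using u by (intro mult_left_mono power_mono) auto
    finally show ?thesis by (simp add: power2_eq_square)
  qed
  moreover have "e (2 * u) \<ge> 0" using u by (intro e_le) auto
  moreover have "real M * real u * real u > 0" using pos by simp
  ultimately show False by (simp add: mult_ac)
qed

end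

section \<open>Counting rich curves through the cells of a sample\<close>

lemma sum_binomial_in_cell_le:
  fixes \<Gamma> :: "'a set set"
  assumes fin: "finite \<Gamma>" "finite Q"
    and c: "\<And>S. S \<subseteq> Q \<Longrightarrow> card S = s \<Longrightarrow> card {\<gamma> \<in> \<Gamma>. S \<subseteq> \<gamma>} \<le> c"
  shows "(\<Sum>\<gamma>\<in>\<Gamma>. card (\<gamma> \<inter> Q) choose s) \<le> c * (card Q choose s)"
proof -
  let ?S = "{S. S \<subseteq> Q \<and> card S = s}"
  have finS: "finite ?S" using fin by simp
  have "(\<Sum>\<gamma>\<in>\<Gamma>. card (\<gamma> \<inter> Q) choose s) = (\<Sum>\<gamma>\<in>\<Gamma>. card {S \<in> ?S. S \<subseteq> \<gamma>})"
  proof (intro sum.cong refl)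
    fix \<gamma>
    have "card (\<gamma> \<inter> Q) choose s = card {S. S \<subseteq> \<gamma> \<inter> Q \<and> card S = s}"
      using fin by (intro n_subsets[symmetric]) simp
    also have "{S. S \<subseteq> \<gamma> \<inter> Q \<and> card S = s} = {S \<in> ?S. S \<subseteq> \<gamma>}" by auto
    finally show "card (\<gamma> \<inter> Q) choose s = card {S \<in> ?S. S \<subseteq> \<gamma>}" .
  qed
  also have "\<dots> = (\<Sum>S\<in>?S. card {\<gamma> \<in> \<Gamma>. S \<subseteq> \<gamma>})"
    using fin finS by (intro sum_card_Collect_swap) auto
  also have "\<dots> \<le> (\<Sum>S\<in>?S. c)" using c by (intro sum_mono) auto
  also have "\<dots> = c * (card Q choose s)" using fin by (simp add: n_subsets)
  finally show ?thesis .
qed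

text \<open>For \<open>i > t \<ge> s\<close> one has
  \<open>i ^ s \<le> s ^ s * (i choose s)\<close>, and \<open>s - 1\<close> of the factors
  \<open>i\<close> may be lowered to \<open>t\<close>.\<close>

lemma le_threshold_plus_binomial:
  fixes t :: real
  assumes "1 \<le> s" "real s \<le> t"
  shows "real i \<le> t + real s ^ s * real (i choose s) / t ^ (s - 1)"
proof (cases "real i \<le> t")
  case True
  moreover have "0 \<le> real s ^ s * real (i choose s) / t ^ (s - 1)" using assms by simp
  ultimately show ?thesis by linarith
next
  case False
  have t: "t > 0" using assms by simp
  have "s \<le> i" using False assms by linarith
  hence "(real i / real s) ^ s \<le> real (i choose s)" by (rule binomial_ge_n_over_k_pow_k)
  hence "real i ^ s \<le> real s ^ s * real (i choose s)"
    using assms by (simp add: power_divide field_simps)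
  moreover have "real i * t ^ (s - 1) \<le> real i ^ s"
  proof -
    have "real i * t ^ (s - 1) \<le> real i * real i ^ (s - 1)"
      using False t by (intro mult_left_mono power_mono) auto
    also have "\<dots> = real i ^ s" using assms by (cases s) auto
    finally show ?thesis .
  qed
  ultimately have "real i \<le> real s ^ s * real (i choose s) / t ^ (s - 1)"
    using t by (simp add: pos_le_divide_eq)
  thus ?thesis using t by linarith
qed

context cell_system
begin

text \<open>Inside a cell \<open>Q\<close>, incidences up to the threshold \<open>s + \<mu> |Q|\<close> are paid for by the conflicts, and
  those above it by the \<open>s\<close>-subsets of \<open>Q\<close>, each of which lies on at most \<open>c\<close> curves.\<close>

theorem card_rich_curves_le:
  fixes k s c r u :: nat
  assumes s: "2 \<le> s" and M: "1 \<le> M" and P: "P \<noteq> {}"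
    and rich: "\<And>\<gamma>. \<gamma> \<in> \<Gamma> \<Longrightarrow> k \<le> card (\<gamma> \<inter> P)"
    and inter: "\<And>\<gamma> \<delta>. \<gamma> \<in> \<Gamma> \<Longrightarrow> \<delta> \<in> \<Gamma> \<Longrightarrow> \<gamma> \<noteq> \<delta> \<Longrightarrow> card (\<gamma> \<inter> \<delta> \<inter> P) \<le> r"
    and c: "\<And>S. S \<subseteq> P \<Longrightarrow> card S = s \<Longrightarrow> card {\<gamma> \<in> \<Gamma>. S \<subseteq> \<gamma>} \<le> c"
    and u: "1 \<le> u" "4 * u \<le> card \<Gamma>" "(8 * r + 1280 * M * s) * u \<le> k"
  shows "real (card \<Gamma>) * (real k * (real u * real k) ^ (s - 1))
    \<le> 4 * real s ^ s * real c * 128 ^ (s - 1) * real (card P) ^ s"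
proof -
  define m n where "m = real (card \<Gamma>)" and "n = real (card P)"
  obtain R where R: "R \<subseteq> \<Gamma>" "u \<le> card R" "card R < 2 * u"
    and w: "real (weight R) \<le> 8 * m * n / real u" and h: "real (total_hits R) \<le> 80 * real M * real u * m"
    using good_sample[of u] u M P unfolding m_def n_def by auto
  have k1: "real (8 * r + 1280 * M * s) * real u \<le> real k"
    using u(3) by (simp only: of_nat_mult[symmetric] of_nat_le_iff)
  have pos: "n > 0" "real u > 0" "real k > 0" "m > 0"
  proof -
    have "0 < (8 * r + 1280 * M * s) * u" using s M u by simp
    with u(3) show "real k > 0" by linarith
  qed (use P finite_points finite_curves u in \<open>auto simp: n_def m_def card_gt_0_iff\<close>)
  have finR: "finite R" using finite_sub R by blast
  define i where "i = (\<lambda>(\<gamma> :: 'p set) Q. card (\<gamma> \<inter> Q))"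
  have inc: "3 / 4 * real k \<le> (\<Sum>Q\<in>cells R. real (i \<gamma> Q))" if \<gamma>: "\<gamma> \<in> \<Gamma> - R" for \<gamma>
  proof -
    have "\<gamma> \<inter> P \<subseteq> (\<Union>\<delta>\<in>R. \<gamma> \<inter> \<delta> \<inter> P) \<union> (\<Union>Q\<in>cells R. \<gamma> \<inter> Q)"
    proof
      fix p assume p: "p \<in> \<gamma> \<inter> P"
      show "p \<in> (\<Union>\<delta>\<in>R. \<gamma> \<inter> \<delta> \<inter> P) \<union> (\<Union>Q\<in>cells R. \<gamma> \<inter> Q)"
      proof (cases "p \<in> \<Union>R")
        case False
        hence "p \<in> cls R p" using cls_self R p by blast
        moreover from this p have "cls R p \<in> cells R" by (auto simp: cells_def)
        ultimately show ?thesis using p by blast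
      qed (use p in blast)
    qed
    hence "card (\<gamma> \<inter> P) \<le> card ((\<Union>\<delta>\<in>R. \<gamma> \<inter> \<delta> \<inter> P) \<union> (\<Union>Q\<in>cells R. \<gamma> \<inter> Q))"
      using finR finite_points finite_cells finite_cell by (intro card_mono) auto
    also have "\<dots> \<le> card (\<Union>\<delta>\<in>R. \<gamma> \<inter> \<delta> \<inter> P) + card (\<Union>Q\<in>cells R. \<gamma> \<inter> Q)" by (rule card_Un_le)
    also have "\<dots> \<le> (\<Sum>\<delta>\<in>R. card (\<gamma> \<inter> \<delta> \<inter> P)) + (\<Sum>Q\<in>cells R. i \<gamma> Q)"
      unfolding i_def using finR finite_cells by (intro add_mono card_UN_le)
    also have "(\<Sum>\<delta>\<in>R. card (\<gamma> \<inter> \<delta> \<inter> P)) \<le> (\<Sum>\<delta>\<in>R. r)"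
      using \<gamma> R by (intro sum_mono inter) auto
    finally have "k \<le> card R * r + (\<Sum>Q\<in>cells R. i \<gamma> Q)" using rich[of \<gamma>] \<gamma> by simp
    \<comment> \<open>The summand \<open>8 * r\<close> in the hypothesis on \<open>u\<close> is
      spent here: fewer than \<open>2 * u\<close> sample curves account for at most a quarter of
      \<open>k\<close>.\<close>
    moreover have "4 * (card R * r) \<le> k"
    proof -
      have "4 * (card R * r) \<le> 4 * ((2 * u) * r)" using R by (intro mult_left_mono mult_right_mono) auto
      also have "\<dots> \<le> (8 * r + 1280 * M * s) * u" by (simp add: algebra_simps)
      finally show ?thesis using u(3) by linarith
    qed
    ultimately have "3 * k \<le> 4 * (\<Sum>Q\<in>cells R. i \<gamma> Q)" by linarith
    hence "real (3 * k) \<le> real (4 * (\<Sum>Q\<in>cells R. i \<gamma> Q))" unfolding of_nat_le_iff .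
    thus ?thesis by simp
  qed
  \<comment> \<open>With 128 = 8 * 16, the bound on the weight times \<open>\<mu>\<close> is exactly
    \<open>m * k / 16\<close>. In the same way 1280 = 16 * 80 matches the bound on
    \<open>total_hits\<close>.\<close>
  define \<mu> where "\<mu> = real u * real k / (128 * n)"
  have \<mu>: "\<mu> > 0" using pos by (simp add: \<mu>_def)
  define t where "t = (\<lambda>Q :: 'p set. real s + \<mu> * real (card Q))"
  have cell: "(\<Sum>\<gamma>\<in>\<Gamma> - R. real (i \<gamma> Q)) \<le> real (hits R Q) * t Q + real s ^ s * real c / \<mu> ^ (s - 1) * real (card Q)"
    if Q: "Q \<in> cells R" for Q
  proof -
    have Q0: "real (card Q) > 0" using Q finite_cell by (auto simp: cells_def card_gt_0_iff)
    have tQ: "t Q > 0" "real s \<le> t Q" "\<mu> * real (card Q) \<le> t Q" using \<mu> s Q0 by (auto simp: t_def add_pos_pos)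
    have "(\<Sum>\<gamma>\<in>\<Gamma> - R. real (i \<gamma> Q)) \<le> (\<Sum>\<gamma>\<in>\<Gamma> - R. (if \<gamma> \<inter> Q \<noteq> {} then t Q else 0) +
        real s ^ s / t Q ^ (s - 1) * real (i \<gamma> Q choose s))"
    proof (rule sum_mono)
      fix \<gamma>
      show "real (i \<gamma> Q) \<le> (if \<gamma> \<inter> Q \<noteq> {} then t Q else 0) + real s ^ s / t Q ^ (s - 1) * real (i \<gamma> Q choose s)"
        using le_threshold_plus_binomial[of s "t Q" "i \<gamma> Q"] s tQ by (auto simp: i_def)
    qed
    also have "\<dots> = real (hits R Q) * t Q + real s ^ s / t Q ^ (s - 1) * real (\<Sum>\<gamma>\<in>\<Gamma> - R. i \<gamma> Q choose s)"
      using finite_curves by (simp add: sum.distrib sum_distrib_left sum.If_cases hits_def Int_def)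
    finally have 1: "(\<Sum>\<gamma>\<in>\<Gamma> - R. real (i \<gamma> Q)) \<le> real (hits R Q) * t Q +
      real s ^ s / t Q ^ (s - 1) * real (\<Sum>\<gamma>\<in>\<Gamma> - R. i \<gamma> Q choose s)" .
    have "real (\<Sum>\<gamma>\<in>\<Gamma> - R. i \<gamma> Q choose s) \<le> real (c * (card Q choose s))"
      unfolding of_nat_le_iff i_def
    proof (rule sum_binomial_in_cell_le)
      fix S assume S: "S \<subseteq> Q" "card S = s"
      have "card {\<gamma> \<in> \<Gamma> - R. S \<subseteq> \<gamma>} \<le> card {\<gamma> \<in> \<Gamma>. S \<subseteq> \<gamma>}"
        using finite_curves by (intro card_mono) auto
      also have "\<dots> \<le> c" using S cell_subset[OF Q] by (intro c) auto
      finally show "card {\<gamma> \<in> \<Gamma> - R. S \<subseteq> \<gamma>} \<le> c" .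
    qed (use finite_curves finite_cell[OF Q] in auto)
    also have "\<dots> \<le> real c * real (card Q) ^ s"
    proof -
      have "card Q choose s \<le> card Q ^ s"
        by (cases "s \<le> card Q") (auto intro: binomial_le_pow simp: binomial_eq_0)
      hence "real (c * (card Q choose s)) \<le> real (c * card Q ^ s)"
        unfolding of_nat_le_iff by (rule mult_left_mono) simp
      thus ?thesis by simp
    qed
    finally have 2: "real (\<Sum>\<gamma>\<in>\<Gamma> - R. i \<gamma> Q choose s) \<le> real c * real (card Q) ^ s" .
    have "real s ^ s / t Q ^ (s - 1) \<le> real s ^ s / (\<mu> * real (card Q)) ^ (s - 1)"
      using \<mu> Q0 tQ by (intro divide_left_mono power_mono mult_pos_pos zero_less_power) auto
    hence "real s ^ s / t Q ^ (s - 1) * real (\<Sum>\<gamma>\<in>\<Gamma> - R. i \<gamma> Q choose s) \<le>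
        real s ^ s / (\<mu> * real (card Q)) ^ (s - 1) * (real c * real (card Q) ^ s)"
      using 2 \<mu> by (intro mult_mono) (auto intro!: sum_nonneg)
    also have "real s ^ s / (\<mu> * real (card Q)) ^ (s - 1) * (real c * real (card Q) ^ s) =
        real s ^ s * real c / \<mu> ^ (s - 1) * real (card Q)"
    proof -
      have "real (card Q) ^ s = real (card Q) ^ (s - 1) * real (card Q)" using s by (cases s) auto
      thus ?thesis using Q0 \<mu> by (simp add: power_mult_distrib field_simps)
    qed
    finally show ?thesis using 1 by linarith
  qed
  \<comment> \<open>At least half of the curves lie outside the sample, as
    \<open>card R < 2 * u\<close> and \<open>4 * u \<le> m\<close>. Of the 3/8 obtained here, hits
    and weight consume 1/16 each, which leaves 1/4 for the \<open>s\<close>-subsets.\<close>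
  have "3 / 8 * (m * real k) \<le> 3 / 4 * real k * real (card (\<Gamma> - R))"
  proof -
    have "card (\<Gamma> - R) = card \<Gamma> - card R" using R finR by (simp add: card_Diff_subset)
    hence "m / 2 \<le> real (card (\<Gamma> - R))" using R u by (simp add: m_def of_nat_diff)
    hence "3 / 4 * real k * (m / 2) \<le> 3 / 4 * real k * real (card (\<Gamma> - R))" by (intro mult_left_mono) auto
    thus ?thesis by (simp add: mult_ac)
  qed
  also have "\<dots> = (\<Sum>\<gamma>\<in>\<Gamma> - R. 3 / 4 * real k)" by simp
  also have "\<dots> \<le> (\<Sum>\<gamma>\<in>\<Gamma> - R. \<Sum>Q\<in>cells R. real (i \<gamma> Q))" by (intro sum_mono inc)
  also have "\<dots> = (\<Sum>Q\<in>cells R. \<Sum>\<gamma>\<in>\<Gamma> - R. real (i \<gamma> Q))" by (rule sum.swap)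
  also have "\<dots> \<le> (\<Sum>Q\<in>cells R. real (hits R Q) * t Q + real s ^ s * real c / \<mu> ^ (s - 1) * real (card Q))"
    by (intro sum_mono cell)
  also have "\<dots> = real s * real (total_hits R) + \<mu> * real (weight R) +
      real s ^ s * real c / \<mu> ^ (s - 1) * real (\<Sum>Q\<in>cells R. card Q)"
    by (simp add: t_def total_hits_def weight_def sum.distrib sum_distrib_left sum_divide_distrib algebra_simps)
  finally have main: "3 / 8 * (m * real k) \<le> real s * real (total_hits R) + \<mu> * real (weight R) +
      real s ^ s * real c / \<mu> ^ (s - 1) * real (\<Sum>Q\<in>cells R. card Q)" .
  have "real s * real (total_hits R) \<le> m * real k / 16"
  proof -
    have "real s * real (total_hits R) \<le> real s * (80 * real M * real u * m)" using h by (intro mult_left_mono) auto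
    also have "\<dots> = m * (1280 * real M * real s * real u) / 16" by simp
    also have "\<dots> \<le> m * real k / 16"
    proof -
      have "1280 * real M * real s * real u \<le> real (8 * r + 1280 * M * s) * real u"
        by (simp add: algebra_simps)
      also note k1
      finally show ?thesis using pos by (intro divide_right_mono mult_left_mono) auto
    qed
    finally show ?thesis .
  qed
  moreover have "\<mu> * real (weight R) \<le> m * real k / 16"
  proof -
    have "\<mu> * real (weight R) \<le> \<mu> * (8 * m * n / real u)" using w \<mu> by (intro mult_left_mono) auto
    also have "\<dots> = m * real k / 16" using pos by (simp add: \<mu>_def field_simps)
    finally show ?thesis .
  qed
  moreover have "(\<Sum>Q\<in>cells R. card Q) \<le> card P"
  proof -
    have "(\<Sum>Q\<in>cells R. card Q) = card (\<Union>(cells R))"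
      by (rule card_Union_disjoint[symmetric])
        (use cells_disjoint[OF R(1)] finite_cell in \<open>auto simp: pairwise_def disjnt_def\<close>)
    also have "\<dots> \<le> card P" using cell_subset finite_points by (intro card_mono) auto
    finally show ?thesis .
  qed
  hence "real s ^ s * real c / \<mu> ^ (s - 1) * real (\<Sum>Q\<in>cells R. card Q) \<le> real s ^ s * real c / \<mu> ^ (s - 1) * n"
    unfolding n_def using \<mu> by (intro mult_left_mono) (auto simp flip: of_nat_sum)
  ultimately have "m * real k / 4 \<le> real s ^ s * real c / \<mu> ^ (s - 1) * n" using main by linarith
  hence "m * real k * \<mu> ^ (s - 1) \<le> 4 * real s ^ s * real c * n" using \<mu> by (simp add: field_simps)
  hence le: "m * real k * \<mu> ^ (s - 1) * (128 * n) ^ (s - 1) \<le> 4 * real s ^ s * real c * n * (128 * n) ^ (s - 1)"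
    using pos by (intro mult_right_mono) auto
  have e1: "\<mu> ^ (s - 1) * (128 * n) ^ (s - 1) = (real u * real k) ^ (s - 1)"
  proof -
    have "\<mu> * (128 * n) = real u * real k" using pos by (simp add: \<mu>_def)
    thus ?thesis by (simp only: power_mult_distrib[symmetric])
  qed
  have e2: "n * (128 * n) ^ (s - 1) = 128 ^ (s - 1) * n ^ s"
    using s by (cases s) (auto simp: power_mult_distrib)
  have "m * (real k * (real u * real k) ^ (s - 1)) = m * real k * \<mu> ^ (s - 1) * (128 * n) ^ (s - 1)"
    by (simp only: e1[symmetric] mult.assoc)
  also note le
  also have "4 * real s ^ s * real c * n * (128 * n) ^ (s - 1) = 4 * real s ^ s * real c * 128 ^ (s - 1) * n ^ s"
    by (simp only: mult.assoc e2)
  finally show ?thesis unfolding m_def n_def .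
qed

end

text \<open>The case of very rich curves needs no geometry: expand \<open>0 \<le> (\<Sum>p\<in>P. (d(p) - mk/n)\<^sup>2)\<close> for the
  degrees \<open>d(p)\<close>.\<close>

lemma card_very_rich_sets_le:
  fixes \<Gamma> :: "'a set set" and k r :: nat
  assumes fin: "finite \<Gamma>" "finite P"
    and rich: "\<And>\<gamma>. \<gamma> \<in> \<Gamma> \<Longrightarrow> k \<le> card (\<gamma> \<inter> P)"
    and inter: "\<And>\<gamma> \<delta>. \<gamma> \<in> \<Gamma> \<Longrightarrow> \<delta> \<in> \<Gamma> \<Longrightarrow> \<gamma> \<noteq> \<delta> \<Longrightarrow> card (\<gamma> \<inter> \<delta> \<inter> P) \<le> r"
    and k: "1 \<le> k" "4 * r * card P \<le> k ^ 2"
  shows "card \<Gamma> * k \<le> 2 * card P"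
proof (cases "card P = 0 \<or> card \<Gamma> = 0")
  case True
  thus ?thesis
  proof
    assume "card P = 0"
    hence "\<Gamma> = {}" using rich k fin by fastforce
    thus ?thesis by simp
  qed simp
next
  case False
  define m n where "m = real (card \<Gamma>)" and "n = real (card P)"
  define D where "D = (\<lambda>p. real (card {\<gamma> \<in> \<Gamma>. p \<in> \<gamma>}))"
  define I where "I = (\<Sum>p\<in>P. D p)"
  \<comment> \<open>A lower bound for the mean degree of a point; the claim amounts to
    \<open>a \<le> 2\<close>.\<close>
  define a where "a = m * real k / n"
  have pos: "m > 0" "n > 0" "real k > 0" using False k by (auto simp: m_def n_def)
  have I_alt: "I = (\<Sum>\<gamma>\<in>\<Gamma>. real (card (\<gamma> \<inter> P)))"
  proof -
    have "(\<Sum>p\<in>P. card {\<gamma> \<in> \<Gamma>. p \<in> \<gamma>}) = (\<Sum>\<gamma>\<in>\<Gamma>. card {p \<in> P. p \<in> \<gamma>})"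
      using fin by (intro sum_card_Collect_swap)
    also have "\<dots> = (\<Sum>\<gamma>\<in>\<Gamma>. card (\<gamma> \<inter> P))" by (simp add: Int_def conj_commute)
    finally show ?thesis unfolding I_def D_def by (simp flip: of_nat_sum)
  qed
  have "(\<Sum>\<gamma>\<in>\<Gamma>. real k) \<le> I" unfolding I_alt using rich by (intro sum_mono) auto
  hence I: "m * real k \<le> I" by (simp add: m_def)
  have "(\<Sum>p\<in>P. D p * D p) = (\<Sum>\<gamma>\<in>\<Gamma>. \<Sum>\<delta>\<in>\<Gamma>. real (card (\<gamma> \<inter> \<delta> \<inter> P)))"
  proof -
    have "(\<Sum>p\<in>P. D p * D p) = (\<Sum>p\<in>P. \<Sum>\<gamma>\<in>\<Gamma>. \<Sum>\<delta>\<in>\<Gamma>. of_bool (p \<in> \<gamma>) * of_bool (p \<in> \<delta>))"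
      unfolding D_def sum_product[symmetric] using fin by (simp add: sum_of_bool_eq Int_def)
    also have "\<dots> = (\<Sum>\<gamma>\<in>\<Gamma>. \<Sum>p\<in>P. \<Sum>\<delta>\<in>\<Gamma>. of_bool (p \<in> \<gamma>) * of_bool (p \<in> \<delta>))" by (rule sum.swap)
    also have "\<dots> = (\<Sum>\<gamma>\<in>\<Gamma>. \<Sum>\<delta>\<in>\<Gamma>. \<Sum>p\<in>P. of_bool (p \<in> \<gamma>) * of_bool (p \<in> \<delta>))"
      by (intro sum.cong refl sum.swap)
    also have "\<dots> = (\<Sum>\<gamma>\<in>\<Gamma>. \<Sum>\<delta>\<in>\<Gamma>. real (card (\<gamma> \<inter> \<delta> \<inter> P)))"
    proof (intro sum.cong refl)
      fix \<gamma> \<delta>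
      have "(\<Sum>p\<in>P. of_bool (p \<in> \<gamma>) * of_bool (p \<in> \<delta>) :: real) = (\<Sum>p\<in>P. of_bool (p \<in> \<gamma> \<inter> \<delta>))"
        by (intro sum.cong refl) auto
      also have "\<dots> = real (card (P \<inter> {p. p \<in> \<gamma> \<inter> \<delta>}))" using fin by (simp only: sum_of_bool_eq)
      also have "P \<inter> {p. p \<in> \<gamma> \<inter> \<delta>} = \<gamma> \<inter> \<delta> \<inter> P" by auto
      finally show "(\<Sum>p\<in>P. of_bool (p \<in> \<gamma>) * of_bool (p \<in> \<delta>) :: real) = real (card (\<gamma> \<inter> \<delta> \<inter> P))" .
    qed
    finally show ?thesis .
  qed
  also have "\<dots> \<le> (\<Sum>\<gamma>\<in>\<Gamma>. \<Sum>\<delta>\<in>\<Gamma>. real r + (if \<delta> = \<gamma> then real (card (\<gamma> \<inter> P)) else 0))"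
    using inter by (intro sum_mono) auto
  also have "\<dots> = m * m * real r + I"
    using fin by (simp add: sum.distrib I_alt m_def)
  finally have sq: "(\<Sum>p\<in>P. D p * D p) \<le> m * m * real r + I" .
  have "0 \<le> (\<Sum>p\<in>P. (D p - a)\<^sup>2)" by (intro sum_nonneg) auto
  also have "(\<Sum>p\<in>P. (D p - a)\<^sup>2) = (\<Sum>p\<in>P. D p * D p - 2 * a * D p + a\<^sup>2)"
    by (intro sum.cong refl) (simp add: power2_eq_square algebra_simps)
  also have "\<dots> = (\<Sum>p\<in>P. D p * D p) - 2 * a * I + n * a\<^sup>2"
    by (simp add: sum.distrib sum_subtractf I_def n_def flip: sum_distrib_left)
  finally have 1: "(2 * a - 1) * I \<le> m * m * real r + n * a\<^sup>2" using sq by (simp add: algebra_simps)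
  have "m * real k \<le> 2 * n"
  proof (cases "2 * a \<le> 1")
    case True
    thus ?thesis using pos by (simp add: a_def field_simps)
  next
    case False
    hence "(2 * a - 1) * (m * real k) \<le> (2 * a - 1) * I" using I by (intro mult_left_mono) auto
    with 1 have "(2 * a - 1) * (m * real k) \<le> m * m * real r + n * a\<^sup>2" by linarith
    moreover have "m * real k = n * a" using pos by (simp add: a_def)
    ultimately have "n * a\<^sup>2 - n * a \<le> m * m * real r" by (simp add: power2_eq_square algebra_simps)
    \<comment> \<open>The hypothesis on \<open>k ^ 2\<close> makes the contribution of pairs of
      distinct sets at most a quarter of the square term, which leads to
      \<open>3 * a \<le> 4\<close>.\<close>
    moreover have "4 * (m * m * real r) \<le> n * a\<^sup>2"
    proof -
      have "real (4 * r * card P) \<le> real (k ^ 2)" using k(2) unfolding of_nat_le_iff .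
      hence "m * m * (4 * real r * n) \<le> m * m * (real k)\<^sup>2" using pos by (intro mult_left_mono) (auto simp: n_def)
      thus ?thesis using pos by (simp add: a_def power2_eq_square field_simps)
    qed
    ultimately have "3 * (n * a\<^sup>2) \<le> 4 * (n * a)" by linarith
    hence "a * (3 * a) \<le> a * 4" using pos by (simp add: power2_eq_square)
    moreover have "a > 0" using pos by (simp add: a_def)
    ultimately have "3 * a \<le> 4" by simp
    hence "a \<le> 2" by simp
    thus ?thesis using pos by (simp add: a_def field_simps)
  qed
  hence "real (card \<Gamma> * k) \<le> real (2 * card P)" by (simp add: m_def n_def)
  thus ?thesis unfolding of_nat_le_iff .
qed

text \<open>Deleting a point of maximal degree does not increase the density of a hypergraph.\<close>

lemma exists_sparse_subset:
  fixes H :: "'a set set"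
  assumes fin: "finite P" and H: "\<And>S. S \<in> H \<Longrightarrow> S \<subseteq> P \<and> card S = h" and "t \<le> card P"
  shows "\<exists>Y\<subseteq>P. card Y = t \<and>
    real (card {S \<in> H. S \<subseteq> Y}) * real (card P) ^ h \<le> real (card H) * real t ^ h"
  using assms(3)
proof (induction rule: inc_induct)
  case base
  have "{S \<in> H. S \<subseteq> P} = H" using H by auto
  thus ?case by auto
next
  case (step t)
  then obtain Y where Y: "Y \<subseteq> P" "card Y = Suc t"
    "real (card {S \<in> H. S \<subseteq> Y}) * real (card P) ^ h \<le> real (card H) * real (Suc t) ^ h" by auto
  have finY: "finite Y" using Y fin finite_subset by blast
  let ?H = "\<lambda>Y. {S \<in> H. S \<subseteq> Y}"
  have finH: "finite (?H Z)" for Z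
  proof -
    have "?H Z \<subseteq> Pow P" using H by blast
    thus ?thesis using fin finite_subset by blast
  qed
  have "\<exists>v\<in>Y. h * card (?H Y) \<le> Suc t * card {S \<in> ?H Y. v \<in> S}"
  proof (rule ccontr)
    assume "\<not> ?thesis"
    hence "(\<Sum>v\<in>Y. Suc t * card {S \<in> ?H Y. v \<in> S}) < (\<Sum>v\<in>Y. h * card (?H Y))"
      using finY Y(2) by (intro sum_strict_mono) auto
    also have "\<dots> = Suc t * (h * card (?H Y))" using Y by simp
    also have "(\<Sum>v\<in>Y. Suc t * card {S \<in> ?H Y. v \<in> S}) = Suc t * (\<Sum>v\<in>Y. card {S \<in> ?H Y. v \<in> S})"
      by (simp only: sum_distrib_left)
    also have "(\<Sum>v\<in>Y. card {S \<in> ?H Y. v \<in> S}) = (\<Sum>S\<in>?H Y. card {v \<in> Y. v \<in> S})"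
      by (rule sum_card_Collect_swap[OF finY finH])
    also have "\<dots> = (\<Sum>S\<in>?H Y. h)"
    proof (intro sum.cong refl)
      fix S assume "S \<in> ?H Y"
      hence "{v \<in> Y. v \<in> S} = S" "card S = h" using H by auto
      thus "card {v \<in> Y. v \<in> S} = h" by simp
    qed
    finally show False by simp
  qed
  then obtain v where v: "v \<in> Y" "h * card (?H Y) \<le> Suc t * card {S \<in> ?H Y. v \<in> S}" by blast
  have split: "card (?H Y) = card (?H (Y - {v})) + card {S \<in> ?H Y. v \<in> S}"
  proof -
    have "?H Y = ?H (Y - {v}) \<union> {S \<in> ?H Y. v \<in> S}" by auto
    hence "card (?H Y) = card (?H (Y - {v}) \<union> {S \<in> ?H Y. v \<in> S})" by (rule arg_cong)
    also have "\<dots> = card (?H (Y - {v})) + card {S \<in> ?H Y. v \<in> S}"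
      using finH[of "Y - {v}"] finite_subset[OF _ finH[of Y], of "{S \<in> ?H Y. v \<in> S}"]
      by (intro card_Un_disjoint) auto
    finally show ?thesis .
  qed
  have "real h * real (card (?H Y)) \<le> real (Suc t) * real (card {S \<in> ?H Y. v \<in> S})"
    using v(2) by (simp only: of_nat_mult[symmetric] of_nat_le_iff)
  hence "real (card (?H (Y - {v}))) \<le> (1 + real h * (- 1 / real (Suc t))) * real (card (?H Y))"
    using split by (simp add: field_simps del: of_nat_Suc)
  \<comment> \<open>By averaging, \<open>v\<close> lies in at least the fraction
    \<open>h / Suc t\<close> of the edges. Bernoulli's inequality turns the surviving fraction into
    the \<open>h\<close>-th power that the induction needs.\<close>
  also have "\<dots> \<le> (1 + - 1 / real (Suc t)) ^ h * real (card (?H Y))"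
    by (intro mult_right_mono Bernoulli_inequality) auto
  also have "1 + - 1 / real (Suc t) = real t / real (Suc t)" by (simp add: field_simps)
  finally have "real (card (?H (Y - {v}))) * real (card P) ^ h
      \<le> (real t / real (Suc t)) ^ h * real (card (?H Y)) * real (card P) ^ h"
    by (intro mult_right_mono) auto
  also have "\<dots> \<le> (real t / real (Suc t)) ^ h * (real (card H) * real (Suc t) ^ h)"
    unfolding mult.assoc using Y(3) by (intro mult_left_mono) auto
  also have "\<dots> = real (card H) * real t ^ h" by (simp add: power_divide del: of_nat_Suc)
  finally show ?case using Y v finY by (intro exI[of _ "Y - {v}"]) auto
qed

lemma remove_edges:
  assumes "finite Y" "finite H" "\<And>S. S \<in> H \<Longrightarrow> S \<noteq> {}"
  shows "\<exists>Z\<subseteq>Y. card Y \<le> card Z + card H \<and> (\<forall>S\<in>H. \<not> S \<subseteq> Z)"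
proof -
  have "\<forall>S\<in>H. \<exists>v. v \<in> S" using assms(3) by blast
  then obtain f where f: "\<And>S. S \<in> H \<Longrightarrow> f S \<in> S" by metis
  have "card Y - card (f ` H) \<le> card (Y - f ` H)" using assms by (intro diff_card_le_card_Diff) auto
  moreover have "card (f ` H) \<le> card H" using assms by (intro card_image_le)
  ultimately have "card Y \<le> card (Y - f ` H) + card H" by linarith
  thus ?thesis using f by (intro exI[of _ "Y - f ` H"]) blast
qed

section \<open>Real roots of bivariate polynomials\<close>

abbreviation fibre_poly :: "real poly poly \<Rightarrow> real \<Rightarrow> real poly" where
  "fibre_poly p x \<equiv> map_poly (\<lambda>c. poly c x) p"

lemma eval2_fibre_poly: "eval2 p (x, y) = poly (fibre_poly p x) y"
proof -
  have "poly (poly p [:y:]) x = poly (fibre_poly p x) y"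
    by (induction p) (simp_all add: map_poly_pCons)
  thus ?thesis by (simp add: eval2_def)
qed

lemma eval2_mult: "eval2 (p * q) z = eval2 p z * eval2 q z"
  by (simp add: eval2_def)

lemma eval2_dvd: "p dvd q \<Longrightarrow> eval2 p z = 0 \<Longrightarrow> eval2 q z = 0"
  by (auto simp: eval2_mult elim!: dvdE)

section \<open>Factors and squarefree parts of bivariate polynomials\<close>

text \<open>The degree in x is additive under multiplication. In each factor take the last
  coefficient of maximal degree; at index \<open>a + b\<close> of the product only this pair reaches
  degree \<open>M f + M h\<close>, so nothing cancels. \<open>top\<close> asks for a nonzero
  coefficient because the zero polynomial also has degree 0.\<close>

lemma degree_coeff_dvd_le:
  fixes f p :: "'a :: idom poly poly"
  assumes "f dvd p" "p \<noteq> 0" "\<And>i. degree (coeff p i) \<le> d"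
  shows "degree (coeff f i) \<le> d"
proof -
  define M where "M = (\<lambda>g :: 'a poly poly. Max ((\<lambda>i. degree (coeff g i)) ` {..degree g}))"
  define top where "top = (\<lambda>g :: 'a poly poly. GREATEST i. coeff g i \<noteq> 0 \<and> degree (coeff g i) = M g)"
  have le_M: "degree (coeff g i) \<le> M g" for g :: "'a poly poly" and i
    by (cases "i \<le> degree g") (auto simp: M_def coeff_eq_0)
  have top: "coeff g (top g) \<noteq> 0" "degree (coeff g (top g)) = M g"
      "\<And>i. i > top g \<Longrightarrow> coeff g i \<noteq> 0 \<Longrightarrow> degree (coeff g i) < M g"
    if "g \<noteq> 0" for g :: "'a poly poly"
  proof -
    let ?Q = "\<lambda>i. coeff g i \<noteq> 0 \<and> degree (coeff g i) = M g"
    have "M g \<in> (\<lambda>i. degree (coeff g i)) ` {..degree g}"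
      unfolding M_def by (intro Max_in) auto
    then obtain i where i: "degree (coeff g i) = M g" by auto
    have ex: "\<exists>i. ?Q i"
    proof (cases "M g = 0")
      case True
      have "degree (lead_coeff g) \<le> M g" by (rule le_M)
      with True that show ?thesis by (metis le_zero_eq leading_coeff_0_iff)
    next
      case False
      with i show ?thesis by (intro exI[of _ i]) auto
    qed
    have bd: "\<And>i. ?Q i \<Longrightarrow> i \<le> degree g" by (auto intro: le_degree)
    have "?Q (top g)" unfolding top_def
      by (rule GreatestI_ex_nat[where P = "?Q" and b = "degree g", OF ex]) (use bd in blast)
    thus "coeff g (top g) \<noteq> 0" "degree (coeff g (top g)) = M g" by auto
    fix i assume i: "i > top g" "coeff g i \<noteq> 0"
    have "\<not> ?Q i"
    proof
      assume "?Q i"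
      hence "i \<le> top g" unfolding top_def by (rule Greatest_le_nat[where b = "degree g"]) (use bd in blast)
      with i(1) show False by simp
    qed
    with i le_M[of g i] show "degree (coeff g i) < M g" by auto
  qed
  from assms(1) obtain h where p: "p = f * h" by (auto elim!: dvdE)
  from assms(2) p have nz: "f \<noteq> 0" "h \<noteq> 0" by auto
  define a b where "a = top f" and "b = top h"
  let ?t = "\<lambda>i. coeff f i * coeff h (a + b - i)"
  have main: "degree (?t a) = M f + M h"
    using top[OF nz(1)] top[OF nz(2)] by (simp add: a_def b_def degree_mult_eq)
  have other: "coeff (?t i) (M f + M h) = 0" if "i \<le> a + b" "i \<noteq> a" for i
  proof (cases "coeff f i = 0 \<or> coeff h (a + b - i) = 0")
    case True
    thus ?thesis by auto
  next
    case False
    have "degree (coeff f i) + degree (coeff h (a + b - i)) < M f + M h"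
    proof (cases "i > a")
      case True
      with False top(3)[OF nz(1)] le_M[of h "a + b - i"] show ?thesis
        by (auto simp: a_def intro!: add_less_le_mono)
    next
      case F: False
      with that have "a + b - i > b" by linarith
      with False top(3)[OF nz(2)] le_M[of f i] show ?thesis
        by (auto simp: b_def intro!: add_le_less_mono)
    qed
    thus ?thesis using False by (intro coeff_eq_0) (simp add: degree_mult_eq)
  qed
  have "coeff (coeff p (a + b)) (M f + M h) = (\<Sum>i\<le>a+b. coeff (?t i) (M f + M h))"
    by (simp add: p coeff_mult coeff_sum)
  also have "\<dots> = (\<Sum>i\<in>{a}. coeff (?t i) (M f + M h))"
    by (rule sum.mono_neutral_right) (use other in auto)
  also have "\<dots> = lead_coeff (?t a)" using main by simp
  also have "\<dots> \<noteq> 0" using top(1)[OF nz(1)] top(1)[OF nz(2)] by (simp add: a_def b_def)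
  finally have "M f + M h \<le> degree (coeff p (a + b))" by (rule le_degree)
  with assms(3)[of "a + b"] le_M[of f i] show ?thesis by linarith
qed

lemma degree_pos_if_prime_dvd_primitive:
  fixes f p :: "real poly poly"
  assumes "prime_elem f" "f dvd p" "Polynomial.content p = 1"
  shows "0 < degree f"
proof (rule ccontr)
  assume "\<not> 0 < degree f"
  then obtain c where c: "f = [:c:]" by (metis degree_eq_zeroE gr0I)
  hence "c dvd Polynomial.content p" using assms(2) by (simp add: const_poly_dvd_iff_dvd_content)
  with assms(3) have "f dvd 1" by (simp add: c is_unit_const_poly_iff)
  with assms(1) show False by (auto simp: prime_elem_def)
qed

text \<open>Primes in x alone would divide both \<open>q\<close> and its derivative, but primitivity
  excludes them. A common prime \<open>f\<close> of positive degree in y, with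
  \<open>q = f * h\<close>, divides \<open>h * pderiv f\<close>: dividing \<open>h\<close>
  contradicts squarefreeness, and dividing \<open>pderiv f\<close>, nonzero in characteristic 0,
  contradicts the degrees.\<close>

lemma degree_gcd_pderiv_squarefree:
  fixes q p :: "real poly poly"
  assumes "squarefree q" "q dvd p" "Polynomial.content p = 1"
  shows "degree (gcd q (pderiv q)) = 0"
proof (rule ccontr)
  define g where "g = gcd q (pderiv q)"
  assume "\<not> ?thesis"
  hence dg: "degree g > 0" by (simp add: g_def)
  hence "\<not> is_unit g" "g \<noteq> 0" by (auto simp: is_unit_poly_iff)
  then obtain f where f: "prime f" "f dvd g" by (metis prime_divisor_exists)
  hence pf: "prime_elem f" by simp
  have fq: "f dvd q" "f dvd pderiv q" using f by (auto simp: g_def)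
  have df: "degree f > 0"
    using degree_pos_if_prime_dvd_primitive[OF pf _ assms(3)] fq assms(2) dvd_trans by blast
  obtain h where h: "q = f * h" using fq by (auto elim!: dvdE)
  have "pderiv q = f * pderiv h + h * pderiv f" by (simp add: h pderiv_mult)
  with fq have "f dvd h * pderiv f" by (metis dvd_add_right_iff dvd_triv_left)
  hence "f dvd h \<or> f dvd pderiv f" using pf by (simp add: prime_elem_dvd_mult_iff)
  moreover have "\<not> f dvd pderiv f"
  proof
    assume d: "f dvd pderiv f"
    have "pderiv f \<noteq> 0" using df by (simp add: pderiv_eq_0_iff)
    from dvd_imp_degree_le[OF d this] df show False by (simp add: degree_pderiv)
  qed
  moreover have "\<not> f dvd h"
  proof
    assume "f dvd h"
    hence "f ^ 2 dvd q" by (auto simp: h power2_eq_square)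
    with assms(1) have "f dvd 1" by (rule squarefreeD)
    with pf show False by auto
  qed
  ultimately show False by blast
qed

text \<open>\<open>C\<close> is the content, whose roots give vertical lines, and \<open>q\<close>
  is the product of the distinct primes of the primitive part. As a divisor of \<open>p\<close>,
  \<open>q\<close> inherits both degree bounds.\<close>

lemma squarefree_reduction:
  fixes p :: "real poly poly"
  assumes "p \<noteq> 0" "degree p \<le> d" "\<And>i. degree (coeff p i) \<le> d"
  obtains q and C :: "real poly" where "q \<noteq> 0" "C \<noteq> 0" "degree C \<le> d" "degree q \<le> d"
    "\<And>i. degree (coeff q i) \<le> d" "resultant q (pderiv q) \<noteq> 0"
    "\<And>z. eval2 p z = 0 \<longleftrightarrow> poly C (fst z) = 0 \<or> eval2 q z = 0"
proof -
  define C where "C = Polynomial.content p"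
  define p1 where "p1 = primitive_part p"
  define q where "q = \<Prod>(prime_factors p1)"
  have p: "p = Polynomial.smult C p1" by (simp add: C_def p1_def)
  have p1: "p1 \<noteq> 0" "Polynomial.content p1 = 1" using assms(1) by (auto simp: p1_def)
  have C: "C \<noteq> 0" using assms(1) by (simp add: C_def)
  have qnz: "q \<noteq> 0" by (auto simp: q_def)
  define M where "M = prime_factorization p1"
  have M: "prod_mset M dvd p1" "p1 dvd prod_mset M"
    using prod_mset_prime_factorization_weak[OF p1(1)] unfolding M_def by (auto dest: associatedD1 associatedD2)
  have q_dvd: "q dvd p1"
  proof -
    have "q dvd prod_mset M" unfolding q_def M_def[symmetric] prod_mset_multiplicity
      by (intro prod_dvd_prod) (auto intro!: dvd_power)
    also note M(1)
    finally show ?thesis .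
  qed
  have sqf: "squarefree q" unfolding q_def
    by (intro squarefree_prod_coprime) (auto intro: primes_coprime squarefree_prime)
  have dvd_p: "p1 dvd p" by (simp add: p dvd_smult)
  have q_dvd_p: "q dvd p" using q_dvd dvd_p by (rule dvd_trans)
  have zero: "eval2 p1 z = 0 \<longleftrightarrow> eval2 q z = 0" for z
  proof
    assume "eval2 p1 z = 0"
    hence "eval2 (prod_mset M) z = 0" using M(2) eval2_dvd by blast
    hence "\<exists>f\<in>set_mset M. eval2 f z = 0"
      by (auto simp: eval2_def poly_prod prod_mset_multiplicity poly_power)
    thus "eval2 q z = 0" by (auto simp: q_def eval2_def poly_prod M_def)
  next
    assume "eval2 q z = 0"
    thus "eval2 p1 z = 0" using eval2_dvd[OF q_dvd] by blast
  qed
  show ?thesis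
  proof (rule that[of q C])
    show "q \<noteq> 0" "C \<noteq> 0" by fact+
    have "coeff p (degree p) \<noteq> 0" using assms(1) by simp
    moreover have "C dvd coeff p (degree p)" by (simp add: C_def content_dvd_coeff)
    ultimately have "degree C \<le> degree (coeff p (degree p))" by (intro dvd_imp_degree_le)
    with assms(3)[of "degree p"] show "degree C \<le> d" by linarith
    from dvd_imp_degree_le[OF q_dvd_p assms(1)] assms(2) show "degree q \<le> d" by linarith
    show "degree (coeff q i) \<le> d" for i
      by (rule degree_coeff_dvd_le[OF q_dvd_p assms(1,3)])
    show "resultant q (pderiv q) \<noteq> 0"
      unfolding resultant_0_gcd using degree_gcd_pderiv_squarefree[OF sqf q_dvd p1(2)] by simp
    show "eval2 p z = 0 \<longleftrightarrow> poly C (fst z) = 0 \<or> eval2 q z = 0" for z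
      by (subst zero[symmetric]) (simp add: p eval2_def)
  qed
qed

section \<open>Local stability of the real roots in a fibre\<close>

lemma continuous_on_eval2: "continuous_on A (eval2 p)"
proof (induction p)
  case 0
  show ?case by (simp add: eval2_def)
next
  case (pCons a p)
  have "eval2 (pCons a p) = (\<lambda>z. poly a (fst z) + snd z * eval2 p z)"
    by (simp add: eval2_def fun_eq_iff)
  with pCons show ?case by (auto intro!: continuous_intros)
qed

lemma coeff_fibre_poly [simp]: "coeff (fibre_poly p x) i = poly (coeff p i) x"
  by (simp add: coeff_map_poly)

lemma pderiv_fibre_poly: "pderiv (fibre_poly p x) = fibre_poly (pderiv p) x"
  by (rule poly_eqI) (simp add: coeff_pderiv)

lemma degree_fibre_poly:
  "poly (lead_coeff p) x \<noteq> 0 \<Longrightarrow> degree (fibre_poly p x) = degree p"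
  by (intro antisym degree_map_poly_le le_degree) simp_all

lemma eval2_DERIV: "((\<lambda>y. eval2 p (x, y)) has_real_derivative eval2 (pderiv p) (x, y)) (at y)"
  unfolding eval2_fibre_poly pderiv_fibre_poly[symmetric] by (rule poly_DERIV)

text \<open>On the compact set \<open>K\<close> the modulus over \<open>x0\<close> has a positive
  minimum, and uniform continuity on a compact strip carries nonvanishing to nearby fibres.\<close>

lemma tube_nonzero:
  fixes F :: "real \<times> real \<Rightarrow> real"
  assumes F: "continuous_on UNIV F" and K: "compact K" and nz: "\<And>y. y \<in> K \<Longrightarrow> F (x0, y) \<noteq> 0"
  shows "\<exists>\<delta>>0. \<forall>x y. \<bar>x - x0\<bar> < \<delta> \<longrightarrow> y \<in> K \<longrightarrow> F (x, y) \<noteq> 0"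
proof (cases "K = {}")
  case False
  have "continuous_on K (\<lambda>y. \<bar>F (x0, y)\<bar>)"
    by (intro continuous_intros continuous_on_compose2[OF F]) auto
  from continuous_attains_inf[OF K False this] obtain y0 where y0: "y0 \<in> K"
    "\<And>y. y \<in> K \<Longrightarrow> \<bar>F (x0, y0)\<bar> \<le> \<bar>F (x0, y)\<bar>" by auto
  have "compact ({x0 - 1..x0 + 1} \<times> K)" by (intro compact_Times K) auto
  hence "uniformly_continuous_on ({x0 - 1..x0 + 1} \<times> K) F"
    by (intro compact_uniformly_continuous continuous_on_subset[OF F]) auto
  moreover have "\<bar>F (x0, y0)\<bar> > 0" using nz y0 by auto
  ultimately obtain \<delta> where \<delta>: "\<delta> > 0" "\<And>z z'. z \<in> {x0 - 1..x0 + 1} \<times> K \<Longrightarrow> z' \<in> {x0 - 1..x0 + 1} \<times> K \<Longrightarrow>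
    dist z' z < \<delta> \<Longrightarrow> dist (F z') (F z) < \<bar>F (x0, y0)\<bar>"
    unfolding uniformly_continuous_on_def by meson
  show ?thesis
  proof (intro exI[of _ "min \<delta> 1"] conjI allI impI)
    fix x y assume xy: "\<bar>x - x0\<bar> < min \<delta> 1" "y \<in> K"
    have "dist (F (x, y)) (F (x0, y)) < \<bar>F (x0, y0)\<bar>"
      using xy by (intro \<delta>(2)) (auto simp: dist_Pair_Pair dist_real_def)
    with y0(2)[OF xy(2)] show "F (x, y) \<noteq> 0" by (auto simp: dist_real_def)
  qed (use \<delta> in auto)
qed (auto intro!: exI[of _ 1])

lemma eventually_nhds_neq_if_isCont:
  fixes f :: "'a :: t2_space \<Rightarrow> 'b :: t2_space"
  assumes "isCont f x" "f x \<noteq> c"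
  shows "\<forall>\<^sub>F z in nhds x. f z \<noteq> c"
proof -
  have "(f \<longlongrightarrow> f x) (nhds x)"
    using assms(1) by (simp add: isCont_def tendsto_at_iff_tendsto_nhds)
  thus ?thesis using assms(2) by (rule tendsto_imp_eventually_ne)
qed

text \<open>Roots escaping to infinity would be roots of the reflected polynomial tending to 0,
  where its value over \<open>x0\<close> is the nonzero leading coefficient.\<close>

lemma no_roots_at_infinity:
  assumes "poly (lead_coeff q) x0 \<noteq> 0"
  shows "\<exists>\<delta>>0. \<exists>M. \<forall>x y. \<bar>x - x0\<bar> < \<delta> \<longrightarrow> \<bar>y\<bar> > M \<longrightarrow> eval2 q (x, y) \<noteq> 0"
proof -
  have "isCont (eval2 (reflect_poly q)) (x0, 0)"
    using continuous_on_eval2[of UNIV] by (simp add: continuous_on_eq_continuous_at)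
  moreover have "eval2 (reflect_poly q) (x0, 0) \<noteq> 0"
    using assms by (simp add: eval2_fibre_poly poly_0_coeff_0)
  ultimately have "\<forall>\<^sub>F z in nhds (x0, 0). eval2 (reflect_poly q) z \<noteq> 0"
    by (rule eventually_nhds_neq_if_isCont)
  moreover have "isCont (poly (lead_coeff q)) x0" by simp
  hence "\<forall>\<^sub>F x in nhds x0. poly (lead_coeff q) x \<noteq> 0"
    using assms by (rule eventually_nhds_neq_if_isCont)
  ultimately obtain d1 d2 where d: "d1 > 0" "d2 > 0"
    "\<And>z. dist z (x0, 0) < d1 \<Longrightarrow> eval2 (reflect_poly q) z \<noteq> 0"
    "\<And>x. dist x x0 < d2 \<Longrightarrow> poly (lead_coeff q) x \<noteq> 0"
    unfolding eventually_nhds_metric by auto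
  show ?thesis
  proof (rule exI[of _ "min (d1 / 2) d2"], rule conjI[OF _ exI[of _ "2 / d1"]], goal_cases)
    case 2
    show ?case
    proof (intro allI impI)
    fix x y assume x: "\<bar>x - x0\<bar> < min (d1 / 2) d2" and y: "2 / d1 < \<bar>y\<bar>"
    have "2 / d1 > 0" using d by simp
    with y have y0: "y \<noteq> 0" by auto
    have "\<bar>inverse y\<bar> < d1 / 2" using y y0 d(1) by (simp add: field_simps abs_inverse)
    hence "dist (x, inverse y) (x0, 0) < d1" using x
      by (auto simp: dist_Pair_Pair dist_real_def intro!: le_less_trans[OF sqrt_sum_squares_le_sum_abs])
    hence "eval2 (reflect_poly q) (x, inverse y) \<noteq> 0" by (rule d(3))
    moreover have lc: "poly (lead_coeff q) x \<noteq> 0" using x by (intro d(4)) (auto simp: dist_real_def)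
    \<comment> \<open>Reflection commutes with specialization because the degree does not drop at
      \<open>x\<close>.\<close>
    have "fibre_poly (reflect_poly q) x = reflect_poly (fibre_poly q x)"
      by (rule poly_eqI) (simp add: coeff_reflect_poly degree_fibre_poly[OF lc])
    ultimately show "eval2 q (x, y) \<noteq> 0"
      using y0 by (simp add: eval2_fibre_poly poly_reflect_poly_nz)
    qed
  qed (use d in auto)
qed

definition fib :: "(real \<times> real) set \<Rightarrow> real \<Rightarrow> real set" where
  "fib \<gamma> x = {y. (x, y) \<in> \<gamma>}"

text \<open>Meaningful only for \<open>j < card (fib \<gamma> x)\<close>, roots being counted from 0
  upwards. This guard also excludes infinite fibres, whose \<open>card\<close> is 0.\<close>

definition rt :: "(real \<times> real) set \<Rightarrow> nat \<Rightarrow> real \<Rightarrow> real" where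
  "rt \<gamma> j x = sorted_list_of_set (fib \<gamma> x) ! j"

lemma sorted_list_of_set_image_strict_mono:
  fixes g :: "'a :: linorder \<Rightarrow> 'b :: linorder"
  assumes "finite A" "strict_mono_on A g"
  shows "sorted_list_of_set (g ` A) = map g (sorted_list_of_set A)"
proof (rule sorted_distinct_set_unique)
  show "sorted (map g (sorted_list_of_set A))"
    unfolding sorted_map
    by (rule sorted_wrt_mono_rel[OF _ sorted_sorted_list_of_set])
      (use assms(1) strict_mono_on_leD[OF assms(2)] in auto)
  show "distinct (map g (sorted_list_of_set A))"
    using assms by (simp add: distinct_map strict_mono_on_imp_inj_on)
qed (use assms in auto)

text \<open>At a simple root the sign changes, so a root persists nearby; a second one would, by
  Rolle, give a zero of the derivative. Compactness excludes further roots in a bounded range and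
  \<open>no_roots_at_infinity\<close> those outside it. The new roots are in the same order as the
  old ones, so each keeps its index.\<close>

lemma roots_locally_stable:
  fixes q :: "real poly poly"
  defines "Z \<equiv> {z. eval2 q z = 0}"
  assumes lc: "poly (lead_coeff q) x0 \<noteq> 0"
    and simple: "\<And>y. eval2 q (x0, y) = 0 \<Longrightarrow> eval2 (pderiv q) (x0, y) \<noteq> 0"
    and "\<epsilon> > 0"
  shows "\<exists>\<delta>>0. \<forall>x. \<bar>x - x0\<bar> < \<delta> \<longrightarrow> card (fib Z x) = card (fib Z x0) \<and>
           (\<forall>j<card (fib Z x0). \<bar>rt Z j x - rt Z j x0\<bar> < \<epsilon>)"
proof -
  define A where "A = fib Z x0"
  have fib: "fib Z x = {y. eval2 q (x, y) = 0}" for x by (auto simp: fib_def Z_def)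
  have finA: "finite A" unfolding A_def fib eval2_fibre_poly
    using lc by (intro poly_roots_finite) (metis coeff_fibre_poly coeff_0)
  have cont: "continuous_on S (\<lambda>y. eval2 p (x, y))" for S p x
    by (intro continuous_on_compose2[OF continuous_on_eval2[of UNIV]] continuous_intros) auto
  have "\<exists>\<eta>>0. \<forall>a\<in>A. \<forall>y. \<bar>y - a\<bar> \<le> \<eta> \<longrightarrow> eval2 (pderiv q) (x0, y) \<noteq> 0"
  proof -
    have "\<forall>a\<in>A. \<exists>\<eta>>0. \<forall>y. \<bar>y - a\<bar> < \<eta> \<longrightarrow> eval2 (pderiv q) (x0, y) \<noteq> 0"
    proof
      fix a assume a: "a \<in> A"
      have "isCont (\<lambda>y. eval2 (pderiv q) (x0, y)) a" using cont[of UNIV]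
        by (simp add: continuous_on_eq_continuous_at)
      moreover have "eval2 (pderiv q) (x0, a) \<noteq> 0" using simple a by (auto simp: A_def fib)
      ultimately have "\<forall>\<^sub>F y in nhds a. eval2 (pderiv q) (x0, y) \<noteq> 0"
        by (rule eventually_nhds_neq_if_isCont)
      thus "\<exists>\<eta>>0. \<forall>y. \<bar>y - a\<bar> < \<eta> \<longrightarrow> eval2 (pderiv q) (x0, y) \<noteq> 0"
        unfolding eventually_nhds_metric by (auto simp: dist_real_def)
    qed
    then obtain h where h: "\<And>a. a \<in> A \<Longrightarrow> h a > 0"
      "\<And>a y. a \<in> A \<Longrightarrow> \<bar>y - a\<bar> < h a \<Longrightarrow> eval2 (pderiv q) (x0, y) \<noteq> 0" by metis
    define \<eta> where "\<eta> = Min (insert 1 (h ` A)) / 2"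
    have "\<eta> > 0" using h finA by (auto simp: \<eta>_def)
    moreover have "\<eta> < h a" if "a \<in> A" for a
    proof -
      have "Min (insert 1 (h ` A)) \<le> h a" using finA that by (intro Min_le) auto
      moreover have "Min (insert 1 (h ` A)) > 0" using h finA by auto
      ultimately show ?thesis by (simp add: \<eta>_def)
    qed
    ultimately show ?thesis using h by (intro exI[of _ \<eta>]) force
  qed
  then obtain \<eta>1 where \<eta>1: "\<eta>1 > 0" "\<And>a y. a \<in> A \<Longrightarrow> \<bar>y - a\<bar> \<le> \<eta>1 \<Longrightarrow> eval2 (pderiv q) (x0, y) \<noteq> 0"
    by blast
  have "\<exists>\<eta>>0. \<forall>a\<in>A. \<forall>b\<in>A. a < b \<longrightarrow> a + 2 * \<eta> < b"
  proof -
    define D where "D = insert 1 ((\<lambda>(a, b). b - a) ` {(a, b). a \<in> A \<and> b \<in> A \<and> a < b})"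
    have "finite D" unfolding D_def
      by (intro finite.insertI finite_imageI finite_subset[OF _ finite_cartesian_product[OF finA finA]]) auto
    moreover have "D \<noteq> {}" "\<And>t. t \<in> D \<Longrightarrow> t > 0" by (auto simp: D_def)
    ultimately have "Min D > 0" by simp
    moreover have "a + 2 * (Min D / 3) < b" if "a \<in> A" "b \<in> A" "a < b" for a b
    proof -
      have "Min D \<le> b - a" using \<open>finite D\<close> that by (intro Min_le) (auto simp: D_def)
      with \<open>Min D > 0\<close> show ?thesis by linarith
    qed
    ultimately show ?thesis by (intro exI[of _ "Min D / 3"]) auto
  qed
  then obtain \<eta>2 where \<eta>2: "\<eta>2 > 0" "\<And>a b. a \<in> A \<Longrightarrow> b \<in> A \<Longrightarrow> a < b \<Longrightarrow> a + 2 * \<eta>2 < b"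
    by blast
  \<comment> \<open>Small enough for the accuracy \<open>\<epsilon>\<close>, for a nonvanishing
    derivative near every root, and for disjoint neighbourhoods of distinct roots.\<close>
  define \<eta> where "\<eta> = min \<epsilon> (min \<eta>1 \<eta>2)"
  have \<eta>: "\<eta> > 0" "\<eta> \<le> \<epsilon>" using \<eta>1 \<eta>2 \<open>\<epsilon> > 0\<close> by (auto simp: \<eta>_def)
  have ysep: "eval2 (pderiv q) (x0, y) \<noteq> 0" if "a \<in> A" "\<bar>y - a\<bar> \<le> \<eta>" for a y
    using \<eta>1(2)[OF that(1)] that(2) by (auto simp: \<eta>_def)
  have sep: "a + 2 * \<eta> < b" if "a \<in> A" "b \<in> A" "a < b" for a b
    using \<eta>2(2)[OF that] by (auto simp: \<eta>_def min_def split: if_splits)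
  have rolle: "\<exists>y. u < y \<and> y < v \<and> eval2 (pderiv q) (x, y) = 0"
    if "u < v" "eval2 q (x, u) = 0" "eval2 q (x, v) = 0" for u v x
  proof -
    have "\<exists>z. u < z \<and> z < v \<and> ((\<lambda>y. eval2 q (x, y)) has_real_derivative 0) (at z)"
      using that
      by (intro Rolle cont) (auto intro: real_differentiable_def[THEN iffD2, OF exI, OF eval2_DERIV])
    then obtain z where z: "u < z" "z < v" "((\<lambda>y. eval2 q (x, y)) has_real_derivative 0) (at z)"
      by blast
    have "eval2 (pderiv q) (x, z) = 0" using DERIV_unique[OF eval2_DERIV z(3)] .
    with z show ?thesis by blast
  qed
  have opp: "eval2 q (x0, a - \<eta>) * eval2 q (x0, a + \<eta>) < 0" if a: "a \<in> A" for a
  proof -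
    have a0: "eval2 q (x0, a) = 0" using a by (auto simp: A_def fib)
    obtain s t where s: "a - \<eta> < s" "s < a" "eval2 q (x0, a) - eval2 q (x0, a - \<eta>) = \<eta> * eval2 (pderiv q) (x0, s)"
      and t: "a < t" "t < a + \<eta>" "eval2 q (x0, a + \<eta>) - eval2 q (x0, a) = \<eta> * eval2 (pderiv q) (x0, t)"
      using MVT2[of "a - \<eta>" a "\<lambda>y. eval2 q (x0, y)" "\<lambda>y. eval2 (pderiv q) (x0, y)"]
        MVT2[of a "a + \<eta>" "\<lambda>y. eval2 q (x0, y)" "\<lambda>y. eval2 (pderiv q) (x0, y)"] \<eta>(1) eval2_DERIV
      by auto
    have "eval2 (pderiv q) (x0, s) * eval2 (pderiv q) (x0, t) > 0"
    proof (rule ccontr)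
      assume "\<not> ?thesis"
      hence "\<exists>y\<ge>s. y \<le> t \<and> eval2 (pderiv q) (x0, y) = 0"
        using IVT'[of "\<lambda>y. eval2 (pderiv q) (x0, y)" s 0 t] IVT2'[of "\<lambda>y. eval2 (pderiv q) (x0, y)" t 0 s]
          s t cont by (auto simp: not_less mult_le_0_iff)
      then obtain y where "s \<le> y" "y \<le> t" "eval2 (pderiv q) (x0, y) = 0" by blast
      moreover from this s t have "\<bar>y - a\<bar> \<le> \<eta>" by linarith
      ultimately show False using ysep[OF a] by blast
    qed
    hence "0 < \<eta> * \<eta> * (eval2 (pderiv q) (x0, s) * eval2 (pderiv q) (x0, t))" using \<eta> by simp
    also have "\<dots> = (\<eta> * eval2 (pderiv q) (x0, s)) * (\<eta> * eval2 (pderiv q) (x0, t))" by simp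
    also have "\<dots> = - (eval2 q (x0, a - \<eta>) * eval2 q (x0, a + \<eta>))"
      unfolding s(3)[symmetric] t(3)[symmetric] a0 by simp
    finally show ?thesis by simp
  qed
  have "\<forall>a\<in>A. \<exists>\<delta>>0. \<forall>x. \<bar>x - x0\<bar> < \<delta> \<longrightarrow> eval2 q (x, a - \<eta>) * eval2 q (x, a + \<eta>) < 0"
  proof
    fix a assume a: "a \<in> A"
    have "isCont (\<lambda>x. eval2 q (x, a - \<eta>) * eval2 q (x, a + \<eta>)) x0"
      by (rule continuous_on_interior[of UNIV])
        (auto intro!: continuous_intros continuous_on_compose2[OF continuous_on_eval2[of UNIV]])
    from order_tendstoD(2)[OF this[unfolded isCont_def] opp[OF a]] opp[OF a]
    have "\<forall>\<^sub>F x in nhds x0. eval2 q (x, a - \<eta>) * eval2 q (x, a + \<eta>) < 0"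
      by (simp add: eventually_nhds_conv_at)
    thus "\<exists>\<delta>>0. \<forall>x. \<bar>x - x0\<bar> < \<delta> \<longrightarrow> eval2 q (x, a - \<eta>) * eval2 q (x, a + \<eta>) < 0"
      unfolding eventually_nhds_metric by (auto simp: dist_real_def)
  qed
  then obtain h where h: "\<And>a. a \<in> A \<Longrightarrow> h a > 0"
    "\<And>a x. a \<in> A \<Longrightarrow> \<bar>x - x0\<bar> < h a \<Longrightarrow> eval2 q (x, a - \<eta>) * eval2 q (x, a + \<eta>) < 0" by metis
  define \<delta>1 where "\<delta>1 = Min (insert 1 (h ` A))"
  have \<delta>1: "\<delta>1 > 0" "\<And>a x. a \<in> A \<Longrightarrow> \<bar>x - x0\<bar> < \<delta>1 \<Longrightarrow> eval2 q (x, a - \<eta>) * eval2 q (x, a + \<eta>) < 0"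
    using h finA by (auto simp: \<delta>1_def)
  define N where "N = (\<Union>a\<in>A. {a - \<eta>..a + \<eta>})"
  have "compact N" unfolding N_def using finA by (intro compact_UN) auto
  then obtain \<delta>2 where \<delta>2: "\<delta>2 > 0" "\<And>x y. \<bar>x - x0\<bar> < \<delta>2 \<Longrightarrow> y \<in> N \<Longrightarrow> eval2 (pderiv q) (x, y) \<noteq> 0"
    using tube_nonzero[OF continuous_on_eval2, of N "pderiv q" x0] ysep
    by (force simp: N_def abs_le_iff)
  obtain \<delta>3 M where \<delta>3: "\<delta>3 > 0" "\<And>x y. \<bar>x - x0\<bar> < \<delta>3 \<Longrightarrow> \<bar>y\<bar> > M \<Longrightarrow> eval2 q (x, y) \<noteq> 0"
    using no_roots_at_infinity[OF lc] by blast
  define K where "K = {-M..M} - (\<Union>a\<in>A. {a - \<eta><..<a + \<eta>})"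
  have "compact K" unfolding K_def by (intro compact_diff open_UN) auto
  moreover have "eval2 q (x0, y) \<noteq> 0" if "y \<in> K" for y
  proof
    assume "eval2 q (x0, y) = 0"
    hence "y \<in> A" by (simp add: A_def fib)
    with that \<eta>(1) show False by (auto simp: K_def)
  qed
  ultimately obtain \<delta>4 where \<delta>4: "\<delta>4 > 0" "\<And>x y. \<bar>x - x0\<bar> < \<delta>4 \<Longrightarrow> y \<in> K \<Longrightarrow> eval2 q (x, y) \<noteq> 0"
    using tube_nonzero[OF continuous_on_eval2, of K q x0] by blast
  define \<delta> where "\<delta> = min (min \<delta>1 \<delta>2) (min \<delta>3 \<delta>4)"
  show ?thesis
  proof (intro exI[of _ \<delta>] conjI allI impI)
    show "\<delta> > 0" using \<delta>1 \<delta>2 \<delta>3 \<delta>4 by (auto simp: \<delta>_def)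
    fix x assume "\<bar>x - x0\<bar> < \<delta>"
    hence x: "\<bar>x - x0\<bar> < \<delta>1" "\<bar>x - x0\<bar> < \<delta>2" "\<bar>x - x0\<bar> < \<delta>3" "\<bar>x - x0\<bar> < \<delta>4" by (auto simp: \<delta>_def)
    have "\<exists>y. \<bar>y - a\<bar> < \<eta> \<and> eval2 q (x, y) = 0" if a: "a \<in> A" for a
    proof -
      have neg: "eval2 q (x, a - \<eta>) * eval2 q (x, a + \<eta>) < 0" using \<delta>1(2)[OF a x(1)] .
      hence "\<exists>y\<ge>a - \<eta>. y \<le> a + \<eta> \<and> eval2 q (x, y) = 0"
        using IVT'[of "\<lambda>y. eval2 q (x, y)" "a - \<eta>" 0 "a + \<eta>"]
          IVT2'[of "\<lambda>y. eval2 q (x, y)" "a + \<eta>" 0 "a - \<eta>"] \<eta> cont by (auto simp: mult_less_0_iff)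
      then obtain y where y: "a - \<eta> \<le> y" "y \<le> a + \<eta>" "eval2 q (x, y) = 0" by blast
      moreover have "y \<noteq> a - \<eta>" "y \<noteq> a + \<eta>" using y(3) neg by auto
      ultimately show ?thesis by (intro exI[of _ y]) (auto simp: abs_less_iff)
    qed
    then obtain g where g: "\<And>a. a \<in> A \<Longrightarrow> \<bar>g a - a\<bar> < \<eta>" "\<And>a. a \<in> A \<Longrightarrow> eval2 q (x, g a) = 0"
      by metis
    have uniq: "y = y'" if "a \<in> A" "\<bar>y - a\<bar> < \<eta>" "\<bar>y' - a\<bar> < \<eta>" "eval2 q (x, y) = 0" "eval2 q (x, y') = 0"
      for a y y'
    proof (rule ccontr)
      assume "y \<noteq> y'"
      hence "min y y' < max y y'" by (simp add: min_def max_def)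
      moreover have "eval2 q (x, min y y') = 0" "eval2 q (x, max y y') = 0"
        using that by (simp_all add: min_def max_def)
      ultimately obtain t where "min y y' < t" "t < max y y'" "eval2 (pderiv q) (x, t) = 0"
        using rolle by blast
      moreover from this have "t \<in> N" unfolding N_def using that(1-3) by (auto intro!: bexI[of _ a])
      ultimately show False using \<delta>2(2)[OF x(2)] by blast
    qed
    have img: "fib Z x = g ` A"
    proof (intro equalityI subsetI)
      fix y assume "y \<in> fib Z x"
      hence y: "eval2 q (x, y) = 0" by (simp add: fib)
      hence "y \<notin> K" "\<bar>y\<bar> \<le> M" using \<delta>4(2)[OF x(4)] \<delta>3(2)[OF x(3), of y] by force+
      then obtain a where "a \<in> A" "\<bar>y - a\<bar> < \<eta>" by (auto simp: K_def abs_less_iff abs_le_iff)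
      with y g[of a] uniq[of a y "g a"] show "y \<in> g ` A" by auto
    qed (use g in \<open>auto simp: fib\<close>)
    have mono: "strict_mono_on A g"
    proof (rule strict_mono_onI)
      fix a b assume ab: "a \<in> A" "b \<in> A" "a < b"
      with sep[OF ab] g(1)[OF ab(1)] g(1)[OF ab(2)] show "g a < g b" by linarith
    qed
    show "card (fib Z x) = card (fib Z x0)"
      unfolding img A_def[symmetric] by (intro card_image strict_mono_on_imp_inj_on mono)
    fix j assume j: "j < card (fib Z x0)"
    hence "rt Z j x = g (rt Z j x0)"
      using finA unfolding rt_def img sorted_list_of_set_image_strict_mono[OF finA mono]
      by (simp add: A_def)
    moreover have "rt Z j x0 \<in> A" using j finA unfolding rt_def A_def
      by (metis nth_mem set_sorted_list_of_set length_sorted_list_of_set)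
    ultimately show "\<bar>rt Z j x - rt Z j x0\<bar> < \<epsilon>" using g(1) \<eta>(2) by fastforce
  qed
qed

section \<open>Curves as stacks of continuous graphs\<close>

text \<open>\<open>W\<close> is the set of exceptional abscissae; a fibre equal to the whole line
  comes from a vertical line in the curve. Away from \<open>W\<close> a curve is a constant number
  of continuous graphs in a fixed order, and this is all that the vertical decomposition uses of its
  being algebraic.\<close>

definition tame :: "nat \<Rightarrow> nat \<Rightarrow> (real \<times> real) set \<Rightarrow> real set \<Rightarrow> bool" where
  "tame B d \<gamma> W \<longleftrightarrow> finite W \<and> card W \<le> B \<and>
     (\<forall>x. x \<in> W \<and> fib \<gamma> x = UNIV \<or> finite (fib \<gamma> x) \<and> card (fib \<gamma> x) \<le> d) \<and>
     (\<forall>x x'. x \<le> x' \<longrightarrow> {x..x'} \<inter> W = {} \<longrightarrow> card (fib \<gamma> x) = card (fib \<gamma> x') \<and>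
        (\<forall>j<card (fib \<gamma> x). continuous_on {x..x'} (rt \<gamma> j)))"

lemma degree_coeff_le_total_degree: "degree (coeff p i) \<le> total_degree p" "degree p \<le> total_degree p"
proof -
  have *: "degree (coeff p i) + i \<le> total_degree p" if "i \<le> degree p" for i
    unfolding total_degree_def using that by (intro Max_ge) auto
  show "degree (coeff p i) \<le> total_degree p"
    using *[of i] by (cases "i \<le> degree p") (auto simp: coeff_eq_0)
  show "degree p \<le> total_degree p" using *[of "degree p"] by simp
qed

lemma degree_resultant_pderiv_le:
  fixes q :: "real poly poly"
  assumes "degree q \<le> d" "\<And>i. degree (coeff q i) \<le> d"
  shows "degree (resultant q (pderiv q)) \<le> d * (2 * d)"
proof -
  define n where "n = degree q + degree (pderiv q)"
  have co: "degree (coeff (pderiv q) i) \<le> d" for i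
  proof -
    have "coeff (pderiv q) i = of_nat (Suc i) * coeff q (Suc i)" by (simp add: coeff_pderiv)
    also have "degree \<dots> \<le> degree (of_nat (Suc i) :: real poly) + degree (coeff q (Suc i))"
      by (rule degree_mult_le)
    also have "\<dots> \<le> d" using assms(2)[of "Suc i"] by (simp del: of_nat_Suc)
    finally show ?thesis .
  qed
  have "degree (resultant q (pderiv q)) \<le> d * n" unfolding resultant_def
  proof (rule degree_det_le)
    show "sylvester_mat q (pderiv q) \<in> carrier_mat n n"
      unfolding n_def by (rule sylvester_carrier_mat)
    fix i j assume "i < n" "j < n"
    thus "degree (sylvester_mat q (pderiv q) $$ (i, j)) \<le> d"
      using assms(2) co by (simp add: sylvester_index_mat n_def)
  qed
  also have "\<dots> \<le> d * (2 * d)" using assms(1) by (intro mult_left_mono) (auto simp: n_def degree_pderiv)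
  finally show ?thesis .
qed

text \<open>Both degrees survive specialization at \<open>x\<close>, so the resultant specializes
  too. A multiple root would put a linear factor into the gcd.\<close>

lemma simple_root_if_resultant_nonzero:
  fixes q :: "real poly poly"
  assumes "poly (lead_coeff q) x \<noteq> 0" "poly (resultant q (pderiv q)) x \<noteq> 0" "eval2 q (x, y) = 0"
  shows "eval2 (pderiv q) (x, y) \<noteq> 0"
proof
  assume 0: "eval2 (pderiv q) (x, y) = 0"
  have dg: "degree (fibre_poly q x) = degree q" using assms(1) by (rule degree_fibre_poly)
  have "degree (fibre_poly (pderiv q) x) = degree (pderiv q)"
    by (simp add: pderiv_fibre_poly[symmetric] degree_pderiv dg)
  with dg have "resultant (fibre_poly q x) (fibre_poly (pderiv q) x) \<noteq> 0"
    using assms(2) by (simp add: poly_hom.resultant_map_poly)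
  hence deg: "degree (gcd (fibre_poly q x) (fibre_poly (pderiv q) x)) = 0"
    by (simp add: resultant_0_gcd)
  have "[:-y, 1:] dvd gcd (fibre_poly q x) (fibre_poly (pderiv q) x)"
    using 0 assms(3) by (simp add: poly_eq_0_iff_dvd eval2_fibre_poly)
  moreover have "fibre_poly q x \<noteq> 0" using assms(1) by (metis coeff_fibre_poly coeff_0)
  hence "gcd (fibre_poly q x) (fibre_poly (pderiv q) x) \<noteq> 0" by simp
  ultimately have "degree [:-y, 1:] \<le> 0" using deg dvd_imp_degree_le by metis
  thus False by simp
qed

text \<open>The exceptional abscissae number at most \<open>d\<close> each for the content and the
  leading coefficient, and \<open>d * (2 * d)\<close> for the resultant. Elsewhere the fibres are
  those of the squarefree part.\<close>

lemma algebraic_curve_tame: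
  assumes "algebraic_curve_of_degree_le d \<gamma>"
  shows "\<exists>W. tame (2 * d + d * (2 * d)) d \<gamma> W"
proof -
  from assms obtain p where p: "0 < total_degree p" "total_degree p \<le> d" "\<gamma> = {z. eval2 p z = 0}"
    unfolding algebraic_curve_of_degree_le_def by auto
  have "p \<noteq> 0" using p(1) by (auto simp: total_degree_def)
  moreover have "degree p \<le> d" "\<And>i. degree (coeff p i) \<le> d"
    using degree_coeff_le_total_degree p(2) le_trans by blast+
  ultimately obtain q C where q: "q \<noteq> 0" "C \<noteq> 0" "degree C \<le> d" "degree q \<le> d"
    "\<And>i. degree (coeff q i) \<le> d" "resultant q (pderiv q) \<noteq> 0"
    "\<And>z. eval2 p z = 0 \<longleftrightarrow> poly C (fst z) = 0 \<or> eval2 q z = 0"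
    using squarefree_reduction by metis
  define Z where "Z = {z. eval2 q z = 0}"
  define W where "W = {x. poly C x = 0} \<union> {x. poly (lead_coeff q) x = 0} \<union> {x. poly (resultant q (pderiv q)) x = 0}"
  have fin: "finite W" using q by (auto simp: W_def intro!: poly_roots_finite)
  have "card W \<le> card {x. poly C x = 0} + card {x. poly (lead_coeff q) x = 0} + card {x. poly (resultant q (pderiv q)) x = 0}"
    unfolding W_def by (meson card_Un_le le_trans add_le_mono1)
  also have "\<dots> \<le> degree C + degree (lead_coeff q) + degree (resultant q (pderiv q))"
    using q by (intro add_mono card_poly_roots_bound) auto
  also have "\<dots> \<le> d + d + d * (2 * d)"
    using q degree_resultant_pderiv_le[of q d] by (intro add_mono) auto
  finally have card: "card W \<le> 2 * d + d * (2 * d)" by simp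
  have fibZ: "fib \<gamma> x = fib Z x" if "x \<notin> W" for x
    using that q(7) by (auto simp: fib_def Z_def p(3) W_def)
  have rtZ: "rt \<gamma> j x = rt Z j x" if "x \<notin> W" for x j
    by (simp add: rt_def fibZ[OF that])
  have bound: "finite {y. eval2 f (x, y) = 0} \<and> card {y. eval2 f (x, y) = 0} \<le> d"
    if "fibre_poly f x \<noteq> 0" "degree f \<le> d" for f x
  proof -
    have "degree (fibre_poly f x) \<le> d" using degree_map_poly_le[of "\<lambda>c. poly c x" f] that(2) by linarith
    thus ?thesis using that poly_roots_finite[OF that(1)] card_poly_roots_bound[OF that(1)]
      by (auto simp: eval2_fibre_poly)
  qed
  \<comment> \<open>The bound is read off \<open>p\<close> itself, since it must also hold over
    \<open>W\<close>, where \<open>q\<close> need not describe the curve.\<close>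
  have fibres: "x \<in> W \<and> fib \<gamma> x = UNIV \<or> finite (fib \<gamma> x) \<and> card (fib \<gamma> x) \<le> d" for x
  proof (cases "fibre_poly p x = 0")
    case True
    hence U: "fib \<gamma> x = UNIV" by (auto simp: fib_def p(3) eval2_fibre_poly)
    moreover have "x \<in> W"
    proof (rule ccontr)
      assume x: "x \<notin> W"
      hence "fibre_poly q x \<noteq> 0" by (auto simp: W_def) (metis coeff_fibre_poly coeff_0)
      from bound[OF this q(4)] have "finite (fib Z x)" by (simp add: fib_def Z_def)
      with U fibZ[OF x] show False by (simp add: infinite_UNIV_char_0)
    qed
    ultimately show ?thesis by blast
  next
    case False
    from bound[OF this \<open>degree p \<le> d\<close>] show ?thesis by (simp add: fib_def p(3))
  qed
  have stable: "\<exists>\<delta>>0. \<forall>x. \<bar>x - x0\<bar> < \<delta> \<longrightarrow> card (fib Z x) = card (fib Z x0) \<and>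
           (\<forall>j<card (fib Z x0). \<bar>rt Z j x - rt Z j x0\<bar> < \<epsilon>)" if "x0 \<notin> W" "\<epsilon> > 0" for x0 \<epsilon>
    unfolding Z_def using that
    by (intro roots_locally_stable simple_root_if_resultant_nonzero) (auto simp: W_def)
  have main: "card (fib \<gamma> x) = card (fib \<gamma> x') \<and> (\<forall>j<card (fib \<gamma> x). continuous_on {x..x'} (rt \<gamma> j))"
    if xx: "x \<le> x'" "{x..x'} \<inter> W = {}" for x x'
  proof -
    have const: "card (fib Z u) = card (fib Z x)" if "u \<in> {x..x'}" for u
    proof (rule connected_local_const[of "{x..x'}"])
      show "\<forall>a\<in>{x..x'}. \<forall>\<^sub>F b in at a within {x..x'}. card (fib Z a) = card (fib Z b)"
      proof
        fix a assume "a \<in> {x..x'}"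
        with xx have "a \<notin> W" by auto
        then obtain \<delta> where "\<delta> > 0" "\<And>b. \<bar>b - a\<bar> < \<delta> \<Longrightarrow> card (fib Z b) = card (fib Z a)"
          using stable[of a 1] by auto
        thus "\<forall>\<^sub>F b in at a within {x..x'}. card (fib Z a) = card (fib Z b)"
          unfolding eventually_at dist_real_def by metis
      qed
    qed (use that xx in auto)
    have "continuous_on {x..x'} (rt Z j)" if j: "j < card (fib Z x)" for j
      unfolding continuous_on_iff
    proof (intro ballI allI impI)
      fix a \<epsilon> :: real assume a: "a \<in> {x..x'}" and "\<epsilon> > 0"
      with xx have "a \<notin> W" by auto
      from stable[OF this \<open>\<epsilon> > 0\<close>] const[OF a] j
      show "\<exists>\<delta>>0. \<forall>b\<in>{x..x'}. dist b a < \<delta> \<longrightarrow> dist (rt Z j b) (rt Z j a) < \<epsilon>"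
        by (auto simp: dist_real_def)
    qed
    moreover have "continuous_on {x..x'} (rt \<gamma> j) \<longleftrightarrow> continuous_on {x..x'} (rt Z j)" for j
      using xx by (intro continuous_on_cong refl rtZ) auto
    moreover have "x \<notin> W" "x' \<notin> W" using xx by auto
    ultimately show ?thesis using const[of x'] xx fibZ by auto
  qed
  from fin card fibres main show ?thesis unfolding tame_def by blast
qed

section \<open>Vertical decompositions\<close>

lemma tame_fib: "tame B d \<gamma> W \<Longrightarrow> x \<in> W \<and> fib \<gamma> x = UNIV \<or> finite (fib \<gamma> x) \<and> card (fib \<gamma> x) \<le> d"
  by (simp add: tame_def)

lemma card_fib_le: "tame B d \<gamma> W \<Longrightarrow> card (fib \<gamma> x) \<le> d"
  using tame_fib[of B d \<gamma> W x] by (auto simp: infinite_UNIV_char_0)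

lemma rt_in_fib: "j < card (fib \<gamma> x) \<Longrightarrow> (x, rt \<gamma> j x) \<in> \<gamma>"
  unfolding rt_def
  by (metis card_ge_0_finite fib_def gr_implies_not0 length_sorted_list_of_set mem_Collect_eq
      neq0_conv nth_mem set_sorted_list_of_set)

lemma rt_less: "j < j' \<Longrightarrow> j' < card (fib \<gamma> x) \<Longrightarrow> rt \<gamma> j x < rt \<gamma> j' x"
  unfolding rt_def using strict_sorted_list_of_set[of "fib \<gamma> x"] by (auto simp: sorted_wrt_iff_nth_less)

lemma rt_le_iff: "j < card (fib \<gamma> x) \<Longrightarrow> j' < card (fib \<gamma> x) \<Longrightarrow> rt \<gamma> j x \<le> rt \<gamma> j' x \<longleftrightarrow> j \<le> j'"
  by (metis rt_less linorder_not_le nat_neq_iff order_less_imp_le order_refl)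

lemma mem_curve_iff:
  assumes "tame B d \<gamma> W"
  shows "(x, y) \<in> \<gamma> \<longleftrightarrow> x \<in> W \<and> fib \<gamma> x = UNIV \<or> (\<exists>j<card (fib \<gamma> x). rt \<gamma> j x = y)"
proof (cases "finite (fib \<gamma> x)")
  case True
  have "(x, y) \<in> \<gamma> \<longleftrightarrow> y \<in> set (sorted_list_of_set (fib \<gamma> x))"
    using True by (simp add: fib_def)
  also have "\<dots> \<longleftrightarrow> (\<exists>j<card (fib \<gamma> x). rt \<gamma> j x = y)"
    by (auto simp: in_set_conv_nth rt_def)
  finally show ?thesis using True by (auto simp: infinite_UNIV_char_0)
next
  case False
  thus ?thesis using tame_fib[OF assms, of x] by (auto simp: fib_def)
qed

section \<open>Columns, gaps, and cells as equivalence classes\<close>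

type_synonym item = "(real \<times> real) set \<times> nat"

definition rv :: "real \<Rightarrow> item \<Rightarrow> real" where
  "rv x a = rt (fst a) (snd a) x"

text \<open>A curve containing the whole line over \<open>x\<close> contributes no item, since an
  infinite fibre has \<open>card\<close> 0. Its points are kept out of the cells by a separate
  condition in \<open>rel\<close>.\<close>

definition items :: "(real \<times> real) set set \<Rightarrow> real \<Rightarrow> item set" where
  "items R x = {a. fst a \<in> R \<and> snd a < card (fib (fst a) x)}"

definition inside :: "real \<times> real \<Rightarrow> item option \<Rightarrow> item option \<Rightarrow> bool" where
  "inside p \<alpha> \<beta> \<longleftrightarrow> (\<forall>a. \<alpha> = Some a \<longrightarrow> rv (fst p) a < snd p) \<and> (\<forall>b. \<beta> = Some b \<longrightarrow> snd p < rv (fst p) b)"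

definition seg :: "real \<Rightarrow> real \<Rightarrow> real set" where
  "seg x y = {min x y..max x y}"

lemma seg_commute: "seg x y = seg y x"
  by (simp add: seg_def min.commute max.commute)

lemma seg_trans: "seg x z \<subseteq> seg x y \<union> seg y z"
  by (auto simp: seg_def min_def max_def)

lemma seg_mono: "y \<in> seg x z \<Longrightarrow> seg x y \<subseteq> seg x z"
  by (auto simp: seg_def min_def max_def split: if_splits)

lemma seg_ends [simp]: "x \<in> seg x y" "y \<in> seg x y" and seg_same [simp]: "seg x x = {x}"
  by (auto simp: seg_def)

locale arrangement =
  fixes \<Gamma> :: "(real \<times> real) set set" and P :: "(real \<times> real) set"
    and W :: "(real \<times> real) set \<Rightarrow> real set" and idx :: "(real \<times> real) set \<Rightarrow> nat"
    and B d r :: nat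
  assumes finite_curves: "finite \<Gamma>" and finite_points: "finite P"
    and tame: "\<gamma> \<in> \<Gamma> \<Longrightarrow> tame B d \<gamma> (W \<gamma>)"
    and inj_idx: "inj_on idx \<Gamma>"
    and inter: "\<gamma> \<in> \<Gamma> \<Longrightarrow> \<delta> \<in> \<Gamma> \<Longrightarrow> \<gamma> \<noteq> \<delta> \<Longrightarrow> finite (\<gamma> \<inter> \<delta>) \<and> card (\<gamma> \<inter> \<delta>) \<le> r"
begin

text \<open>Ties at a crossing are broken by \<open>idx\<close>, so that every column is linearly ordered.\<close>

definition le :: "real \<Rightarrow> item \<Rightarrow> item \<Rightarrow> bool" where
  "le x a b \<longleftrightarrow> rv x a < rv x b \<or> rv x a = rv x b \<and> idx (fst a) \<le> idx (fst b)"

text \<open>\<open>gap R x \<alpha> \<beta>\<close>: on the vertical line over \<open>x\<close>, the roots \<open>\<alpha>\<close> and \<open>\<beta>\<close> of the curves in \<open>R\<close> are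
  distinct and adjacent. \<^const>\<open>None\<close> stands for the ends of the line.\<close>

definition gap :: "(real \<times> real) set set \<Rightarrow> real \<Rightarrow> item option \<Rightarrow> item option \<Rightarrow> bool" where
  "gap R x \<alpha> \<beta> \<longleftrightarrow> (\<forall>a. \<alpha> = Some a \<longrightarrow> a \<in> items R x) \<and> (\<forall>b. \<beta> = Some b \<longrightarrow> b \<in> items R x) \<and>
     (\<forall>a b. \<alpha> = Some a \<longrightarrow> \<beta> = Some b \<longrightarrow> rv x a < rv x b) \<and>
     (\<forall>c\<in>items R x. (\<exists>a. \<alpha> = Some a \<and> le x c a) \<or> (\<exists>b. \<beta> = Some b \<and> le x b c))"

definition walls :: "(real \<times> real) set set \<Rightarrow> real set" where
  "walls R = (\<Union>\<gamma>\<in>R. W \<gamma>)"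

definition cols :: "real set" where
  "cols = fst ` P"

text \<open>Adjacency is tested only over abscissae of points of \<open>P\<close>; what the arcs do
  in between is ignored. The alternative \<open>x = y\<close> allows cells within a column that is
  itself a wall.\<close>

definition linked :: "(real \<times> real) set set \<Rightarrow> item option \<Rightarrow> item option \<Rightarrow> real \<Rightarrow> real \<Rightarrow> bool" where
  "linked R \<alpha> \<beta> x y \<longleftrightarrow> (x = y \<or> walls R \<inter> seg x y = {}) \<and> (\<forall>z\<in>cols \<inter> seg x y. gap R z \<alpha> \<beta>)"

definition rel :: "(real \<times> real) set set \<Rightarrow> real \<times> real \<Rightarrow> real \<times> real \<Rightarrow> bool" where
  "rel R p q \<longleftrightarrow> p \<notin> \<Union>R \<and> q \<notin> \<Union>R \<and>
     (\<exists>\<alpha> \<beta>. inside p \<alpha> \<beta> \<and> inside q \<alpha> \<beta> \<and> linked R \<alpha> \<beta> (fst p) (fst q))"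

definition cls :: "(real \<times> real) set set \<Rightarrow> real \<times> real \<Rightarrow> (real \<times> real) set" where
  "cls R p = {q \<in> P. rel R p q}"

lemma finite_items: assumes "R \<subseteq> \<Gamma>" shows "finite (items R x)" "card (items R x) \<le> card R * d"
proof -
  have sub: "items R x \<subseteq> R \<times> {..<d}"
  proof
    fix a assume "a \<in> items R x"
    with assms have "fst a \<in> \<Gamma>" "fst a \<in> R" "snd a < card (fib (fst a) x)" by (auto simp: items_def)
    with card_fib_le[OF tame, of "fst a" x] show "a \<in> R \<times> {..<d}" by (cases a) auto
  qed
  have fin: "finite R" using assms finite_curves finite_subset by blast
  from sub fin show "finite (items R x)" by (meson finite_SigmaI finite_lessThan finite_subset)
  from card_mono[OF _ sub] fin show "card (items R x) \<le> card R * d" by simp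
qed

lemma le_total: "le x a b \<or> le x b a" by (auto simp: le_def)
lemma le_trans': "le x a b \<Longrightarrow> le x b c \<Longrightarrow> le x a c" by (auto simp: le_def)
lemma le_rv: "le x a b \<Longrightarrow> rv x a \<le> rv x b" by (auto simp: le_def)
lemma not_le_rv: "\<not> le x a b \<Longrightarrow> rv x b \<le> rv x a" by (auto simp: le_def)

lemma le_antisym': 
  assumes "a \<in> items \<Gamma> x" "b \<in> items \<Gamma> x" "le x a b" "le x b a"
  shows "a = b"
proof -
  have "idx (fst a) = idx (fst b)" "rv x a = rv x b" using assms(3,4) by (auto simp: le_def)
  with assms(1,2) inj_idx have f: "fst a = fst b" by (auto simp: items_def inj_on_def)
  moreover have "snd a \<le> snd b" "snd b \<le> snd a"
    using assms(1,2) \<open>rv x a = rv x b\<close> f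
    by (auto simp: items_def rv_def simp flip: rt_le_iff[of "snd a" "fst a" x "snd b"] rt_le_iff[of "snd b" "fst a" x "snd a"])
  ultimately show ?thesis by (auto intro: prod_eqI)
qed

lemma items_mono: "R \<subseteq> R' \<Longrightarrow> items R x \<subseteq> items R' x"
  by (auto simp: items_def)

lemma item_in_gap:
  assumes "gap R x \<alpha> \<beta>" "inside (x, y) \<alpha> \<beta>" "c \<in> items R x"
  shows "(\<exists>a. \<alpha> = Some a \<and> le x c a \<and> rv x c < y) \<or> (\<exists>b. \<beta> = Some b \<and> le x b c \<and> y < rv x c)"
  using assms unfolding gap_def inside_def by (fastforce dest: le_rv)

text \<open>With respect to \<open>le\<close>, the lower bound is the greatest item below
  \<open>p\<close> and the upper bound the least item above it. Antisymmetry of \<open>le\<close>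
  comes from the injectivity of \<open>idx\<close>.\<close>

lemma gap_unique:
  assumes "R \<subseteq> \<Gamma>" "gap R (fst p) \<alpha> \<beta>" "inside p \<alpha> \<beta>" "gap R (fst p) \<alpha>' \<beta>'" "inside p \<alpha>' \<beta>'"
  shows "\<alpha>' = \<alpha> \<and> \<beta>' = \<beta>"
proof -
  let ?x = "fst p"
  have it: "c \<in> items \<Gamma> ?x" if "c \<in> items R ?x" for c using items_mono[OF assms(1)] that by blast
  note D = item_in_gap[of R ?x _ _ "snd p", simplified]
  have A: "\<exists>a'. \<alpha>2 = Some a' \<and> le ?x a a'"
    if "gap R ?x (Some a) \<beta>1" "inside p (Some a) \<beta>1" "gap R ?x \<alpha>2 \<beta>2" "inside p \<alpha>2 \<beta>2" for a \<alpha>2 \<beta>1 \<beta>2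
    using D[OF that(3,4), of a] that(1,2) by (force simp: gap_def inside_def)
  have B: "\<exists>b'. \<beta>2 = Some b' \<and> le ?x b' b"
    if "gap R ?x \<alpha>1 (Some b)" "inside p \<alpha>1 (Some b)" "gap R ?x \<alpha>2 \<beta>2" "inside p \<alpha>2 \<beta>2" for b \<alpha>1 \<alpha>2 \<beta>2
    using D[OF that(3,4), of b] that(1,2) by (force simp: gap_def inside_def)
  have "\<alpha>' = \<alpha>"
  proof (cases \<alpha>)
    case None
    show ?thesis
    proof (cases \<alpha>')
      case (Some a)
      with A[of a \<beta>' \<alpha> \<beta>] assms None show ?thesis by simp
    qed (use None in simp)
  next
    case (Some a)
    with A[of a \<beta> \<alpha>' \<beta>'] assms obtain a' where a': "\<alpha>' = Some a'" "le ?x a a'" by auto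
    with A[of a' \<beta>' \<alpha> \<beta>] assms Some have "le ?x a' a" by auto
    with a' Some assms(2,4) le_antisym'[of a ?x a'] it show ?thesis by (auto simp: gap_def)
  qed
  moreover have "\<beta>' = \<beta>"
  proof (cases \<beta>)
    case None
    show ?thesis
    proof (cases \<beta>')
      case (Some b)
      with B[of \<alpha>' b \<alpha> \<beta>] assms None show ?thesis by simp
    qed (use None in simp)
  next
    case (Some b)
    with B[of \<alpha> b \<alpha>' \<beta>'] assms obtain b' where b': "\<beta>' = Some b'" "le ?x b' b" by auto
    with B[of \<alpha>' b' \<alpha> \<beta>] assms Some have "le ?x b b'" by auto
    with b' Some assms(2,4) le_antisym'[of b ?x b'] it show ?thesis by (auto simp: gap_def)
  qed
  ultimately show ?thesis by simp
qed

text \<open>An item strictly above \<open>\<alpha>\<close> must lie at or beyond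
  \<open>\<beta>\<close> in \<open>le\<close>, so the upper bound is the least such item. Together
  with its mirror image this lets a single arc identify a cell when cells are counted.\<close>

lemma gap_unique_above:
  assumes "R \<subseteq> \<Gamma>" "gap R x \<alpha> \<beta>" "gap R x \<alpha> \<beta>'"
  shows "\<beta>' = \<beta>"
proof -
  have it: "c \<in> items \<Gamma> x" if "c \<in> items R x" for c using items_mono[OF assms(1)] that by blast
  have B: "\<exists>b'. \<beta>2 = Some b' \<and> le x b' b" if "gap R x \<alpha> (Some b)" "gap R x \<alpha> \<beta>2" for b \<beta>2
    using that unfolding gap_def by (metis le_rv linorder_not_le)
  show ?thesis
  proof (cases \<beta>)
    case None
    show ?thesis
    proof (cases \<beta>')
      case (Some b)
      with B[of b \<beta>] assms None show ?thesis by simp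
    qed (use None in simp)
  next
    case (Some b)
    with B[of b \<beta>'] assms obtain b' where b': "\<beta>' = Some b'" "le x b' b" by auto
    with B[of b' \<beta>] assms Some have "le x b b'" by auto
    with b' Some assms(2,3) le_antisym'[of b x b'] it show ?thesis by (auto simp: gap_def)
  qed
qed

lemma gap_unique_below:
  assumes "R \<subseteq> \<Gamma>" "gap R x \<alpha> \<beta>" "gap R x \<alpha>' \<beta>"
  shows "\<alpha>' = \<alpha>"
proof -
  have it: "c \<in> items \<Gamma> x" if "c \<in> items R x" for c using items_mono[OF assms(1)] that by blast
  have B: "\<exists>a'. \<alpha>2 = Some a' \<and> le x a a'" if "gap R x (Some a) \<beta>" "gap R x \<alpha>2 \<beta>" for a \<alpha>2
    using that unfolding gap_def by (metis le_rv linorder_not_le)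
  show ?thesis
  proof (cases \<alpha>)
    case None
    show ?thesis
    proof (cases \<alpha>')
      case (Some a)
      with B[of a \<alpha>] assms None show ?thesis by simp
    qed (use None in simp)
  next
    case (Some a)
    with B[of a \<alpha>'] assms obtain a' where a': "\<alpha>' = Some a'" "le x a a'" by auto
    with B[of a' \<alpha>] assms Some have "le x a' a" by auto
    with a' Some assms(2,3) le_antisym'[of a x a'] it show ?thesis by (auto simp: gap_def)
  qed
qed

lemma ex_le_greatest: "finite S \<Longrightarrow> S \<noteq> {} \<Longrightarrow> \<exists>m\<in>S. \<forall>c\<in>S. le x c m"
proof (induction S rule: finite_ne_induct)
  case (singleton a)
  show ?case using le_total[of x a a] by blast
next
  case (insert a S)
  then obtain m where m: "m \<in> S" "\<forall>c\<in>S. le x c m" by blast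
  show ?case
  proof (cases "le x a m")
    case False
    hence "le x m a" "le x a a" using le_total by blast+
    with m show ?thesis by (blast intro: le_trans')
  qed (use m in blast)
qed

lemma ex_le_least: "finite S \<Longrightarrow> S \<noteq> {} \<Longrightarrow> \<exists>m\<in>S. \<forall>c\<in>S. le x m c"
proof (induction S rule: finite_ne_induct)
  case (singleton a)
  show ?case using le_total[of x a a] by blast
next
  case (insert a S)
  then obtain m where m: "m \<in> S" "\<forall>c\<in>S. le x m c" by blast
  show ?case
  proof (cases "le x m a")
    case False
    hence "le x a m" "le x a a" using le_total by blast+
    with m show ?thesis by (blast intro: le_trans')
  qed (use m in blast)
qed

lemma gap_exists:
  assumes "R \<subseteq> \<Gamma>" "p \<notin> \<Union>R"
  shows "\<exists>\<alpha> \<beta>. gap R (fst p) \<alpha> \<beta> \<and> inside p \<alpha> \<beta>"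
proof -
  let ?x = "fst p"
  define L where "L = {a \<in> items R ?x. rv ?x a < snd p}"
  define U where "U = {a \<in> items R ?x. rv ?x a > snd p}"
  have fin: "finite L" "finite U" using finite_items[OF assms(1)] by (auto simp: L_def U_def)
  have LU: "c \<in> L \<or> c \<in> U" if "c \<in> items R ?x" for c
  proof -
    have "rv ?x c \<noteq> snd p"
      using rt_in_fib[of "snd c" "fst c" ?x] that assms(2) by (auto simp: items_def rv_def)
    with that show ?thesis by (auto simp: L_def U_def)
  qed
  obtain \<alpha> where \<alpha>: "(\<alpha> = None \<and> L = {}) \<or> (\<exists>m\<in>L. \<alpha> = Some m \<and> (\<forall>c\<in>L. le ?x c m))"
    using ex_le_greatest[OF fin(1)] by (cases "L = {}") metis+
  obtain \<beta> where \<beta>: "(\<beta> = None \<and> U = {}) \<or> (\<exists>m\<in>U. \<beta> = Some m \<and> (\<forall>c\<in>U. le ?x m c))"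
    using ex_le_least[OF fin(2)] by (cases "U = {}") metis+
  have "inside p \<alpha> \<beta>" using \<alpha> \<beta> by (auto simp: inside_def L_def U_def)
  moreover have "gap R ?x \<alpha> \<beta>" unfolding gap_def
  proof (intro conjI allI impI ballI)
    show "a \<in> items R ?x" if "\<alpha> = Some a" for a using \<alpha> that by (auto simp: L_def)
    show "b \<in> items R ?x" if "\<beta> = Some b" for b using \<beta> that by (auto simp: U_def)
    show "rv ?x a < rv ?x b" if "\<alpha> = Some a" "\<beta> = Some b" for a b
      using \<open>inside p \<alpha> \<beta>\<close> that by (auto simp: inside_def)
    show "(\<exists>a. \<alpha> = Some a \<and> le ?x c a) \<or> (\<exists>b. \<beta> = Some b \<and> le ?x b c)" if "c \<in> items R ?x" for c
      using LU[OF that] \<alpha> \<beta> by auto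
  qed
  ultimately show ?thesis by blast
qed

lemma gap_subset:
  assumes "gap R x \<alpha> \<beta>" "R' \<subseteq> R" "fst ` (set_option \<alpha> \<union> set_option \<beta>) \<subseteq> R'"
  shows "gap R' x \<alpha> \<beta>"
proof -
  have "c \<in> items R' x \<longleftrightarrow> c \<in> items R x" if "fst c \<in> R'" for c
    using assms(2) that by (auto simp: items_def)
  hence "\<forall>a. \<alpha> = Some a \<longrightarrow> a \<in> items R' x" "\<forall>b. \<beta> = Some b \<longrightarrow> b \<in> items R' x"
    using assms(1,3) unfolding gap_def by auto
  thus ?thesis using assms(1) items_mono[OF assms(2)] unfolding gap_def by blast
qed

lemma walls_mono: "R' \<subseteq> R \<Longrightarrow> walls R' \<subseteq> walls R"
  by (auto simp: walls_def)

lemma linked_sym: "linked R \<alpha> \<beta> x y \<Longrightarrow> linked R \<alpha> \<beta> y x"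
  by (simp add: linked_def seg_commute) blast

lemma linked_trans: "linked R \<alpha> \<beta> x y \<Longrightarrow> linked R \<alpha> \<beta> y z \<Longrightarrow> linked R \<alpha> \<beta> x z"
  using seg_trans[of x z y] unfolding linked_def by blast

lemma linked_gap: "linked R \<alpha> \<beta> x y \<Longrightarrow> x \<in> cols \<Longrightarrow> gap R x \<alpha> \<beta>"
  by (simp add: linked_def)

lemma rel_sym: "rel R p q \<Longrightarrow> rel R q p"
  unfolding rel_def by (blast intro: linked_sym)

text \<open>As \<open>q\<close> lies in \<open>P\<close>, its column is tested in both links, and
  \<open>gap_unique\<close> over that column identifies the two bounding pairs.\<close>

lemma rel_trans:
  assumes "R \<subseteq> \<Gamma>" "q \<in> P" "rel R p q" "rel R q s"
  shows "rel R p s"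
proof -
  have q: "fst q \<in> cols" using assms(2) by (simp add: cols_def)
  from assms(3) obtain \<alpha> \<beta> where 1: "inside p \<alpha> \<beta>" "inside q \<alpha> \<beta>" "linked R \<alpha> \<beta> (fst p) (fst q)"
    by (auto simp: rel_def)
  from assms(4) obtain \<alpha>' \<beta>' where 2: "inside q \<alpha>' \<beta>'" "inside s \<alpha>' \<beta>'" "linked R \<alpha>' \<beta>' (fst q) (fst s)"
    by (auto simp: rel_def)
  have "\<alpha>' = \<alpha> \<and> \<beta>' = \<beta>"
    by (rule gap_unique[OF assms(1) linked_gap[OF linked_sym[OF 1(3)] q] 1(2) linked_gap[OF 2(3) q] 2(1)])
  with 1 2 assms(3,4) show ?thesis unfolding rel_def using linked_trans by blast
qed

lemma rel_refl:
  assumes "R \<subseteq> \<Gamma>" "p \<notin> \<Union>R"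
  shows "rel R p p"
  using gap_exists[OF assms] assms(2) by (auto simp: rel_def linked_def)

lemma cls_eq: "R \<subseteq> \<Gamma> \<Longrightarrow> p \<in> P \<Longrightarrow> q \<in> cls R p \<Longrightarrow> cls R q = cls R p"
  unfolding cls_def by (auto intro: rel_trans rel_sym)

lemma cls_self: "R \<subseteq> \<Gamma> \<Longrightarrow> p \<in> P \<Longrightarrow> p \<notin> \<Union>R \<Longrightarrow> p \<in> cls R p"
  by (simp add: cls_def rel_refl)

lemma cls_subset: "cls R p \<subseteq> P" by (auto simp: cls_def)
lemma cls_disjoint: "q \<in> cls R p \<Longrightarrow> q \<notin> \<Union>R" by (auto simp: cls_def rel_def)
lemma cls_empty: "p \<in> \<Union>R \<Longrightarrow> cls R p = {}" by (auto simp: cls_def rel_def)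

text \<open>Every obstruction in the first bad column on either side is caused by a single curve.\<close>

lemma bounded_definers:
  assumes R: "R \<subseteq> \<Gamma>" and p: "p \<in> P"
  shows "\<exists>D\<subseteq>R. card D \<le> 4 \<and> (\<forall>R'. D \<subseteq> R' \<longrightarrow> R' \<subseteq> R \<longrightarrow> cls R' p = cls R p)"
proof (cases "p \<in> \<Union>R")
  case True
  then obtain \<gamma> where \<gamma>: "\<gamma> \<in> R" "p \<in> \<gamma>" by blast
  have "cls R' p = cls R p" if "{\<gamma>} \<subseteq> R'" for R'
  proof -
    have "p \<in> \<Union>R'" using that \<gamma> by blast
    thus ?thesis using cls_empty True by metis
  qed
  hence "\<forall>R'. {\<gamma>} \<subseteq> R' \<longrightarrow> R' \<subseteq> R \<longrightarrow> cls R' p = cls R p" by blast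
  moreover have "{\<gamma>} \<subseteq> R" "card {\<gamma>} \<le> 4" using \<gamma> by auto
  ultimately show ?thesis by blast
next
  case False
  let ?x = "fst p"
  have pcol: "?x \<in> cols" using p by (simp add: cols_def)
  obtain \<alpha> \<beta> where ab: "gap R ?x \<alpha> \<beta>" "inside p \<alpha> \<beta>" using gap_exists[OF R False] by blast
  \<comment> \<open>At most two of the four definers carry the bounding arcs; the other two, in
    \<open>Kr\<close> and \<open>Kl\<close>, stop the cell on the right and on the left.\<close>
  define D0 where "D0 = fst ` (set_option \<alpha> \<union> set_option \<beta>)"
  have D0: "D0 \<subseteq> R" using ab(1) by (auto simp: D0_def gap_def items_def)
  have "card D0 \<le> card (set_option \<alpha> \<union> set_option \<beta>)" unfolding D0_def by (intro card_image_le) auto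
  also have "\<dots> \<le> card (set_option \<alpha>) + card (set_option \<beta>)" by (rule card_Un_le)
  also have "\<dots> \<le> 2" by (cases \<alpha>; cases \<beta>) auto
  finally have cardD0: "card D0 \<le> 2" .
  define bad where "bad = (\<lambda>R' x. walls R' \<inter> seg ?x x \<noteq> {} \<or> \<not> gap R' x \<alpha> \<beta>)"
  have killer: "\<exists>\<delta>\<in>R. \<forall>R'. \<delta> \<in> R' \<longrightarrow> R' \<subseteq> R \<longrightarrow> bad R' x" if "bad R x" for x
  proof (cases "walls R \<inter> seg ?x x = {}")
    case False
    then obtain \<delta> where "\<delta> \<in> R" "W \<delta> \<inter> seg ?x x \<noteq> {}" by (auto simp: walls_def)
    thus ?thesis by (intro bexI[of _ \<delta>]) (auto simp: bad_def walls_def)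
  next
    case True
    with that have ng: "\<not> gap R x \<alpha> \<beta>" by (simp add: bad_def)
    have D0a: "fst a \<in> R" if "\<alpha> = Some a" for a using D0 that by (auto simp: D0_def)
    have D0b: "fst b \<in> R" if "\<beta> = Some b" for b using D0 that by (auto simp: D0_def)
    consider (a) a where "\<alpha> = Some a" "a \<notin> items R x" | (b) b where "\<beta> = Some b" "b \<notin> items R x"
      | (ab) a b where "\<alpha> = Some a" "\<beta> = Some b" "\<not> rv x a < rv x b"
      | (c) c where "c \<in> items R x" "\<not> ((\<exists>a. \<alpha> = Some a \<and> le x c a) \<or> (\<exists>b. \<beta> = Some b \<and> le x b c))"
      using ng unfolding gap_def by blast
    thus ?thesis
    proof cases
      case a
      hence "\<not> gap R' x \<alpha> \<beta>" if "R' \<subseteq> R" for R' using items_mono[OF that, of x] by (auto simp: gap_def)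
      with a show ?thesis using D0a by (intro bexI[of _ "fst a"]) (simp_all add: bad_def)
    next
      case b
      hence "\<not> gap R' x \<alpha> \<beta>" if "R' \<subseteq> R" for R' using items_mono[OF that, of x] by (auto simp: gap_def)
      with b show ?thesis using D0b by (intro bexI[of _ "fst b"]) (simp_all add: bad_def)
    next
      case ab
      thus ?thesis using D0a by (intro bexI[of _ "fst a"]) (auto simp: bad_def gap_def)
    next
      case c
      have "c \<in> items R' x" if "fst c \<in> R'" for R' using that c(1) by (auto simp: items_def)
      hence "\<not> gap R' x \<alpha> \<beta>" if "fst c \<in> R'" for R' using c(2) that unfolding gap_def by blast
      moreover have "fst c \<in> R" using c(1) by (simp add: items_def)
      ultimately show ?thesis by (intro bexI[of _ "fst c"]) (simp_all add: bad_def)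
    qed
  qed
  have side: "\<exists>K\<subseteq>R. finite K \<and> card K \<le> 1 \<and> (\<forall>R'. K \<subseteq> R' \<longrightarrow> R' \<subseteq> R \<longrightarrow>
      (\<forall>x\<in>S. \<exists>x'\<in>S \<inter> seg ?x x. bad R' x'))"
    if "\<forall>x\<in>S. bad R x" "S \<noteq> {} \<Longrightarrow> \<exists>x0\<in>S. \<forall>x\<in>S. x0 \<in> seg ?x x" for S
  proof (cases "S = {}")
    case False
    with that(2) obtain x0 where x0: "x0 \<in> S" "\<forall>x\<in>S. x0 \<in> seg ?x x" by blast
    from killer[of x0] that(1) x0 obtain \<delta> where "\<delta> \<in> R" "\<forall>R'. \<delta> \<in> R' \<longrightarrow> R' \<subseteq> R \<longrightarrow> bad R' x0" by blast
    with x0 show ?thesis by (intro exI[of _ "{\<delta>}"]) auto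
  qed auto
  define Sr where "Sr = {x \<in> cols. x > ?x \<and> bad R x}"
  define Sl where "Sl = {x \<in> cols. x < ?x \<and> bad R x}"
  have fcols: "finite cols" using finite_points by (simp add: cols_def)
  have fin: "finite Sr" "finite Sl" using fcols by (auto simp: Sr_def Sl_def)
  have "\<exists>x0\<in>Sr. \<forall>x\<in>Sr. x0 \<in> seg ?x x" if "Sr \<noteq> {}"
    using Min_in[OF fin(1) that] Min_le[OF fin(1)]
    by (intro bexI[of _ "Min Sr"]) (auto simp: seg_def Sr_def)
  moreover have "\<forall>x\<in>Sr. bad R x" by (simp add: Sr_def)
  ultimately have "\<exists>K\<subseteq>R. finite K \<and> card K \<le> 1 \<and> (\<forall>R'. K \<subseteq> R' \<longrightarrow> R' \<subseteq> R \<longrightarrow>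
      (\<forall>x\<in>Sr. \<exists>x'\<in>Sr \<inter> seg ?x x. bad R' x'))" by (intro side)
  then obtain Kr where Kr: "Kr \<subseteq> R" "finite Kr" "card Kr \<le> 1"
    "\<forall>R'. Kr \<subseteq> R' \<longrightarrow> R' \<subseteq> R \<longrightarrow> (\<forall>x\<in>Sr. \<exists>x'\<in>Sr \<inter> seg ?x x. bad R' x')"
    by (elim exE conjE) (rule that)
  have "\<exists>x0\<in>Sl. \<forall>x\<in>Sl. x0 \<in> seg ?x x" if "Sl \<noteq> {}"
    using Max_in[OF fin(2) that] Max_ge[OF fin(2)]
    by (intro bexI[of _ "Max Sl"]) (auto simp: seg_def Sl_def)
  moreover have "\<forall>x\<in>Sl. bad R x" by (simp add: Sl_def)
  ultimately have "\<exists>K\<subseteq>R. finite K \<and> card K \<le> 1 \<and> (\<forall>R'. K \<subseteq> R' \<longrightarrow> R' \<subseteq> R \<longrightarrow>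
      (\<forall>x\<in>Sl. \<exists>x'\<in>Sl \<inter> seg ?x x. bad R' x'))" by (intro side)
  then obtain Kl where Kl: "Kl \<subseteq> R" "finite Kl" "card Kl \<le> 1"
    "\<forall>R'. Kl \<subseteq> R' \<longrightarrow> R' \<subseteq> R \<longrightarrow> (\<forall>x\<in>Sl. \<exists>x'\<in>Sl \<inter> seg ?x x. bad R' x')"
    by (elim exE conjE) (rule that)
  define D where "D = D0 \<union> Kr \<union> Kl"
  have "D \<subseteq> R" using D0 Kr Kl by (auto simp: D_def)
  moreover have "card D \<le> 4"
    using card_Un_le[of "D0 \<union> Kr" Kl] card_Un_le[of D0 Kr] cardD0 Kr Kl by (simp add: D_def)
  moreover have "cls R' p = cls R p" if R': "D \<subseteq> R'" "R' \<subseteq> R" for R'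
  proof -
    have sub: "gap R' x \<alpha> \<beta>" if "gap R x \<alpha> \<beta>" for x
      by (rule gap_subset[OF that R'(2)]) (use R' in \<open>auto simp: D_def D0_def\<close>)
    have pR': "p \<notin> \<Union>R'" using False R' by auto
    have "rel R p q \<longleftrightarrow> rel R' p q" if q: "q \<in> P" for q
    proof
      assume rel: "rel R p q"
      then obtain \<alpha>' \<beta>' where 1: "inside p \<alpha>' \<beta>'" "inside q \<alpha>' \<beta>'" "linked R \<alpha>' \<beta>' ?x (fst q)"
        by (auto simp: rel_def)
      from gap_unique[OF R ab linked_gap[OF 1(3) pcol] 1(1)] have "\<alpha>' = \<alpha>" "\<beta>' = \<beta>" by auto
      with 1(3) have "walls R \<inter> seg ?x (fst q) = {} \<or> ?x = fst q" "\<forall>z\<in>cols \<inter> seg ?x (fst q). gap R z \<alpha> \<beta>"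
        by (auto simp: linked_def)
      with sub walls_mono[OF R'(2)] have "linked R' \<alpha> \<beta> ?x (fst q)"
        unfolding linked_def by blast
      moreover have "q \<notin> \<Union>R'" using rel R' by (auto simp: rel_def)
      ultimately show "rel R' p q"
        using 1(1,2) pR' \<open>\<alpha>' = \<alpha>\<close> \<open>\<beta>' = \<beta>\<close> unfolding rel_def by blast
    next
      assume rel: "rel R' p q"
      then obtain \<alpha>' \<beta>' where 1: "inside p \<alpha>' \<beta>'" "inside q \<alpha>' \<beta>'" "linked R' \<alpha>' \<beta>' ?x (fst q)"
        by (auto simp: rel_def)
      have "R' \<subseteq> \<Gamma>" using R R' by blast
      from gap_unique[OF this sub[OF ab(1)] ab(2) linked_gap[OF 1(3) pcol] 1(1)]
      have eq: "\<alpha>' = \<alpha>" "\<beta>' = \<beta>" by auto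
      \<comment> \<open>If a column on the way to \<open>q\<close> were bad for \<open>R\<close>,
        then that column or one closer to \<open>p\<close> would be bad for \<open>R'\<close> too,
        which the link in \<open>R'\<close> excludes.\<close>
      have good: "\<not> bad R z" if z: "z \<in> cols" "z \<in> seg ?x (fst q)" "z \<noteq> ?x" for z
      proof
        assume "bad R z"
        with z have "z \<in> Sr \<or> z \<in> Sl" by (auto simp: Sr_def Sl_def)
        hence "\<exists>z'\<in>(Sr \<union> Sl) \<inter> seg ?x z. bad R' z'"
        proof
          assume "z \<in> Sr"
          with Kr(4) R' have "\<exists>x'\<in>Sr \<inter> seg ?x z. bad R' x'" by (simp add: D_def)
          thus ?thesis by blast
        next
          assume "z \<in> Sl"
          with Kl(4) R' have "\<exists>x'\<in>Sl \<inter> seg ?x z. bad R' x'" by (simp add: D_def)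
          thus ?thesis by blast
        qed
        then obtain z' where
          z': "z' \<in> cols" "z' \<noteq> ?x" "z' \<in> seg ?x z" "bad R' z'"
          by (auto simp: Sr_def Sl_def)
        with seg_mono[OF z(2)] have z'q: "z' \<in> seg ?x (fst q)" by blast
        with z'(2) have "?x \<noteq> fst q" by auto
        with 1(3) have "walls R' \<inter> seg ?x (fst q) = {}" "gap R' z' \<alpha> \<beta>"
          using z'(1) z'q by (auto simp: linked_def eq)
        with z'(4) seg_mono[OF z'q] show False by (auto simp: bad_def)
      qed
      have qcol: "fst q \<in> cols" using q by (simp add: cols_def)
      have lk: "linked R \<alpha> \<beta> ?x (fst q)" unfolding linked_def
      proof (intro conjI ballI)
        show "?x = fst q \<or> walls R \<inter> seg ?x (fst q) = {}"
          using good[OF qcol] by (auto simp: bad_def)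
        show "gap R z \<alpha> \<beta>" if "z \<in> cols \<inter> seg ?x (fst q)" for z
          using good[of z] ab(1) that by (cases "z = ?x") (auto simp: bad_def)
      qed
      \<comment> \<open>The gap in \<open>R\<close> keeps \<open>q\<close> off the roots of
        \<open>\<gamma>\<close>. A vertical line through \<open>q\<close> either passes through
        \<open>p\<close> as well or is a wall met by the link.\<close>
      have "q \<notin> \<gamma>" if \<gamma>: "\<gamma> \<in> R" for \<gamma>
      proof
        assume "q \<in> \<gamma>"
        have tm: "tame B d \<gamma> (W \<gamma>)" using \<gamma> R tame by blast
        from \<open>q \<in> \<gamma>\<close> mem_curve_iff[OF tm, of "fst q" "snd q"]
        consider "fst q \<in> W \<gamma>" "fib \<gamma> (fst q) = UNIV" | j where "j < card (fib \<gamma> (fst q))" "rt \<gamma> j (fst q) = snd q"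
          by auto
        thus False
        proof cases
          case 1
          show False
          proof (cases "?x = fst q")
            case True
            with 1 have "snd p \<in> fib \<gamma> ?x" by simp
            hence "p \<in> \<gamma>" by (simp add: fib_def)
            with \<open>p \<notin> \<Union>R\<close> \<gamma> show False by blast
          next
            case False
            with lk have "walls R \<inter> seg ?x (fst q) = {}" by (simp add: linked_def)
            with 1 \<gamma> show False by (auto simp: walls_def)
          qed
        next
          case 2
          have "(\<gamma>, j) \<in> items R (fst q)" using 2 \<gamma> by (simp add: items_def)
          with item_in_gap[of R "fst q" \<alpha> \<beta> "snd q" "(\<gamma>, j)"] 2 1(2) linked_gap[OF linked_sym[OF lk] qcol]
          show False by (auto simp: eq rv_def)
        qed
      qed
      with 1 lk False show "rel R p q" unfolding rel_def eq by blast
    qed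
    thus ?thesis by (auto simp: cls_def)
  qed
  ultimately show ?thesis by blast
qed

section \<open>The number of cells of a vertical decomposition\<close>

definition cells :: "(real \<times> real) set set \<Rightarrow> (real \<times> real) set set" where
  "cells R = cls R ` P - {{}}"

text \<open>For the first column the set is empty and the value unspecified, hence the recurring
  guard \<open>x \<noteq> Min cols\<close>.\<close>

definition left_col :: "real \<Rightarrow> real" where
  "left_col x = Max {y \<in> cols. y < x}"

lemma finite_cols: "finite cols"
  using finite_points by (simp add: cols_def)

lemma left_col:
  assumes "x \<in> cols" "x \<noteq> Min cols"
  shows "left_col x \<in> cols" "left_col x < x" "\<And>y. y \<in> cols \<Longrightarrow> y < x \<Longrightarrow> y \<le> left_col x"
proof -
  let ?S = "{y \<in> cols. y < x}"
  have fin: "finite ?S" using finite_cols by simp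
  have "Min cols \<in> cols" using finite_cols assms(1) by (intro Min_in) auto
  moreover have "Min cols \<le> x" using finite_cols assms(1) by simp
  ultimately have ne: "?S \<noteq> {}" using assms(2) by force
  from Max_in[OF fin ne] show "left_col x \<in> cols" "left_col x < x" by (auto simp: left_col_def)
  show "y \<le> left_col x" if "y \<in> cols" "y < x" for y
    using Max_ge[OF fin] that by (simp add: left_col_def)
qed

text \<open>A point lies in at most two of the intervals between consecutive columns.\<close>

lemma step_unique:
  assumes "x \<in> cols" "x \<noteq> Min cols" "w \<in> {left_col x..x}"
    and "x' \<in> cols" "x' \<noteq> Min cols" "w \<in> {left_col x'..x'}" and "w = x \<longleftrightarrow> w = x'"
  shows "x = x'"
proof -
  have *: False if "u < v" "u \<in> cols" "v \<in> cols" "v \<noteq> Min cols" "w \<le> u" "left_col v \<le> w" "w = u \<longleftrightarrow> w = v" for u v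
    using left_col(3)[OF that(3,4,2,1)] that by auto
  show ?thesis using *[of x x'] *[of x' x] assms by (cases x x' rule: linorder_cases) auto
qed

text \<open>Intermediate value theorem for the difference of the arcs. The absence of walls keeps
  both root indices valid and both arcs continuous on the interval.\<close>

lemma arcs_meet:
  assumes ac: "a \<in> items \<Gamma> x" "c \<in> items \<Gamma> x" "y \<le> x"
    and w: "{y..x} \<inter> W (fst a) = {}" "{y..x} \<inter> W (fst c) = {}"
    and le: "rv x a \<le> rv x c" "rv y c \<le> rv y a"
  shows "\<exists>z\<in>fst a \<inter> fst c. fst z \<in> {y..x} \<and> snd z = rv (fst z) a \<and> snd z = rv (fst z) c"
proof -
  have ta: "tame B d (fst a) (W (fst a))" "tame B d (fst c) (W (fst c))"
    using ac tame by (auto simp: items_def)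
  have cd: "card (fib (fst a) u) = card (fib (fst a) x)" "card (fib (fst c) u) = card (fib (fst c) x)"
    if "u \<in> {y..x}" for u
  proof -
    have "{u..x} \<subseteq> {y..x}" using that by auto
    with w have "{u..x} \<inter> W (fst a) = {}" "{u..x} \<inter> W (fst c) = {}" by blast+
    with ta that show "card (fib (fst a) u) = card (fib (fst a) x)" "card (fib (fst c) u) = card (fib (fst c) x)"
      by (auto simp: tame_def)
  qed
  have yx: "y \<in> {y..x}" using ac(3) by simp
  have "continuous_on {y..x} (\<lambda>u. rv u c - rv u a)"
  proof (intro continuous_on_diff)
    have "snd a < card (fib (fst a) y)" "snd c < card (fib (fst c) y)"
      using ac(1,2) cd[OF yx] by (auto simp: items_def)
    thus "continuous_on {y..x} (\<lambda>u. rv u a)" "continuous_on {y..x} (\<lambda>u. rv u c)"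
      unfolding rv_def using ta ac(3) w by (auto simp: tame_def)
  qed
  from IVT'[of "\<lambda>u. rv u c - rv u a" y 0 x, OF _ _ ac(3) this] le
  obtain u where u: "y \<le> u" "u \<le> x" "rv u c = rv u a" by auto
  have "(u, rv u a) \<in> fst a" "(u, rv u c) \<in> fst c"
    unfolding rv_def using ac(1,2) cd[of u] u by (auto intro!: rt_in_fib simp: items_def)
  thus ?thesis using u by (intro bexI[of _ "(u, rv u a)"]) auto
qed

text \<open>Crossings of \<open>\<gamma>\<close> and \<open>\<delta>\<close> in the closed slab that
  ends at column \<open>x\<close>, recorded by the arc of \<open>\<gamma>\<close> on which they
  lie.\<close>

definition events :: "(real \<times> real) set \<Rightarrow> (real \<times> real) set \<Rightarrow> (real \<times> item) set" where
  "events \<gamma> \<delta> = {(x, a). x \<in> cols \<and> x \<noteq> Min cols \<and> fst a = \<gamma> \<and> snd a < card (fib \<gamma> x) \<and>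
     {left_col x..x} \<inter> W \<gamma> = {} \<and> (\<exists>z\<in>\<gamma> \<inter> \<delta>. fst z \<in> {left_col x..x} \<and> snd z = rv (fst z) a)}"

text \<open>A crossing lies in at most two closed slabs, and in each it determines the arc, because
  different roots of \<open>\<gamma>\<close> over one abscissa are distinct.\<close>

lemma card_events:
  assumes "\<gamma> \<in> \<Gamma>" "\<delta> \<in> \<Gamma>" "\<gamma> \<noteq> \<delta>"
  shows "finite (events \<gamma> \<delta>)" "card (events \<gamma> \<delta>) \<le> 2 * r"
proof -
  have "\<forall>e\<in>events \<gamma> \<delta>. \<exists>z. z \<in> \<gamma> \<inter> \<delta> \<and> fst z \<in> {left_col (fst e)..fst e} \<and> snd z = rv (fst z) (snd e)"
    by (auto simp: events_def)
  then obtain f where f: "\<And>e. e \<in> events \<gamma> \<delta> \<Longrightarrow> f e \<in> \<gamma> \<inter> \<delta>"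
    "\<And>e. e \<in> events \<gamma> \<delta> \<Longrightarrow> fst (f e) \<in> {left_col (fst e)..fst e}"
    "\<And>e. e \<in> events \<gamma> \<delta> \<Longrightarrow> snd (f e) = rv (fst (f e)) (snd e)" by metis
  \<comment> \<open>The truth value distinguishes the two slabs that share a column when the
    crossing lies exactly over it.\<close>
  define g where "g = (\<lambda>e. (f e, fst (f e) = fst e))"
  have inj: "inj_on g (events \<gamma> \<delta>)"
  proof (rule inj_onI)
    fix e e' assume e: "e \<in> events \<gamma> \<delta>" "e' \<in> events \<gamma> \<delta>" "g e = g e'"
    hence z: "f e = f e'" by (simp add: g_def)
    have ev: "fst e \<in> cols" "fst e \<noteq> Min cols" "fst e' \<in> cols" "fst e' \<noteq> Min cols"
      "fst (snd e) = \<gamma>" "fst (snd e') = \<gamma>" "snd (snd e) < card (fib \<gamma> (fst e))" "snd (snd e') < card (fib \<gamma> (fst e'))"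
      "{left_col (fst e)..fst e} \<inter> W \<gamma> = {}"
      using e by (auto simp: events_def)
    have x: "fst e = fst e'"
    proof (rule step_unique[of _ "fst (f e)"])
      show "fst (f e) \<in> {left_col (fst e)..fst e}" using f(2)[OF e(1)] .
      show "fst (f e) \<in> {left_col (fst e')..fst e'}" using f(2)[OF e(2)] z by simp
      show "fst (f e) = fst e \<longleftrightarrow> fst (f e) = fst e'" using e(3) by (auto simp: g_def)
    qed (use ev in auto)
    have "{fst (f e)..fst e} \<subseteq> {left_col (fst e)..fst e}" "fst (f e) \<le> fst e"
      using f(2)[OF e(1)] by auto
    with ev(9) have "{fst (f e)..fst e} \<inter> W \<gamma> = {}" "fst (f e) \<le> fst e" by blast+
    hence "card (fib \<gamma> (fst (f e))) = card (fib \<gamma> (fst e))"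
      using tame[OF assms(1)] by (auto simp: tame_def)
    moreover have "rt \<gamma> (snd (snd e)) (fst (f e)) = rt \<gamma> (snd (snd e')) (fst (f e))"
      using f(3)[OF e(1)] f(3)[OF e(2)] z ev by (simp add: rv_def)
    ultimately have "snd (snd e) = snd (snd e')"
      using ev(7,8) x rt_le_iff[of "snd (snd e)" \<gamma> "fst (f e)" "snd (snd e')"]
        rt_le_iff[of "snd (snd e')" \<gamma> "fst (f e)" "snd (snd e)"] by auto
    with x ev show "e = e'" by (auto intro: prod_eqI)
  qed
  have im: "g ` events \<gamma> \<delta> \<subseteq> (\<gamma> \<inter> \<delta>) \<times> UNIV" using f by (auto simp: g_def)
  have fin: "finite ((\<gamma> \<inter> \<delta>) \<times> (UNIV :: bool set))" using inter[OF assms] by auto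
  show "finite (events \<gamma> \<delta>)" using finite_subset[OF im fin] inj finite_imageD by blast
  have "card (events \<gamma> \<delta>) \<le> card ((\<gamma> \<inter> \<delta>) \<times> (UNIV :: bool set))" by (rule card_inj_on_le[OF inj im fin])
  also have "\<dots> \<le> 2 * r" using inter[OF assms] by (simp add: card_cartesian_product)
  finally show "card (events \<gamma> \<delta>) \<le> 2 * r" .
qed

definition all_events :: "(real \<times> real) set set \<Rightarrow> (real \<times> item) set" where
  "all_events R = (\<Union>(\<gamma>, \<delta>)\<in>{(\<gamma>, \<delta>). \<gamma> \<in> R \<and> \<delta> \<in> R \<and> \<gamma> \<noteq> \<delta>}. events \<gamma> \<delta>)"

lemma card_all_events:
  assumes "R \<subseteq> \<Gamma>"
  shows "finite (all_events R)" "card (all_events R) \<le> 2 * r * (card R)\<^sup>2"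
proof -
  let ?I = "{(\<gamma>, \<delta>). \<gamma> \<in> R \<and> \<delta> \<in> R \<and> \<gamma> \<noteq> \<delta>}"
  have finR: "finite R" using assms finite_curves finite_subset by blast
  have I: "?I \<subseteq> R \<times> R" by auto
  have finI: "finite ?I" by (rule finite_subset[OF I]) (use finR in auto)
  show "finite (all_events R)" unfolding all_events_def
    using finI card_events(1) assms by auto
  have "card (all_events R) \<le> (\<Sum>(\<gamma>, \<delta>)\<in>?I. card (events \<gamma> \<delta>))"
    unfolding all_events_def using card_UN_le[OF finI, of "\<lambda>(\<gamma>, \<delta>). events \<gamma> \<delta>"] by (simp add: case_prod_unfold)
  also have "\<dots> \<le> (\<Sum>i\<in>?I. 2 * r)" using card_events(2) assms by (intro sum_mono) auto
  also have "\<dots> = 2 * r * card ?I" by simp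
  also have "\<dots> \<le> 2 * r * (card R * card R)"
    using card_mono[OF _ I] finR by (intro mult_left_mono) (auto simp: card_cartesian_product)
  finally show "card (all_events R) \<le> 2 * r * (card R)\<^sup>2" by (simp add: power2_eq_square)
qed

definition wall_cols :: "(real \<times> real) set set \<Rightarrow> real set" where
  "wall_cols R = {x \<in> cols. x = Min cols \<or> walls R \<inter> {left_col x..x} \<noteq> {}}"

text \<open>Each wall belongs to at most two closed slabs; the summand 1 is the first
  column.\<close>

lemma card_wall_cols:
  assumes "R \<subseteq> \<Gamma>"
  shows "finite (wall_cols R)" "card (wall_cols R) \<le> 1 + 2 * (card R * B)"
proof -
  have finR: "finite R" using assms finite_curves finite_subset by blast
  show fin: "finite (wall_cols R)" using finite_cols by (simp add: wall_cols_def)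
  have finW: "finite (walls R)" unfolding walls_def using finR assms tame by (auto simp: tame_def)
  have "card (walls R) \<le> (\<Sum>\<gamma>\<in>R. card (W \<gamma>))" unfolding walls_def by (rule card_UN_le[OF finR])
  also have "\<dots> \<le> (\<Sum>\<gamma>\<in>R. B)" using assms tame by (intro sum_mono) (auto simp: tame_def)
  finally have cW: "card (walls R) \<le> card R * B" by simp
  let ?S = "{x \<in> cols. x \<noteq> Min cols \<and> walls R \<inter> {left_col x..x} \<noteq> {}}"
  have "\<forall>x\<in>?S. \<exists>w. w \<in> walls R \<and> w \<in> {left_col x..x}" by auto
  from bchoice[OF this] obtain f where f: "\<And>x. x \<in> ?S \<Longrightarrow> f x \<in> walls R \<and> f x \<in> {left_col x..x}" by blast
  define g where "g = (\<lambda>x. (f x, f x = x))"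
  have inj: "inj_on g ?S"
  proof (rule inj_onI)
    fix x x' assume x: "x \<in> ?S" "x' \<in> ?S" "g x = g x'"
    show "x = x'"
      by (rule step_unique[of _ "f x"]) (use x f[OF x(1)] f[OF x(2)] in \<open>auto simp: g_def\<close>)
  qed
  have im: "g ` ?S \<subseteq> walls R \<times> UNIV" using f by (auto simp: g_def)
  have "card ?S \<le> card (walls R \<times> (UNIV :: bool set))"
    by (rule card_inj_on_le[OF inj im]) (use finW in auto)
  also have "\<dots> \<le> 2 * (card R * B)" using cW by (simp add: card_cartesian_product)
  finally have S: "card ?S \<le> 2 * (card R * B)" .
  have "card (wall_cols R) \<le> card (insert (Min cols) ?S)"
    by (rule card_mono) (use finite_cols in \<open>auto simp: wall_cols_def\<close>)
  also have "\<dots> \<le> Suc (card ?S)" by (rule card_insert_le_m1) auto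
  finally show "card (wall_cols R) \<le> 1 + 2 * (card R * B)" using S by linarith
qed

definition good_from :: "(real \<times> real) set set \<Rightarrow> real \<times> real \<Rightarrow> item option \<Rightarrow> item option \<Rightarrow> real \<Rightarrow> bool" where
  "good_from R p \<alpha> \<beta> x \<longleftrightarrow> x \<in> cols \<and> x \<le> fst p \<and> p \<notin> \<Union>R \<and> inside p \<alpha> \<beta> \<and>
     (x = fst p \<or> walls R \<inter> {x..fst p} = {}) \<and> (\<forall>z\<in>cols \<inter> {x..fst p}. gap R z \<alpha> \<beta>)"

text \<open>The point with the larger abscissa has its gap intact all the way back to
  \<open>x\<close>, hence in particular over the columns between the two points.\<close>

lemma good_from_same_cell:
  assumes "R \<subseteq> \<Gamma>" "p \<in> P" "q \<in> P" "good_from R p \<alpha> \<beta> x" "good_from R q \<alpha> \<beta> x"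
  shows "cls R p = cls R q"
proof -
  have "rel R u v" if "fst u \<le> fst v" "good_from R u \<alpha> \<beta> x" "good_from R v \<alpha> \<beta> x" for u v
  proof -
    have "seg (fst u) (fst v) \<subseteq> {x..fst v}" using that by (auto simp: seg_def good_from_def)
    moreover have "fst u = fst v \<or> walls R \<inter> seg (fst u) (fst v) = {}"
      using that calculation by (auto simp: good_from_def)
    ultimately have "linked R \<alpha> \<beta> (fst u) (fst v)" using that unfolding linked_def good_from_def by blast
    with that show ?thesis unfolding rel_def good_from_def by blast
  qed
  from this[of p q] this[of q p] assms have "rel R p q"
    using rel_sym by (cases "fst p \<le> fst q") auto
  hence "q \<in> cls R p" using assms by (simp add: cls_def)
  with cls_eq assms show ?thesis by blast
qed

text \<open>A cell is charged to the leftmost column \<open>x\<close> up to which its bounding arcs stay adjacent, together with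
  an arc: there, either \<open>x\<close> is the first column or follows a wall (tag 0), or the lower (tag 1) or the upper
  (tag 2) arc has just met another one.\<close>

definition marks :: "(real \<times> real) set set \<Rightarrow> (real \<times> real) set \<Rightarrow> nat \<times> real \<times> item option \<Rightarrow> bool" where
  "marks R Q t \<longleftrightarrow> (\<exists>p\<in>P. Q = cls R p \<and> (\<exists>\<alpha> \<beta>. good_from R p \<alpha> \<beta> (fst (snd t)) \<and>
     snd (snd t) = (if fst t = 2 then \<beta> else \<alpha>)))"

text \<open>The tag says which bounding arc is recorded; over the recorded column this arc
  determines the other one, and column and gap together determine the cell.\<close>

lemma marks_unique:
  assumes "R \<subseteq> \<Gamma>" "marks R Q t" "marks R Q' t"
  shows "Q = Q'"
proof -
  obtain p \<alpha> \<beta> where p: "p \<in> P" "Q = cls R p" "good_from R p \<alpha> \<beta> (fst (snd t))" "snd (snd t) = (if fst t = 2 then \<beta> else \<alpha>)"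
    using assms(2) unfolding marks_def by blast
  obtain q \<alpha>' \<beta>' where q: "q \<in> P" "Q' = cls R q" "good_from R q \<alpha>' \<beta>' (fst (snd t))" "snd (snd t) = (if fst t = 2 then \<beta>' else \<alpha>')"
    using assms(3) unfolding marks_def by blast
  have g: "gap R (fst (snd t)) \<alpha> \<beta>" "gap R (fst (snd t)) \<alpha>' \<beta>'" using p q by (auto simp: good_from_def)
  have "\<alpha>' = \<alpha> \<and> \<beta>' = \<beta>"
  proof (cases "fst t = 2")
    case True
    with p q g gap_unique_below[OF assms(1), of "fst (snd t)" \<alpha> \<beta> \<alpha>'] show ?thesis by auto
  next
    case False
    with p q g gap_unique_above[OF assms(1), of "fst (snd t)" \<alpha> \<beta> \<beta>'] show ?thesis by auto
  qed
  with good_from_same_cell[OF assms(1) p(1) q(1)] p q show ?thesis by auto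
qed

definition tags :: "(real \<times> real) set set \<Rightarrow> (nat \<times> real \<times> item option) set" where
  "tags R = {0} \<times> (SIGMA x:wall_cols R. insert None (Some ` items R x)) \<union>
     {1, 2} \<times> ((\<lambda>(x, a). (x, Some a)) ` all_events R)"

text \<open>Without a wall both columns carry the same items, so the gap fails on the left only if
  the bounding arcs lose their strict order or a third arc comes between them. Either way two arcs
  change order or touch within the slab and hence meet. Roots of a single curve keep their order, so
  two different curves are involved.\<close>

lemma gap_changes_imp_event:
  assumes R: "R \<subseteq> \<Gamma>" and x: "x \<in> cols" "x \<noteq> Min cols" and nw: "walls R \<inter> {left_col x..x} = {}"
    and g: "gap R x \<alpha> \<beta>" and ng: "\<not> gap R (left_col x) \<alpha> \<beta>"
  shows "(\<exists>a. \<alpha> = Some a \<and> (x, a) \<in> all_events R) \<or> (\<exists>b. \<beta> = Some b \<and> (x, b) \<in> all_events R)"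
proof -
  define y where "y = left_col x"
  have yx: "y \<le> x" using left_col(2)[OF x] by (simp add: y_def)
  have w: "{y..x} \<inter> W \<gamma> = {}" if "\<gamma> \<in> R" for \<gamma> using nw that by (auto simp: walls_def y_def)
  have cd: "card (fib \<gamma> y) = card (fib \<gamma> x)" if "\<gamma> \<in> R" for \<gamma>
    using w[OF that] tame[of \<gamma>] R that yx by (auto simp: tame_def)
  hence it: "items R y = items R x" by (auto simp: items_def)
  have event: "(x, a) \<in> all_events R"
    if "a \<in> items R x" "c \<in> items R x" "fst a \<noteq> fst c"
      and "\<exists>z\<in>fst a \<inter> fst c. fst z \<in> {y..x} \<and> snd z = rv (fst z) a" for a c
    unfolding all_events_def
    by (rule UN_I[of "(fst a, fst c)"]) (use that x w in \<open>auto simp: events_def items_def y_def\<close>)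
  have meet: "\<exists>z\<in>fst a \<inter> fst c. fst z \<in> {y..x} \<and> snd z = rv (fst z) a \<and> snd z = rv (fst z) c"
    if "a \<in> items R x" "c \<in> items R x" "rv x a \<le> rv x c" "rv y c \<le> rv y a" for a c
    using arcs_meet[of a x c y] that w yx items_mono[OF R, of x] by (auto simp: items_def)
  consider (ab) a b where "\<alpha> = Some a" "\<beta> = Some b" "\<not> rv y a < rv y b"
    | (c) c where "c \<in> items R y" "\<not> ((\<exists>a. \<alpha> = Some a \<and> le y c a) \<or> (\<exists>b. \<beta> = Some b \<and> le y b c))"
    using ng g it unfolding gap_def y_def[symmetric] by auto
  thus ?thesis
  proof cases
    case ab
    have i: "a \<in> items R x" "b \<in> items R x" "rv x a < rv x b" using g ab by (auto simp: gap_def)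
    have "fst a \<noteq> fst b"
    proof
      assume eq: "fst a = fst b"
      have "snd a < snd b" using i eq rt_le_iff[of "snd b" "fst b" x "snd a"]
        by (auto simp: items_def rv_def not_le[symmetric])
      moreover have "snd b < card (fib (fst b) y)" using i cd by (auto simp: items_def)
      ultimately have "rv y a < rv y b" using rt_less[of "snd a" "snd b" "fst b" y] eq by (simp add: rv_def)
      with ab show False by simp
    qed
    with event[OF i(1,2)] meet[OF i(1,2)] i(3) ab show ?thesis by fastforce
  next
    case c
    have ci: "c \<in> items R x" using c it by simp
    have diff: "fst c \<noteq> fst a" if "le x u v" "\<not> le y u v" "u = c \<and> v = a \<or> u = a \<and> v = c" "a \<in> items R x" for u v a
    proof
      assume eq: "fst c = fst a"
      hence uv: "fst u = fst v" "snd u < card (fib (fst v) x)" "snd v < card (fib (fst v) x)" "fst v \<in> R"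
        using that ci by (auto simp: items_def)
      hence "snd u \<le> snd v" using le_rv[OF that(1)] rt_le_iff[of "snd u" "fst v" x "snd v"] by (simp add: rv_def)
      hence "rv y u \<le> rv y v" using uv cd rt_le_iff[of "snd u" "fst v" y "snd v"] by (simp add: rv_def)
      with that(2) uv(1) show False by (auto simp: le_def)
    qed
    from g ci consider (a) a where "\<alpha> = Some a" "le x c a" | (b) b where "\<beta> = Some b" "le x b c"
      by (auto simp: gap_def)
    thus ?thesis
    proof cases
      case a
      have ai: "a \<in> items R x" using a g by (auto simp: gap_def)
      have nle: "\<not> le y c a" using c a by auto
      have "fst c \<noteq> fst a" using diff[OF a(2) nle] ai by blast
      with meet[OF ci ai le_rv[OF a(2)] not_le_rv[OF nle]] event[OF ai ci] a(1) show ?thesis by fastforce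
    next
      case b
      have bi: "b \<in> items R x" using b g by (auto simp: gap_def)
      have nle: "\<not> le y b c" using c b by auto
      have "fst c \<noteq> fst b" using diff[OF b(2) nle] bi by blast
      with meet[OF bi ci le_rv[OF b(2)] not_le_rv[OF nle]] event[OF bi ci] b(1) show ?thesis by fastforce
    qed
  qed
qed

text \<open>Take the leftmost column that is good for some point of the cell. If no wall lies
  between it and the preceding column, goodness can be lost there only through the gap itself, which
  is an event.\<close>

lemma marks_exists:
  assumes R: "R \<subseteq> \<Gamma>" and Q: "Q \<in> cells R"
  shows "\<exists>t\<in>tags R. marks R Q t"
proof -
  from Q obtain p where p: "p \<in> P" "Q = cls R p" "cls R p \<noteq> {}" by (auto simp: cells_def)
  hence pR: "p \<notin> \<Union>R" using cls_empty by blast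
  obtain \<alpha> \<beta> where ab: "gap R (fst p) \<alpha> \<beta>" "inside p \<alpha> \<beta>" using gap_exists[OF R pR] by blast
  define S where "S = {x. good_from R p \<alpha> \<beta> x}"
  have "finite S" using finite_cols by (rule finite_subset[rotated]) (auto simp: S_def good_from_def)
  moreover have "fst p \<in> S" using p ab pR by (auto simp: S_def good_from_def cols_def)
  ultimately have x: "Min S \<in> S" "\<And>y. y \<in> S \<Longrightarrow> Min S \<le> y" by (auto intro: Min_in)
  define x where "x = Min S"
  have gx: "good_from R p \<alpha> \<beta> x" and gap: "gap R x \<alpha> \<beta>" and xc: "x \<in> cols"
    using x(1) unfolding x_def[symmetric] by (auto simp: S_def good_from_def)
  have mk: "marks R Q (k, x, if k = 2 then \<beta> else \<alpha>)" for k
    unfolding marks_def using p gx by fastforce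
  show ?thesis
  proof (cases "x \<in> wall_cols R")
    case True
    have "\<alpha> \<in> insert None (Some ` items R x)" using gap by (cases \<alpha>) (auto simp: gap_def)
    with True have "(0, x, \<alpha>) \<in> tags R" unfolding tags_def by blast
    with mk[of 0] show ?thesis by auto
  next
    case False
    with xc have nm: "x \<noteq> Min cols" and nw: "walls R \<inter> {left_col x..x} = {}" by (auto simp: wall_cols_def)
    note lc = left_col[OF xc nm]
    have not_good: "\<not> good_from R p \<alpha> \<beta> (left_col x)" using x(2)[of "left_col x"] lc(2) by (auto simp: S_def x_def)
    have nwall: "walls R \<inter> {left_col x..fst p} = {}"
    proof (cases "x = fst p")
      case False
      have "{left_col x..fst p} \<subseteq> {left_col x..x} \<union> {x..fst p}" by auto
      with nw gx False show ?thesis unfolding good_from_def by blast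
    qed (use nw in simp)
    have new: "z = left_col x \<or> z \<in> {x..fst p}" if "z \<in> cols" "z \<in> {left_col x..fst p}" for z
    proof (cases "z < x")
      case True
      with lc(3)[OF that(1)] that(2) show ?thesis by simp
    qed (use that(2) in simp)
    have "\<not> gap R (left_col x) \<alpha> \<beta>"
    proof
      assume "gap R (left_col x) \<alpha> \<beta>"
      hence "\<forall>z\<in>cols \<inter> {left_col x..fst p}. gap R z \<alpha> \<beta>"
        using gx new unfolding good_from_def by blast
      moreover have "left_col x \<le> fst p" using gx lc(2) by (simp add: good_from_def)
      ultimately have "good_from R p \<alpha> \<beta> (left_col x)"
        using gx lc(1) nwall unfolding good_from_def by blast
      with not_good show False ..
    qed
    from gap_changes_imp_event[OF R xc nm nw gap this]
    show ?thesis
    proof (elim disjE exE conjE)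
      fix a assume "\<alpha> = Some a" "(x, a) \<in> all_events R"
      hence "(1, x, \<alpha>) \<in> tags R" by (auto simp: tags_def image_iff split: prod.splits)
      with mk[of 1] show ?thesis by auto
    next
      fix b assume "\<beta> = Some b" "(x, b) \<in> all_events R"
      hence "(2, x, \<beta>) \<in> tags R" by (auto simp: tags_def image_iff split: prod.splits)
      with mk[of 2] show ?thesis by auto
    qed
  qed
qed

text \<open>With \<open>u\<close> curves there are at most \<open>1 + 2 * (u * B)\<close> wall
  columns, each with at most \<open>u * d + 1\<close> possible lower arcs including
  \<open>None\<close>. The events, at most \<open>2 * r * u ^ 2\<close>, are counted for each of the
  tags 1 and 2, which gives \<open>4 * r\<close>.\<close>

lemma card_cells:
  assumes R: "R \<subseteq> \<Gamma>"
  shows "card (cells R) \<le> ((1 + 2 * B) * (d + 1) + 4 * r) * (card R + 1)\<^sup>2"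
proof -
  define u where "u = card R"
  have finT: "finite (tags R)" unfolding tags_def
    using card_wall_cols(1)[OF R] card_all_events(1)[OF R] finite_items(1)[OF R] by auto
  have "\<forall>Q\<in>cells R. \<exists>t. t \<in> tags R \<and> marks R Q t" using marks_exists[OF R] by blast
  then obtain f where f: "\<And>Q. Q \<in> cells R \<Longrightarrow> f Q \<in> tags R \<and> marks R Q (f Q)" by metis
  have "inj_on f (cells R)" by (rule inj_onI) (metis f marks_unique[OF R])
  hence "card (cells R) \<le> card (tags R)" using f finT by (intro card_inj_on_le[of f]) auto
  also have "\<dots> \<le> card ({0 :: nat} \<times> (SIGMA x:wall_cols R. insert None (Some ` items R x))) +
      card ({1 :: nat, 2} \<times> ((\<lambda>(x, a). (x, Some a)) ` all_events R))"
    unfolding tags_def by (rule card_Un_le)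
  also have "card ({0 :: nat} \<times> (SIGMA x:wall_cols R. insert None (Some ` items R x))) =
      (\<Sum>x\<in>wall_cols R. card (insert None (Some ` items R x)))"
    using card_wall_cols(1)[OF R] finite_items(1)[OF R] by (simp add: card_cartesian_product)
  also have "\<dots> \<le> (\<Sum>x\<in>wall_cols R. u * d + 1)"
  proof (rule sum_mono)
    fix x
    have "card (insert None (Some ` items R x)) \<le> Suc (card (Some ` items R x))"
      by (rule card_insert_le_m1) auto
    also have "\<dots> \<le> u * d + 1"
      using finite_items[OF R, of x] card_image_le[of "items R x" Some] by (simp add: u_def)
    finally show "card (insert None (Some ` items R x)) \<le> u * d + 1" .
  qed
  also have "\<dots> \<le> (1 + 2 * (u * B)) * (u * d + 1)"
    using mult_right_mono[OF card_wall_cols(2)[OF R], of "u * d + 1"] by (simp add: u_def)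
  also have "\<dots> \<le> ((1 + 2 * B) * (u + 1)) * ((d + 1) * (u + 1))"
    by (intro mult_mono) (auto simp: algebra_simps)
  also have "card ({1 :: nat, 2} \<times> ((\<lambda>(x, a). (x, Some a)) ` all_events R)) \<le> 2 * card (all_events R)"
    using card_image_le[OF card_all_events(1)[OF R], of "\<lambda>(x, a). (x, Some a)"]
    by (simp add: card_cartesian_product del: card_image_le)
  also have "\<dots> \<le> 2 * (2 * r * (u + 1)\<^sup>2)"
  proof -
    have "card (all_events R) \<le> 2 * r * u\<^sup>2" using card_all_events(2)[OF R] by (simp add: u_def)
    also have "\<dots> \<le> 2 * r * (u + 1)\<^sup>2" by (intro mult_left_mono power_mono) auto
    finally show ?thesis by simp
  qed
  finally show ?thesis by (simp add: u_def algebra_simps power2_eq_square)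
qed

end

section \<open>Incidences with curves of bounded degree\<close>

lemma (in arrangement) cell_system:
  "cell_system \<Gamma> P cls ((1 + 2 * B) * (d + 1) + 4 * r)"
proof
  show "card (cls R ` P - {{}}) \<le> ((1 + 2 * B) * (d + 1) + 4 * r) * (card R + 1)\<^sup>2" if "R \<subseteq> \<Gamma>" for R
    using card_cells[OF that] by (simp add: cells_def)
qed (fact finite_curves finite_points cls_subset | rule cls_eq cls_self cls_disjoint bounded_definers; assumption)+

lemma card_rich_algebraic_curves_le:
  fixes d r s c k u :: nat and \<Gamma> :: "(real \<times> real) set set"
  defines "M \<equiv> (1 + 2 * (2 * d + d * (2 * d))) * (d + 1) + 4 * r"
  assumes fin: "finite \<Gamma>" "finite P" and P: "P \<noteq> {}" and s: "2 \<le> s"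
    and alg: "\<And>\<gamma>. \<gamma> \<in> \<Gamma> \<Longrightarrow> algebraic_curve_of_degree_le d \<gamma>"
    and mult: "multiplicity_type \<Gamma> r"
    and rich: "\<And>\<gamma>. \<gamma> \<in> \<Gamma> \<Longrightarrow> k \<le> card (\<gamma> \<inter> P)"
    and c: "\<And>S. S \<subseteq> P \<Longrightarrow> card S = s \<Longrightarrow> card {\<gamma> \<in> \<Gamma>. S \<subseteq> \<gamma>} \<le> c"
    and u: "1 \<le> u" "4 * u \<le> card \<Gamma>" "(8 * r + 1280 * M * s) * u \<le> k"
  shows "real (card \<Gamma>) * (real k * (real u * real k) ^ (s - 1))
    \<le> 4 * real s ^ s * real c * 128 ^ (s - 1) * real (card P) ^ s"
proof -
  have "\<forall>\<gamma>\<in>\<Gamma>. \<exists>W. tame (2 * d + d * (2 * d)) d \<gamma> W" using alg algebraic_curve_tame by blast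
  then obtain W where W: "\<And>\<gamma>. \<gamma> \<in> \<Gamma> \<Longrightarrow> tame (2 * d + d * (2 * d)) d \<gamma> (W \<gamma>)" by metis
  obtain idx :: "(real \<times> real) set \<Rightarrow> nat" where idx: "inj_on idx \<Gamma>"
    using finite_imp_inj_to_nat_seg[OF fin(1)] by blast
  interpret A: arrangement \<Gamma> P W idx "2 * d + d * (2 * d)" d r
    by unfold_locales (use fin W idx mult in \<open>auto simp: multiplicity_type_def\<close>)
  interpret cell_system \<Gamma> P A.cls M unfolding M_def by (rule A.cell_system)
  show ?thesis
  proof (rule card_rich_curves_le[OF s _ P rich _ c u])
    show "1 \<le> M" by (simp add: M_def)
    show "card (\<gamma> \<inter> \<delta> \<inter> P) \<le> r" if "\<gamma> \<in> \<Gamma>" "\<delta> \<in> \<Gamma>" "\<gamma> \<noteq> \<delta>" for \<gamma> \<delta>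
    proof -
      have "finite (\<gamma> \<inter> \<delta>)" "card (\<gamma> \<inter> \<delta>) \<le> r" using mult that by (auto simp: multiplicity_type_def)
      moreover have "card (\<gamma> \<inter> \<delta> \<inter> P) \<le> card (\<gamma> \<inter> \<delta>)" using calculation by (intro card_mono) auto
      ultimately show ?thesis by linarith
    qed
  qed
qed

text \<open>Pascal's rule adds \<open>k choose s\<close> at each step. Writing the bound as a sum
  over levels permits the later exchange of summation between curves and richness levels.\<close>

lemma choose_Suc_le_sum_powers: "k choose Suc s \<le> (\<Sum>j=Suc s..k. j ^ s)"
proof (induction k)
  case (Suc k)
  show ?case
  proof (cases "s \<le> k")
    case True
    have "k choose s \<le> k ^ s" using True by (rule binomial_le_pow)
    also have "\<dots> \<le> Suc k ^ s" by (intro power_mono) auto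
    finally show ?thesis using Suc True by simp
  qed (simp add: binomial_eq_0)
qed simp

lemma sum_inverse_squares_le: "s \<ge> 1 \<Longrightarrow> (\<Sum>j=Suc s..L. 1 / (real j)\<^sup>2) \<le> 1"
proof -
  assume s: "s \<ge> 1"
  have *: "(\<Sum>j=2..L. 1 / (real j)\<^sup>2) \<le> 1 - 1 / real L" if "L \<ge> 1" for L
    using that
  proof (induction L rule: dec_induct)
    case (step L)
    have "1 / (real (Suc L))\<^sup>2 \<le> 1 / real L - 1 / real (Suc L)"
    proof -
      have "1 / (real (Suc L))\<^sup>2 \<le> 1 / (real L * real (Suc L))"
        using step by (intro divide_left_mono) (auto simp: power2_eq_square mult_right_mono)
      also have "\<dots> = 1 / real L - 1 / real (Suc L)" using step by (simp add: field_simps)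
      finally show ?thesis .
    qed
    with step show ?case by simp
  qed simp
  have "(\<Sum>j=Suc s..L. 1 / (real j)\<^sup>2) \<le> (\<Sum>j=2..L. 1 / (real j)\<^sup>2)"
    using s by (intro sum_mono2) auto
  also have "\<dots> \<le> 1"
  proof (cases "L \<ge> 1")
    case True
    have "1 / real L \<ge> 0" by simp
    with *[OF True] show ?thesis by linarith
  qed simp
  finally show ?thesis .
qed

section \<open>Bounding the number of (s+1)-subsets that lie on a curve\<close>

locale curve_family =
  fixes C :: "(real \<times> real) set set" and s d r c :: nat
  assumes s: "3 \<le> s"
    and alg: "\<And>\<gamma>. \<gamma> \<in> C \<Longrightarrow> algebraic_curve_of_degree_le d \<gamma>"
    and mult: "multiplicity_type C r"
    and free: "at_most_curves_through C s c"
begin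

definition rich :: "(real \<times> real) set \<Rightarrow> nat \<Rightarrow> (real \<times> real) set set" where
  "rich P k = {\<gamma> \<in> C. k \<le> card (\<gamma> \<inter> P)}"

text \<open>Each such curve contains an \<open>s\<close>-subset of \<open>P\<close>, and each subset
  lies on at most \<open>c\<close> curves. Besides finiteness this settles the levels
  \<open>k < A\<close>, for which no sample is available.\<close>

lemma rich_trivial:
  assumes "finite P" "s \<le> k"
  shows "finite (rich P k)" "card (rich P k) \<le> c * card P ^ s"
proof -
  let ?S = "{S. S \<subseteq> P \<and> card S = s}"
  have finS: "finite ?S" using assms by simp
  have sub: "rich P k \<subseteq> (\<Union>S\<in>?S. {\<gamma> \<in> C. S \<subseteq> \<gamma>})"
  proof
    fix \<gamma> assume \<gamma>: "\<gamma> \<in> rich P k"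
    hence "s \<le> card (\<gamma> \<inter> P)" using assms by (auto simp: rich_def)
    then obtain S where "S \<subseteq> \<gamma> \<inter> P" "card S = s" by (rule obtain_subset_with_card_n) auto
    with \<gamma> show "\<gamma> \<in> (\<Union>S\<in>?S. {\<gamma> \<in> C. S \<subseteq> \<gamma>})" by (auto simp: rich_def)
  qed
  have through: "finite {\<gamma> \<in> C. S \<subseteq> \<gamma>} \<and> card {\<gamma> \<in> C. S \<subseteq> \<gamma>} \<le> c" if "S \<in> ?S" for S
  proof -
    have "finite S" using that assms(1) finite_subset by blast
    with that free show ?thesis unfolding at_most_curves_through_def by auto
  qed
  have fin: "finite (\<Union>S\<in>?S. {\<gamma> \<in> C. S \<subseteq> \<gamma>})" using finS through by blast
  from finite_subset[OF sub this] show "finite (rich P k)" .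
  have "card (rich P k) \<le> card (\<Union>S\<in>?S. {\<gamma> \<in> C. S \<subseteq> \<gamma>})" by (rule card_mono[OF fin sub])
  also have "\<dots> \<le> (\<Sum>S\<in>?S. card {\<gamma> \<in> C. S \<subseteq> \<gamma>})" by (rule card_UN_le[OF finS])
  also have "\<dots> \<le> (\<Sum>S\<in>?S. c)" using through by (intro sum_mono) blast
  also have "\<dots> = c * (card P choose s)" using n_subsets[OF assms(1)] by simp
  also have "card P choose s \<le> card P ^ s"
    by (cases "s \<le> card P") (auto intro: binomial_le_pow simp: binomial_eq_0)
  finally show "card (rich P k) \<le> c * card P ^ s" by simp
qed

text \<open>The ratio \<open>k / u\<close> that \<open>card_rich_algebraic_curves_le\<close>
  demands.\<close>

definition A :: nat where
  "A = 8 * r + 1280 * ((1 + 2 * (2 * d + d * (2 * d))) * (d + 1) + 4 * r) * s"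

text \<open>The constant of the incidence bound after \<open>u\<close> has been replaced by its
  lower bound \<open>k / (2 * A)\<close>.\<close>

definition C1 :: real where
  "C1 = (2 * real A) ^ (s - 1) * (4 * real s ^ s * real c * 128 ^ (s - 1))"

lemma A_pos: "1 \<le> A"
proof -
  have "0 < ((1 + 2 * (2 * d + d * (2 * d))) * (d + 1) + 4 * r) * s" using s by simp
  thus ?thesis unfolding A_def by linarith
qed

lemma multiplicity_type_rich: "multiplicity_type (rich P k) r"
  using mult by (simp add: multiplicity_type_def rich_def)

lemma card_rich_through:
  assumes "finite S" "card S = s"
  shows "card {\<gamma> \<in> rich P k. S \<subseteq> \<gamma>} \<le> c"
proof -
  have "finite {\<gamma> \<in> C. S \<subseteq> \<gamma>}" "card {\<gamma> \<in> C. S \<subseteq> \<gamma>} \<le> c"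
    using free assms by (auto simp: at_most_curves_through_def)
  moreover have "card {\<gamma> \<in> rich P k. S \<subseteq> \<gamma>} \<le> card {\<gamma> \<in> C. S \<subseteq> \<gamma>}"
    using calculation by (intro card_mono) (auto simp: rich_def)
  ultimately show ?thesis by linarith
qed

text \<open>The sample size is \<open>k div A\<close>, the largest one admissible for
  \<open>k\<close>. If there are too few curves for it, their number is already at most
  \<open>4 * k\<close>.\<close>

lemma rich_cutting:
  assumes P: "finite P" "P \<noteq> {}" and k: "s \<le> k" "A \<le> k"
  shows "real (card (rich P k)) * real k ^ (2 * s - 1) \<le> C1 * real (card P) ^ s \<or> card (rich P k) \<le> 4 * k"
proof (cases "4 * (k div A) \<le> card (rich P k)")
  case True
  define u where "u = k div A"
  define m where "m = real (card (rich P k))"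
  have u1: "1 \<le> u" using A_pos k by (simp add: u_def Suc_leI div_greater_zero_iff)
  have "k < A * u + A" unfolding u_def
    using A_pos by (simp add: dividend_less_times_div add.commute)
  also have "A * u + A \<le> 2 * A * u" using mult_le_mono2[OF u1, of A] by (simp add: algebra_simps)
  finally have "real k \<le> real (2 * A * u)" by (simp only: of_nat_le_iff less_imp_le)
  hence ku: "real k \<le> 2 * real A * real u" by simp
  have "m * (real k * (real u * real k) ^ (s - 1)) \<le> 4 * real s ^ s * real c * 128 ^ (s - 1) * real (card P) ^ s"
    unfolding m_def
  proof (rule card_rich_algebraic_curves_le[OF rich_trivial(1)[OF P(1) k(1)] P])
    show "algebraic_curve_of_degree_le d \<gamma>" if "\<gamma> \<in> rich P k" for \<gamma> using that alg by (simp add: rich_def)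
    show "card {\<gamma> \<in> rich P k. S \<subseteq> \<gamma>} \<le> c" if "S \<subseteq> P" "card S = s" for S
      using card_rich_through that P(1) finite_subset by blast
    show "(8 * r + 1280 * ((1 + 2 * (2 * d + d * (2 * d))) * (d + 1) + 4 * r) * s) * u \<le> k"
      unfolding A_def[symmetric] u_def by simp
    show "2 \<le> s" using s by simp
    show "k \<le> card (\<gamma> \<inter> P)" if "\<gamma> \<in> rich P k" for \<gamma> using that by (simp add: rich_def)
    show "4 * u \<le> card (rich P k)" using True by (simp add: u_def)
  qed (fact multiplicity_type_rich u1)+
  hence "(2 * real A) ^ (s - 1) * (m * (real k * (real u * real k) ^ (s - 1))) \<le> C1 * real (card P) ^ s"
    unfolding C1_def mult.assoc using A_pos by (intro mult_left_mono) (auto simp: mult_ac)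
  moreover have "real k ^ (2 * s - 1) \<le> (2 * real A) ^ (s - 1) * (real k * (real u * real k) ^ (s - 1))"
  proof -
    have "real k ^ (2 * s - 1) = real k * (real k * real k) ^ (s - 1)"
    proof -
      have "2 * s - 1 = Suc (2 * (s - 1))" using s by simp
      thus ?thesis by (simp only: power_Suc power_mult power2_eq_square)
    qed
    also have "\<dots> \<le> real k * ((2 * real A * real u) * real k) ^ (s - 1)"
      using ku by (intro mult_left_mono power_mono mult_right_mono) auto
    also have "\<dots> = (2 * real A) ^ (s - 1) * (real k * (real u * real k) ^ (s - 1))"
      by (simp only: power_mult_distrib mult_ac)
    finally show ?thesis .
  qed
  hence "m * real k ^ (2 * s - 1) \<le> m * ((2 * real A) ^ (s - 1) * (real k * (real u * real k) ^ (s - 1)))"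
    by (intro mult_left_mono) (auto simp: m_def)
  ultimately show ?thesis unfolding m_def by (simp only: mult_ac) linarith
next
  case False
  have "k div A \<le> k" by simp
  with False show ?thesis by linarith
qed

lemma rich_large:
  assumes "finite P" "s \<le> k" "4 * r * card P \<le> k ^ 2"
  shows "card (rich P k) * k \<le> 2 * card P"
proof (rule card_very_rich_sets_le[OF rich_trivial(1)[OF assms(1,2)] assms(1) _ _ _ assms(3)])
  show "1 \<le> k" using s assms(2) by simp
  fix \<gamma> \<delta> assume "\<gamma> \<in> rich P k" "\<delta> \<in> rich P k" "\<gamma> \<noteq> \<delta>"
  hence "finite (\<gamma> \<inter> \<delta>)" "card (\<gamma> \<inter> \<delta>) \<le> r" using mult by (auto simp: multiplicity_type_def rich_def)
  moreover have "card (\<gamma> \<inter> \<delta> \<inter> P) \<le> card (\<gamma> \<inter> \<delta>)" using calculation by (intro card_mono) auto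
  ultimately show "card (\<gamma> \<inter> \<delta> \<inter> P) \<le> r" by linarith
qed (auto simp: rich_def)

definition cotuples :: "(real \<times> real) set \<Rightarrow> (real \<times> real) set set" where
  "cotuples P = {S. S \<subseteq> P \<and> card S = Suc s \<and> (\<exists>\<gamma>\<in>C. S \<subseteq> \<gamma>)}"

lemma card_cotuples_le_sum:
  assumes P: "finite P" and L: "\<And>\<gamma>. \<gamma> \<in> C \<Longrightarrow> card (\<gamma> \<inter> P) \<le> L"
  shows "card (cotuples P) \<le> (\<Sum>j=Suc s..L. j ^ s * card (rich P j))"
proof -
  let ?G = "rich P (Suc s)"
  have finG: "finite ?G" using rich_trivial[OF P] by simp
  have sub: "cotuples P \<subseteq> (\<Union>\<gamma>\<in>?G. {S. S \<subseteq> \<gamma> \<inter> P \<and> card S = Suc s})"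
  proof
    fix S assume "S \<in> cotuples P"
    then obtain \<gamma> where \<gamma>: "\<gamma> \<in> C" "S \<subseteq> \<gamma> \<inter> P" "card S = Suc s" by (auto simp: cotuples_def)
    hence "Suc s \<le> card (\<gamma> \<inter> P)" using P card_mono[of "\<gamma> \<inter> P" S] by simp
    with \<gamma> show "S \<in> (\<Union>\<gamma>\<in>?G. {S. S \<subseteq> \<gamma> \<inter> P \<and> card S = Suc s})" by (auto simp: rich_def)
  qed
  have "card (cotuples P) \<le> card (\<Union>\<gamma>\<in>?G. {S. S \<subseteq> \<gamma> \<inter> P \<and> card S = Suc s})"
    using finG P by (intro card_mono[OF _ sub]) auto
  also have "\<dots> \<le> (\<Sum>\<gamma>\<in>?G. card {S. S \<subseteq> \<gamma> \<inter> P \<and> card S = Suc s})" by (rule card_UN_le[OF finG])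
  also have "\<dots> = (\<Sum>\<gamma>\<in>?G. card (\<gamma> \<inter> P) choose Suc s)"
    using P by (intro sum.cong refl n_subsets) auto
  also have "\<dots> \<le> (\<Sum>\<gamma>\<in>?G. \<Sum>j=Suc s..L. if j \<le> card (\<gamma> \<inter> P) then j ^ s else 0)"
  proof (rule sum_mono)
    fix \<gamma> assume "\<gamma> \<in> ?G"
    hence "card (\<gamma> \<inter> P) \<le> L" using L by (simp add: rich_def)
    have "card (\<gamma> \<inter> P) choose Suc s \<le> (\<Sum>j=Suc s..card (\<gamma> \<inter> P). j ^ s)" by (rule choose_Suc_le_sum_powers)
    also have "{Suc s..card (\<gamma> \<inter> P)} = {j \<in> {Suc s..L}. j \<le> card (\<gamma> \<inter> P)}"
      using \<open>card (\<gamma> \<inter> P) \<le> L\<close> by auto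
    also have "(\<Sum>j\<in>{j \<in> {Suc s..L}. j \<le> card (\<gamma> \<inter> P)}. j ^ s) =
        (\<Sum>j=Suc s..L. if j \<le> card (\<gamma> \<inter> P) then j ^ s else 0)"
      by (rule sum.inter_filter) simp
    finally show "card (\<gamma> \<inter> P) choose Suc s \<le> (\<Sum>j=Suc s..L. if j \<le> card (\<gamma> \<inter> P) then j ^ s else 0)" .
  qed
  also have "\<dots> = (\<Sum>j=Suc s..L. \<Sum>\<gamma>\<in>?G. if j \<le> card (\<gamma> \<inter> P) then j ^ s else 0)" by (rule sum.swap)
  also have "\<dots> = (\<Sum>j=Suc s..L. j ^ s * card (rich P j))"
  proof (intro sum.cong refl)
    fix j assume "j \<in> {Suc s..L}"
    hence "{\<gamma> \<in> ?G. j \<le> card (\<gamma> \<inter> P)} = rich P j" by (auto simp: rich_def)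
    thus "(\<Sum>\<gamma>\<in>?G. if j \<le> card (\<gamma> \<inter> P) then j ^ s else 0) = j ^ s * card (rich P j)"
      using sum.inter_filter[OF finG, of "\<lambda>_. j ^ s" "\<lambda>\<gamma>. j \<le> card (\<gamma> \<inter> P)"] by (simp add: mult.commute)
  qed
  finally show ?thesis .
qed

text \<open>The summands correspond to the four cases \<open>T1\<close> to \<open>T4\<close> in
  \<open>card_cotuples_le\<close>.\<close>

definition K :: real where
  "K = real A ^ Suc s * real c + C1 + 4 * (4 * real r) ^ s + 2"

lemma card_cotuples_le:
  assumes P: "finite P" "P \<noteq> {}" and L: "\<And>\<gamma>. \<gamma> \<in> C \<Longrightarrow> card (\<gamma> \<inter> P) \<le> L"
    and Ls: "real L ^ s \<le> real (card P) ^ (s - 1)"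
  shows "real (card (cotuples P)) \<le> K * real (card P) ^ s"
proof -
  define n where "n = real (card P)"
  define E where "E = 4 * r * card P"
  have C1: "C1 \<ge> 0" by (simp add: C1_def)
  have n: "n \<ge> 0" by (simp add: n_def)
  have term_le: "real (j ^ s * card (rich P j)) \<le> (if j < A then real A ^ s * (real c * n ^ s) else 0) +
      C1 * n ^ s * (1 / (real j)\<^sup>2) + (if j < E then 4 * real E ^ (s - 1) else 0) + 2 * n * real L ^ (s - 1)"
    if j: "j \<in> {Suc s..L}" for j
  proof -
    define m where "m = real (card (rich P j))"
    have j1: "real j \<ge> 1" "s \<le> j" using j s by auto
    define T1 where "T1 = (if j < A then real A ^ s * (real c * n ^ s) else 0)"
    define T2 where "T2 = C1 * n ^ s * (1 / (real j)\<^sup>2)"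
    define T3 where "T3 = (if j < E then 4 * real E ^ (s - 1) else 0)"
    define T4 where "T4 = 2 * n * real L ^ (s - 1)"
    have nonneg: "0 \<le> T1" "0 \<le> T2" "0 \<le> T3" "0 \<le> T4"
      using C1 n by (auto simp: T1_def T2_def T3_def T4_def)
    have lhs: "real (j ^ s * card (rich P j)) = real j ^ s * m" by (simp add: m_def)
    \<comment> \<open>The trivial bound serves small \<open>j\<close>, then the cutting bound; its
      alternative of at most \<open>4 * j\<close> curves is affordable only while
      \<open>j ^ 2 < E\<close>, and beyond that the second-moment bound takes over.\<close>
    consider "j < A" | "m * real j ^ (2 * s - 1) \<le> C1 * n ^ s" | "card (rich P j) \<le> 4 * j" "j ^ 2 < E"
      | "card (rich P j) \<le> 4 * j" "E \<le> j ^ 2"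
      using rich_cutting[OF P j1(2)] unfolding m_def n_def by linarith
    hence "real (j ^ s * card (rich P j)) \<le> T1 + T2 + T3 + T4"
    proof cases
      case 1
      have "m \<le> real (c * card P ^ s)" unfolding m_def of_nat_le_iff by (rule rich_trivial(2)[OF P(1) j1(2)])
      hence "real j ^ s * m \<le> real A ^ s * (real c * n ^ s)"
        using 1 by (intro mult_mono power_mono) (auto simp: m_def n_def)
      hence "real j ^ s * m \<le> T1" using 1 by (simp add: T1_def)
      with nonneg show ?thesis unfolding lhs by linarith
    next
      case 2
      have "2 * s - 1 = s + (s - 1)" using s by simp
      hence "(real j ^ s * m) * real j ^ (s - 1) \<le> C1 * n ^ s"
        using 2 by (simp only: power_add mult_ac)
      \<comment> \<open>Here \<open>s \<ge> 3\<close> enters: the remaining exponent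
        \<open>s - 1\<close> is at least 2, so the series over \<open>j\<close> is bounded.\<close>
      moreover have "(real j ^ s * m) * (real j)\<^sup>2 \<le> (real j ^ s * m) * real j ^ (s - 1)"
        using j1 s by (intro mult_left_mono power_increasing) (auto simp: m_def)
      ultimately have "(real j ^ s * m) * (real j)\<^sup>2 \<le> C1 * n ^ s" by linarith
      hence "real j ^ s * m \<le> T2" using j1 by (simp add: T2_def field_simps)
      with nonneg show ?thesis unfolding lhs by linarith
    next
      case 3
      have "j ^ s * card (rich P j) \<le> j ^ s * (4 * j)" using 3 by simp
      also have "\<dots> = 4 * j ^ Suc s" by simp
      \<comment> \<open>The comparison of exponents \<open>Suc s \<le> 2 * (s - 1)\<close> is again
        \<open>s \<ge> 3\<close>. It leaves \<open>E ^ (s - 1)\<close> for each of at most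
        \<open>E\<close> levels.\<close>
      also have "\<dots> \<le> 4 * j ^ (2 * (s - 1))" using j1 s by (intro mult_left_mono power_increasing) auto
      also have "\<dots> \<le> 4 * E ^ (s - 1)" unfolding power_mult using 3 by (intro mult_left_mono power_mono) auto
      finally have "real (j ^ s * card (rich P j)) \<le> real (4 * E ^ (s - 1))" unfolding of_nat_le_iff .
      moreover have "j < E"
      proof -
        have "j \<le> j ^ 2" using j1 by (simp add: power2_eq_square)
        with 3 show ?thesis by linarith
      qed
      ultimately have "real (j ^ s * card (rich P j)) \<le> T3" by (simp add: T3_def)
      with nonneg show ?thesis by linarith
    next
      case 4
      have "card (rich P j) * j \<le> 2 * card P"
        using 4 by (intro rich_large P j1) (simp add: E_def)
      hence "j ^ (s - 1) * (card (rich P j) * j) \<le> L ^ (s - 1) * (2 * card P)"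
        using j by (intro mult_le_mono[OF power_mono \<open>card (rich P j) * j \<le> 2 * card P\<close>]) auto
      moreover have "j ^ s = j ^ (s - 1) * j" using s by (cases s) auto
      ultimately have "j ^ s * card (rich P j) \<le> L ^ (s - 1) * (2 * card P)" by (simp add: mult_ac)
      hence "real (j ^ s * card (rich P j)) \<le> real (L ^ (s - 1) * (2 * card P))" unfolding of_nat_le_iff .
      hence "real (j ^ s * card (rich P j)) \<le> T4" by (simp add: T4_def n_def mult_ac)
      with nonneg show ?thesis by linarith
    qed
    thus ?thesis by (simp only: T1_def T2_def T3_def T4_def)
  qed
  have few: "(\<Sum>j=Suc s..L. if j < N then y else 0) \<le> real N * y" if "0 \<le> y" for N and y :: real
  proof -
    have "(\<Sum>j=Suc s..L. if j < N then y else 0) = real (card ({Suc s..L} \<inter> {j. j < N})) * y"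
      by (simp add: sum.If_cases)
    also have "card ({Suc s..L} \<inter> {j. j < N}) \<le> card {..<N}" by (rule card_mono) auto
    finally show ?thesis using that by (simp add: mult_right_mono)
  qed
  have "real (card (cotuples P)) \<le> real (\<Sum>j=Suc s..L. j ^ s * card (rich P j))"
    unfolding of_nat_le_iff by (rule card_cotuples_le_sum[OF P(1) L])
  also have "\<dots> \<le> (\<Sum>j=Suc s..L. (if j < A then real A ^ s * (real c * n ^ s) else 0) +
      C1 * n ^ s * (1 / (real j)\<^sup>2) + (if j < E then 4 * real E ^ (s - 1) else 0) + 2 * n * real L ^ (s - 1))"
    unfolding of_nat_sum by (intro sum_mono term_le)
  also have "\<dots> = (\<Sum>j=Suc s..L. if j < A then real A ^ s * (real c * n ^ s) else 0) +
      C1 * n ^ s * (\<Sum>j=Suc s..L. 1 / (real j)\<^sup>2) + (\<Sum>j=Suc s..L. if j < E then 4 * real E ^ (s - 1) else 0) +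
      (\<Sum>j=Suc s..L. 2 * n * real L ^ (s - 1))"
    by (simp only: sum.distrib sum_distrib_left)
  also have "\<dots> \<le> real A * (real A ^ s * (real c * n ^ s)) + C1 * n ^ s * 1 + real E * (4 * real E ^ (s - 1)) + 2 * n ^ s"
  proof (intro add_mono)
    show "(\<Sum>j=Suc s..L. if j < A then real A ^ s * (real c * n ^ s) else 0) \<le> real A * (real A ^ s * (real c * n ^ s))"
      using n by (intro few) auto
    show "(\<Sum>j=Suc s..L. if j < E then 4 * real E ^ (s - 1) else 0) \<le> real E * (4 * real E ^ (s - 1))"
      by (intro few) auto
    show "C1 * n ^ s * (\<Sum>j=Suc s..L. 1 / (real j)\<^sup>2) \<le> C1 * n ^ s * 1"
      using C1 n s by (intro mult_left_mono sum_inverse_squares_le) auto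
    have "(\<Sum>j=Suc s..L. 2 * n * real L ^ (s - 1)) = real (card {Suc s..L}) * (2 * n * real L ^ (s - 1))" by simp
    also have "\<dots> \<le> real L * (2 * n * real L ^ (s - 1))" using n by (intro mult_right_mono) auto
    also have "\<dots> = 2 * n * real L ^ s" using s by (cases s) auto
    also have "\<dots> \<le> 2 * n * n ^ (s - 1)" using Ls n by (intro mult_left_mono) (auto simp: n_def)
    also have "\<dots> = 2 * n ^ s" using s by (cases s) auto
    finally show "(\<Sum>j=Suc s..L. 2 * n * real L ^ (s - 1)) \<le> 2 * n ^ s" .
  qed
  also have "real E * (4 * real E ^ (s - 1)) = 4 * (4 * real r) ^ s * n ^ s"
  proof -
    have "real E * (4 * real E ^ (s - 1)) = 4 * real E ^ s" using s by (cases s) auto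
    thus ?thesis by (simp add: E_def n_def power_mult_distrib)
  qed
  finally show ?thesis by (simp add: K_def n_def algebra_simps)
qed

section \<open>Extraction of the large subset\<close>

lemma K_ge: "K \<ge> 2"
  by (simp add: K_def C1_def)

lemma large_subset_few_per_curve:
  assumes P: "finite P" and poor: "\<And>\<gamma>. \<gamma> \<in> C \<Longrightarrow> real (card (\<gamma> \<inter> P)) < real (card P) powr (1 - 1 / real s)"
  shows "\<exists>Q\<subseteq>P. 1 / (4 * (2 * K) powr (1 / real s)) * real (card P) powr (1 / real s) \<le> real (card Q) \<and>
    (\<forall>\<gamma>\<in>C. card (Q \<inter> \<gamma>) \<le> s)"
proof (cases "P = {}")
  case True
  thus ?thesis using s by auto
next
  case False
  define n where "n = real (card P)"
  \<comment> \<open>Since \<open>x ^ s = n / (2 * K)\<close>, a sparsest subset of \<open>t\<close>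
    points, \<open>t\<close> being \<open>x\<close> rounded down, contains at most
    \<open>K * n ^ s * (t / n) ^ (s + 1) \<le> t / 2\<close> bad tuples. Rounding and deletion each
    cost at most a factor 2, whence \<open>x / 4\<close>.\<close>
  define x where "x = (n / (2 * K)) powr (1 / real s)"
  have n1: "n \<ge> 1" using False P by (simp add: n_def Suc_leI card_gt_0_iff)
  have goal: "1 / (4 * (2 * K) powr (1 / real s)) * real (card P) powr (1 / real s) = x / 4"
    using K_ge n1 unfolding x_def n_def[symmetric] by (simp add: powr_divide)
  show ?thesis
  proof (cases "x < 1")
    \<comment> \<open>The required size is below 1, so a single point suffices.\<close>
    case True
    obtain p where "p \<in> P" using False by blast
    moreover have "card ({p} \<inter> \<gamma>) \<le> s" for \<gamma>
    proof -
      have "card ({p} \<inter> \<gamma>) \<le> card {p}" by (rule card_mono) auto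
      with s show ?thesis by simp
    qed
    ultimately show ?thesis unfolding goal using True by (intro exI[of _ "{p}"]) auto
  next
    case x1: False
    define t where "t = nat \<lfloor>x\<rfloor>"
    have t: "real t \<le> x" "x / 2 \<le> real t" "1 \<le> t" 
    proof -
      have "1 \<le> \<lfloor>x\<rfloor>" using x1 by simp
      hence "real t = real_of_int \<lfloor>x\<rfloor>" "1 \<le> t" unfolding t_def by linarith+
      thus "real t \<le> x" "x / 2 \<le> real t" "1 \<le> t" using \<open>1 \<le> \<lfloor>x\<rfloor>\<close> by linarith+
    qed
    have "real t ^ s \<le> x ^ s" using t by (intro power_mono) auto
    also have "x ^ s = n / (2 * K)"
      using s K_ge n1 by (simp add: x_def powr_powr flip: powr_realpow')
    finally have ts: "real t ^ s \<le> n / (2 * K)" .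
    have "real t \<le> real t ^ s" using t s by (intro self_le_power) auto
    also note ts
    also have "n / (2 * K) \<le> n / 1" using K_ge n1 by (intro divide_left_mono) auto
    finally have tn: "t \<le> card P" by (simp add: n_def)
    define L where "L = nat \<lfloor>n powr (1 - 1 / real s)\<rfloor>"
    have L: "real L \<le> n powr (1 - 1 / real s)" unfolding L_def by simp
    have "real L ^ s \<le> (n powr (1 - 1 / real s)) ^ s" using L by (intro power_mono) auto
    also have "\<dots> = n powr (real (s - 1))"
    proof -
      have "(1 - 1 / real s) * real s = real (s - 1)" using s by (simp add: of_nat_diff field_simps)
      thus ?thesis using n1 by (simp add: powr_powr flip: powr_realpow)
    qed
    also have "\<dots> = n ^ (s - 1)" using n1 by (simp add: powr_realpow)
    finally have Ls: "real L ^ s \<le> real (card P) ^ (s - 1)" by (simp add: n_def)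
    have "card (\<gamma> \<inter> P) \<le> L" if "\<gamma> \<in> C" for \<gamma>
      using poor[OF that] unfolding L_def n_def[symmetric] by linarith
    from card_cotuples_le[OF P False this Ls]
    have H: "real (card (cotuples P)) \<le> K * n ^ s" by (simp add: n_def)
    obtain Y where Y: "Y \<subseteq> P" "card Y = t"
      "real (card {S \<in> cotuples P. S \<subseteq> Y}) * n ^ Suc s \<le> real (card (cotuples P)) * real t ^ Suc s"
      using exists_sparse_subset[OF P _ tn, of "cotuples P" "Suc s"] unfolding n_def cotuples_def by blast
    let ?H = "{S \<in> cotuples P. S \<subseteq> Y}"
    have finY: "finite Y" using Y P finite_subset by blast
    have "real (card ?H) * n ^ Suc s \<le> (K * n ^ s) * (real t * real t ^ s)"
      using order_trans[OF Y(3) mult_right_mono[OF H]] by simp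
    also have "\<dots> \<le> (K * n ^ s) * (real t * (n / (2 * K)))"
      using ts K_ge n1 by (intro mult_left_mono) auto
    also have "\<dots> = real t / 2 * n ^ Suc s" using K_ge by simp
    finally have "real (card ?H) * n ^ Suc s \<le> real t / 2 * n ^ Suc s" .
    moreover have "n ^ Suc s > 0" using n1 by simp
    ultimately have few: "real (card ?H) \<le> real t / 2" by (rule mult_right_le_imp_le)
    obtain Z where Z: "Z \<subseteq> Y" "card Y \<le> card Z + card ?H" "\<forall>S\<in>?H. \<not> S \<subseteq> Z"
    proof -
      have "?H \<subseteq> Pow Y" by blast
      hence "finite ?H" using finY finite_subset by blast
      moreover have "S \<noteq> {}" if "S \<in> ?H" for S using that by (auto simp: cotuples_def)
      ultimately have "\<exists>Z\<subseteq>Y. card Y \<le> card Z + card ?H \<and> (\<forall>S\<in>?H. \<not> S \<subseteq> Z)"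
        by (rule remove_edges[OF finY])
      thus ?thesis using that by blast
    qed
    have "real t \<le> real (card Z) + real (card ?H)" using Z(2) Y(2) by linarith
    with few t have big: "x / 4 \<le> real (card Z)" by linarith
    have "card (Z \<inter> \<gamma>) \<le> s" if \<gamma>: "\<gamma> \<in> C" for \<gamma>
    proof (rule ccontr)
      assume "\<not> ?thesis"
      hence "Suc s \<le> card (Z \<inter> \<gamma>)" by simp
      then obtain S where S: "S \<subseteq> Z \<inter> \<gamma>" "card S = Suc s" by (rule obtain_subset_with_card_n) auto
      hence "S \<in> ?H" using Z(1) Y(1) \<gamma> unfolding cotuples_def by blast
      with Z(3) S show False by blast
    qed
    with big Z(1) Y(1) show ?thesis unfolding goal by blast
  qed
qed

end

theorem theorem23:
  fixes s d r c :: nat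
  assumes "s > 2"
  shows "\<exists>a b :: real. 0 < a \<and> 0 < b \<and>
    (\<forall>C :: (real \<times> real) set set.
       (\<forall>\<gamma>\<in>C. algebraic_curve_of_degree_le d \<gamma>) \<and>
       multiplicity_type C r \<and>
       degrees_of_freedom C = s \<and>
       at_most_curves_through C s c \<longrightarrow>
       (\<forall>(P :: (real \<times> real) set) n. finite P \<and> card P = n \<longrightarrow>
          (\<exists>\<gamma>\<in>C. \<exists>Q\<subseteq>P. a * real n powr (1 - 1 / real s) \<le> real (card Q) \<and> Q \<subseteq> \<gamma>) \<or>
          (\<exists>Q\<subseteq>P. b * real n powr (1 / real s) \<le> real (card Q) \<and>
             (\<forall>\<gamma>\<in>C. card (Q \<inter> \<gamma>) \<le> s))))"
proof -
  define K0 where "K0 = curve_family.K s d r c"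
  \<comment> \<open>\<open>K\<close> depends only on \<open>s\<close>, \<open>d\<close>,
    \<open>r\<close> and \<open>c\<close>, so the empty family already yields its lower bound,
    before any \<open>C\<close> is fixed. This makes the constants uniform over all
    families.\<close>
  have "curve_family {} s d r c"
    using assms by unfold_locales (auto simp: multiplicity_type_def at_most_curves_through_def)
  hence K0: "K0 \<ge> 2" unfolding K0_def by (rule curve_family.K_ge)
  show ?thesis
  proof (rule exI[of _ "1 :: real"], rule exI[of _ "1 / (4 * (2 * K0) powr (1 / real s))"], intro conjI allI impI)
    show "0 < 1 / (4 * (2 * K0) powr (1 / real s))" using K0 by simp
    fix C :: "(real \<times> real) set set" and P :: "(real \<times> real) set" and n :: nat
    assume C: "(\<forall>\<gamma>\<in>C. algebraic_curve_of_degree_le d \<gamma>) \<and> multiplicity_type C r \<and>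
       degrees_of_freedom C = s \<and> at_most_curves_through C s c"
      and P: "finite P \<and> card P = n"
    interpret curve_family C s d r c using C assms by unfold_locales auto
    show "(\<exists>\<gamma>\<in>C. \<exists>Q\<subseteq>P. 1 * real n powr (1 - 1 / real s) \<le> real (card Q) \<and> Q \<subseteq> \<gamma>) \<or>
          (\<exists>Q\<subseteq>P. 1 / (4 * (2 * K0) powr (1 / real s)) * real n powr (1 / real s) \<le> real (card Q) \<and>
             (\<forall>\<gamma>\<in>C. card (Q \<inter> \<gamma>) \<le> s))"
    proof (cases "\<exists>\<gamma>\<in>C. real n powr (1 - 1 / real s) \<le> real (card (\<gamma> \<inter> P))")
      case True
      then obtain \<gamma> where "\<gamma> \<in> C" "real n powr (1 - 1 / real s) \<le> real (card (\<gamma> \<inter> P))" by blast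
      thus ?thesis by (intro disjI1 bexI[of _ \<gamma>] exI[of _ "\<gamma> \<inter> P"]) auto
    next
      case False
      with P have "\<And>\<gamma>. \<gamma> \<in> C \<Longrightarrow> real (card (\<gamma> \<inter> P)) < real (card P) powr (1 - 1 / real s)"
        by (auto simp: not_le)
      from large_subset_few_per_curve[OF conjunct1[OF P] this] P show ?thesis unfolding K0_def by (intro disjI2) simp
    qed
  qed simp
qed

end
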